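(* Let $a$ be a known $1$-periodic function on $[0,1]^d$ and $Af=a*f$ the (periodic) convolution operator. For $k=1,\dots,d$ let $a_k(y_k)=\int a(y)\prod_{l\ne k}dy_l$ be the $k$-th marginal of $a$; assume that $a_k$ is a $1$-periodic function in $L_2([0,1])$ with expansion $a_k=\sum_{j=0}^\infty b_{kj}\phi_{kj}$, where $\phi_{k0}=1$ and $\phi_{kj}(t)=\sqrt2\cos(2\pi jt)$ for $j\ge1$, and that $$C_2j^{-q_k}\le b_{kj}\le C_3j^{-q_k},\qquad j\ge1,$$ for some $q_k\ge0$ and $C_2,C_3>0$. Let $\mathcal F=\mathcal F_1\oplus\cdots\oplus\mathcal F_d$ be the class of functions $f(x)=f_1(x_1)+\cdots+f_d(x_d)$ on $[0,1]^d$ with $f_k\in\mathcal F_k$, where $$\mathcal F_k=\Big\{\sum_{j=1}^\infty\theta_{kj}\phi_{kj}:\ \sum_{j=1}^\infty a_{kj}^2\theta_{kj}^2\le L_k^2\Big\},$$ $L_k>0$, $s_k>0$, and $c_1j^{s_k}\le a_{kj}\le c_2j^{s_k}$ for all $j\ge1$ with positive constants $c_1,c_2$. Put $$\alpha=\min_{k=1,\dots,d}\frac{2s_k}{2s_k+2q_k+1}.$$ Then, in the Gaussian white noise model, $$\limsup_{n\to\infty}\ n^{\alpha}\sup_{f\in\mathcal F}E_f\|\hat f-f\|_2^2<\infty,$$ where $\hat f$ is the $\delta$-net estimator described in the context. Also $$\liminf_{n\to\infty}\ n^{\alpha}\inf_{\hat g}\sup_{f\in\mathcal F}E_f\|\hat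 g-f\|_2^2>0,$$ where the infimum is over all estimators $\hat g$ in the white noise model.
   Context: Gaussian white noise model: one observes $dY_n(y)=(Af)(y)\,dy+n^{-1/2}dW(y)$, $y\in[0,1]^d$, where for $h_1,h_2\in L_2([0,1]^d)$ the vector $(\int h_1dW,\int h_2dW)$ is centered Gaussian with variances $\|h_1\|_2^2,\|h_2\|_2^2$ and covariance $\int h_1h_2$. For additive $f$ one has $(Af)(x)=\sum_k(A_kf_k)(x_k)$ with $(A_kf_k)(x_k)=\int_0^1f_k(x_k-y_k)a_k(y_k)\,dy_k$. $Q=(A^{-1})^*$ acts on finite linear combinations of the functions $x\mapsto\phi_{kj}(x_k)$, $j\ge1$: since $A_k\phi_{kj}=\kappa_{kj}\phi_{kj}$ with $\kappa_{kj}=b_{kj}/\sqrt2$, $Q$ is linear with $Q\phi_{kj}=\kappa_{kj}^{-1}\phi_{kj}$. Empirical risk: $\gamma_n(g)=-2\int(Qg)\,dY_n+\|g\|_2^2$. $\delta$-net estimator: $\hat f=\operatorname{argmin}_{\phi\in\mathcal N_n}\gamma_n(\phi)$, where $\mathcal N_n=\{\phi_1(x_1)+\cdots+\phi_d(x_d):\phi_k\in\mathcal F_{k,\delta_k}\}$, $\delta_k=n^{-s_k/(2s_k+2q_k+1)}$, and $\mathcal F_{k,\delta}$ is a finite $\delta$-net of $\mathcal F_k$ in $L_2([0,1])$ (every $f_k\in\mathcal F_k$ is within $L_2$ distance $\delta$ of an element of it), consisting of linear combinations of $\phi_{k1},\dots,\phi_{kM}$ with $M\le K\delta^{-1/s_k}$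 and satisfying $\log(\#\mathcal F_{k,\delta})\le K'\delta^{-1/s_k}$ for all small $\delta$, with $K,K'$ not depending on $\delta$ (such nets exist). *)

theory Defs
  imports "HOL-Probability.Probability"
begin

section \<open>The function spaces\<close>

text \<open>Points of the cube are functions on a finite index type \<open>'d\<close> (so the dimension is at least
  one). Elements of \<open>L\<^sub>2\<close> are represented by functions; functions on the torus by
  1-periodic functions on the whole space.\<close>

definition unit_leb :: "real measure" where
  "unit_leb = restrict_space lborel {0..1}"

definition cube_leb :: "('d::finite \<Rightarrow> real) measure" where
  "cube_leb = (\<Pi>\<^sub>M k\<in>UNIV. unit_leb)"

definition L2 :: "'a measure \<Rightarrow> ('a \<Rightarrow> real) set" where
  "L2 M = {f. f \<in> borel_measurable M \<and> integrable M (\<lambda>x. (f x)\<^sup>2)}"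

definition L2_norm :: "'a measure \<Rightarrow> ('a \<Rightarrow> real) \<Rightarrow> real" where
  "L2_norm M f = sqrt (LINT x|M. (f x)\<^sup>2)"

definition L2_inner :: "'a measure \<Rightarrow> ('a \<Rightarrow> real) \<Rightarrow> ('a \<Rightarrow> real) \<Rightarrow> real" where
  "L2_inner M f g = (LINT x|M. f x * g x)"

definition L2_sums :: "'a measure \<Rightarrow> (nat \<Rightarrow> 'a \<Rightarrow> real) \<Rightarrow> ('a \<Rightarrow> real) \<Rightarrow> bool" where
  "L2_sums M g f \<longleftrightarrow> (\<lambda>N. L2_norm M (\<lambda>x. f x - (\<Sum>j<N. g j x))) \<longlonglongrightarrow> 0"

definition periodic1 :: "(real \<Rightarrow> real) \<Rightarrow> bool" where
  "periodic1 f \<longleftrightarrow> (\<forall>t. f (t + 1) = f t)"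

definition cos_basis :: "nat \<Rightarrow> real \<Rightarrow> real" where
  "cos_basis j t = (if j = 0 then 1 else sqrt 2 * cos (2 * pi * real j * t))"

text \<open>The series is indexed from \<open>j = 1\<close>, hence the \<open>Suc\<close>.\<close>

definition ellipsoid :: "(nat \<Rightarrow> real) \<Rightarrow> real \<Rightarrow> (real \<Rightarrow> real) set" where
  "ellipsoid w L = {f. f \<in> borel_measurable borel \<and> periodic1 f \<and> f \<in> L2 unit_leb \<and>
     (\<exists>\<theta>. summable (\<lambda>j. (w (Suc j))\<^sup>2 * (\<theta> (Suc j))\<^sup>2) \<and>
          (\<Sum>j. (w (Suc j))\<^sup>2 * (\<theta> (Suc j))\<^sup>2) \<le> L\<^sup>2 \<and>
          L2_sums unit_leb (\<lambda>j t. \<theta> (Suc j) * cos_basis (Suc j) t) f)}"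

definition additive_class :: "('d::finite \<Rightarrow> (real \<Rightarrow> real) set) \<Rightarrow> (('d \<Rightarrow> real) \<Rightarrow> real) set" where
  "additive_class F = {\<lambda>x. \<Sum>k\<in>UNIV. f k (x k) | f. \<forall>k. f k \<in> F k}"


section \<open>The convolution operator\<close>

definition marginal :: "'d::finite \<Rightarrow> (('d \<Rightarrow> real) \<Rightarrow> real) \<Rightarrow> real \<Rightarrow> real" where
  "marginal k a t = (LINT z|(\<Pi>\<^sub>M l\<in>UNIV - {k}. unit_leb). a (z(k := t)))"

text \<open>This is periodic convolution when \<open>f\<close> is 1-periodic in each coordinate, as all members of
  an additive class over ellipsoids are.\<close>

definition conv :: "(('d::finite \<Rightarrow> real) \<Rightarrow> real) \<Rightarrow> (('d \<Rightarrow> real) \<Rightarrow> real) \<Rightarrow> ('d \<Rightarrow> real) \<Rightarrow> real" where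
  "conv a f x = (LINT y|cube_leb. f (\<lambda>k. x k - y k) * a y)"

definition trig_span :: "(('d::finite \<Rightarrow> real) \<Rightarrow> real) set" where
  "trig_span = {\<lambda>x. \<Sum>k\<in>UNIV. \<Sum>j=1..m. \<theta> k j * cos_basis j (x k) | \<theta> m. True}"

text \<open>Convolution by a function with cosine coefficients \<open>b\<close> multiplies the \<open>j\<close>-th basis function
  (\<open>j \<ge> 1\<close>) by \<open>b\<^sub>j / \<surd>2\<close>. The functions occurring below are linearly independent, so \<open>Q\<close> exists
  and is uniquely determined on \<open>trig_span\<close>.\<close>

definition inverse_adjoint ::
  "('d::finite \<Rightarrow> nat \<Rightarrow> real) \<Rightarrow> ((('d \<Rightarrow> real) \<Rightarrow> real) \<Rightarrow> (('d \<Rightarrow> real) \<Rightarrow> real)) \<Rightarrow> bool" where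
  "inverse_adjoint b Q \<longleftrightarrow>
     (\<forall>g\<in>trig_span. \<forall>h\<in>trig_span. Q (\<lambda>x. g x + h x) = (\<lambda>x. Q g x + Q h x)) \<and>
     (\<forall>c. \<forall>g\<in>trig_span. Q (\<lambda>x. c * g x) = (\<lambda>x. c * Q g x)) \<and>
     (\<forall>k. \<forall>j\<ge>1. Q (\<lambda>x. cos_basis j (x k)) = (\<lambda>x. inverse (b k j / sqrt 2) * cos_basis j (x k)))"


section \<open>The Gaussian white noise model\<close>

definition centered_normal :: "real \<Rightarrow> real measure" where
  "centered_normal v = (if v = 0 then return borel 0
     else density lborel (\<lambda>x. ennreal (normal_density 0 (sqrt v) x)))"

text \<open>A pair is Gaussian iff all its linear combinations are normal, possibly degenerate. Applied
  to all pairs, this makes the whole process jointly Gaussian and almost surely linear.\<close>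

definition white_noise :: "'w measure \<Rightarrow> ((('d::finite \<Rightarrow> real) \<Rightarrow> real) \<Rightarrow> 'w \<Rightarrow> real) \<Rightarrow> bool" where
  "white_noise M W \<longleftrightarrow> prob_space M \<and>
     (\<forall>h\<in>L2 cube_leb. W h \<in> borel_measurable M) \<and>
     (\<forall>h\<^sub>1\<in>L2 cube_leb. \<forall>h\<^sub>2\<in>L2 cube_leb. \<forall>u v.
        distr M borel (\<lambda>\<omega>. u * W h\<^sub>1 \<omega> + v * W h\<^sub>2 \<omega>) =
        centered_normal (u\<^sup>2 * (L2_norm cube_leb h\<^sub>1)\<^sup>2 + 2 * u * v * L2_inner cube_leb h\<^sub>1 h\<^sub>2
          + v\<^sup>2 * (L2_norm cube_leb h\<^sub>2)\<^sup>2))"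

text \<open>The data are the family of all values \<open>\<integral> h dY\<^sub>n\<close> with \<open>h\<close> in \<open>L\<^sub>2\<close> of the cube.\<close>

type_synonym 'd data = "(('d \<Rightarrow> real) \<Rightarrow> real) \<Rightarrow> real"

definition data_space :: "'d::finite data measure" where
  "data_space = (\<Pi>\<^sub>M h\<in>L2 cube_leb. borel)"

definition observation ::
  "(('d::finite \<Rightarrow> real) \<Rightarrow> real) \<Rightarrow> ((('d \<Rightarrow> real) \<Rightarrow> real) \<Rightarrow> 'w \<Rightarrow> real) \<Rightarrow> nat
     \<Rightarrow> (('d \<Rightarrow> real) \<Rightarrow> real) \<Rightarrow> 'w \<Rightarrow> 'd data" where
  "observation a W n f \<omega> =
     (\<lambda>h\<in>L2 cube_leb. L2_inner cube_leb h (conv a f) + real n powr (- 1 / 2) * W h \<omega>)"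

text \<open>Measurability of all distances to fixed points is Borel measurability into \<open>L\<^sub>2\<close>, which is
  separable.\<close>

definition estimators :: "('d::finite data \<Rightarrow> ('d \<Rightarrow> real) \<Rightarrow> real) set" where
  "estimators = {T. (\<forall>y\<in>space data_space. T y \<in> L2 cube_leb) \<and>
     (\<forall>g\<in>L2 cube_leb. (\<lambda>y. L2_norm cube_leb (\<lambda>x. T y x - g x)) \<in> borel_measurable data_space)}"

definition risk ::
  "(('d::finite \<Rightarrow> real) \<Rightarrow> real) \<Rightarrow> 'w measure \<Rightarrow> ((('d \<Rightarrow> real) \<Rightarrow> real) \<Rightarrow> 'w \<Rightarrow> real) \<Rightarrow> nat
     \<Rightarrow> ('d data \<Rightarrow> ('d \<Rightarrow> real) \<Rightarrow> real) \<Rightarrow> (('d \<Rightarrow> real) \<Rightarrow> real) \<Rightarrow> ennreal" where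
  "risk a M W n T f =
     (\<integral>\<^sup>+\<omega>. ennreal ((L2_norm cube_leb (\<lambda>x. T (observation a W n f \<omega>) x - f x))\<^sup>2) \<partial>M)"


section \<open>The net estimator\<close>

definition empirical_risk ::
  "((('d::finite \<Rightarrow> real) \<Rightarrow> real) \<Rightarrow> (('d \<Rightarrow> real) \<Rightarrow> real)) \<Rightarrow> 'd data
     \<Rightarrow> (('d \<Rightarrow> real) \<Rightarrow> real) \<Rightarrow> real" where
  "empirical_risk Q y g = - 2 * y (Q g) + (L2_norm cube_leb g)\<^sup>2"

definition trig_polys :: "nat \<Rightarrow> (real \<Rightarrow> real) set" where
  "trig_polys m = {\<lambda>t. \<Sum>j=1..m. \<theta> j * cos_basis j t | \<theta>. True}"

definition delta_nets :: "(real \<Rightarrow> real) set \<Rightarrow> real \<Rightarrow> (real \<Rightarrow> (real \<Rightarrow> real) set) \<Rightarrow> bool" where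
  "delta_nets F s net \<longleftrightarrow>
     (\<forall>\<delta>>0. finite (net \<delta>) \<and> (\<exists>m. net \<delta> \<subseteq> trig_polys m) \<and>
        (\<forall>f\<in>F. \<exists>g\<in>net \<delta>. L2_norm unit_leb (\<lambda>t. f t - g t) \<le> \<delta>)) \<and>
     (\<exists>K K'. \<forall>\<^sub>F \<delta> in at_right 0.
        (\<exists>m. real m \<le> K * \<delta> powr (- 1 / s) \<and> net \<delta> \<subseteq> trig_polys m) \<and>
        ln (real (card (net \<delta>))) \<le> K' * \<delta> powr (- 1 / s))"

definition net_radius :: "real \<Rightarrow> real \<Rightarrow> nat \<Rightarrow> real" where
  "net_radius s q n = real n powr (- s / (2 * s + 2 * q + 1))"

text \<open>The minimiser is almost surely unique; ties may be broken in any measurable way.\<close>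

definition net_estimator ::
  "((('d::finite \<Rightarrow> real) \<Rightarrow> real) \<Rightarrow> (('d \<Rightarrow> real) \<Rightarrow> real)) \<Rightarrow> (('d \<Rightarrow> real) \<Rightarrow> real) set
     \<Rightarrow> ('d data \<Rightarrow> ('d \<Rightarrow> real) \<Rightarrow> real) \<Rightarrow> bool" where
  "net_estimator Q N T \<longleftrightarrow> T \<in> estimators \<and>
     (\<forall>y\<in>space data_space. is_arg_min (empirical_risk Q y) (\<lambda>g. g \<in> N) (T y))"

end

(*
  Upper bound: the empirical risk of an additive function is almost surely the sum of the empirical
  risks of its components, since functions of different coordinates with mean zero are orthogonal
  and the noise is almost surely linear. Hence the estimator splits into d one-dimensional
  estimators. For each of them, comparison with the net point nearest to f_k leaves the noise at
  Q(g - g0), which is a centred normal variable with standard deviation at most rho_k |g - g0|,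
  where rho_k bounds the norm of Q on trigonometric polynomials of the degree of the net. A maximal
  inequality over the net gives the error delta_k^2 + rho_k^2 log(#net) / n, of order delta_k^2.

  Lower bound: Assouad's lemma for the functions sum_j (+-eta) phi_kj(x_k), N < j <= 2N, in the
  coordinate k with the worst rate. The two hypotheses that differ in the sign of one coefficient
  differ by a shift of the data along one unit vector u. The noise has the same law as
  W - <., u> W(u) + Z <., u> with Z standard normal and independent of W, so they reduce to two
  normal distributions on the line.
*)

theory Submission
  imports Defs
begin

section \<open>Uniqueness of characteristic functions on product spaces\<close>

text \<open>An estimator is an arbitrary measurable function on a product over the uncountable set
  \<open>L2 cube_leb\<close>, while the noise is given only by the laws of its pairs. Altering the
  noise in one direction inside the risk therefore needs equality of laws on the whole product, and
  \<open>PiM_borel_eqI_char\<close> obtains it from characteristic functions of finite linear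
  combinations. The constants come from one balance, with p = 2s + 2q + 1. At \<delta> = n^(-s/p)
  the degree and log-cardinality of a net are at most of order \<delta>^(-1/s) = n^(1/p), so \<rho>
  is of order n^(q/p) and the noise term n^(-1) n^(2q/p) n^(1/p) equals n^(-2s/p) = \<delta>^2. In
  the lower bound N is of order n^(1/p) and \<eta>^2 of order N^(-2s-1): N coefficients of this size
  fit into the ellipsoid, convolution shrinks them to order N^(-s-q-1/2), the noise level n^(-1/2),
  and the N errors add up to order n^(-2s/p). The noise is measured relative to |g - g0|, so that
  part of it is absorbed by the loss on the left.\<close>

text \<open>Divided by their common mass, the weights become densities, and the weighted laws of
  \<open>X1\<close> and \<open>X2\<close> are probability laws on the line with equal characteristic
  functions; Levy's theorem applies.\<close>

lemma weighted_law_eqI_char: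
  fixes X1 :: "'a \<Rightarrow> real" and X2 :: "'b \<Rightarrow> real" and D1 :: "'a \<Rightarrow> real" and D2 :: "'b \<Rightarrow> real"
  assumes N: "prob_space N1" "prob_space N2"
    and X[measurable]: "X1 \<in> borel_measurable N1" "X2 \<in> borel_measurable N2"
    and D[measurable]: "D1 \<in> borel_measurable N1" "D2 \<in> borel_measurable N2"
    and D1: "\<And>x. 0 \<le> D1 x" "\<And>x. D1 x \<le> K" and D2: "\<And>x. 0 \<le> D2 x" "\<And>x. D2 x \<le> K"
    and eq: "\<And>t. (\<integral>x. D1 x *\<^sub>R iexp (t * X1 x) \<partial>N1) = (\<integral>x. D2 x *\<^sub>R iexp (t * X2 x) \<partial>N2)"
    and B[measurable]: "B \<in> sets borel"
  shows "(\<integral>x. D1 x * indicator B (X1 x) \<partial>N1) = (\<integral>x. D2 x * indicator B (X2 x) \<partial>N2)"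
proof -
  interpret N1: prob_space N1 by fact
  interpret N2: prob_space N2 by fact
  have i1: "integrable N1 D1"
    by (rule N1.integrable_const_bound[where B=K]) (use D1 in auto)
  have i2: "integrable N2 D2"
    by (rule N2.integrable_const_bound[where B=K]) (use D2 in auto)
  define c where "c = (\<integral>x. D1 x \<partial>N1)"
  \<comment> \<open>At t = 0 the hypothesis says that the two masses agree.\<close>
  have "complex_of_real (\<integral>x. D1 x \<partial>N1) = complex_of_real (\<integral>x. D2 x \<partial>N2)"
    using eq[of 0] i1 i2 by (simp add: scaleR_conv_of_real)
  then have c2: "c = (\<integral>x. D2 x \<partial>N2)"
    by (simp only: c_def of_real_eq_iff)
  have c0: "c \<ge> 0" unfolding c_def by (intro integral_nonneg_AE) (use D1 in auto)
  show ?thesis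
  proof (cases "c = 0")
    \<comment> \<open>Zero mass cannot be normalised; both weights then vanish almost
      everywhere.\<close>
    case True
    have "AE x in N1. D1 x = 0"
      using integral_nonneg_eq_0_iff_AE[OF i1] D1 True by (simp add: c_def)
    moreover have "AE x in N2. D2 x = 0"
      using integral_nonneg_eq_0_iff_AE[OF i2] D2 True c2 by simp
    ultimately show ?thesis
      by (subst (1 2) integral_eq_zero_AE) (auto elim!: eventually_mono)
  next
    case False
    with c0 have c: "c > 0" by simp
    define P1 where "P1 = distr (density N1 (\<lambda>x. ennreal (D1 x / c))) borel X1"
    define P2 where "P2 = distr (density N2 (\<lambda>x. ennreal (D2 x / c))) borel X2"
    have p1: "prob_space (density N1 (\<lambda>x. ennreal (D1 x / c)))"
    proof
      have "(\<integral>\<^sup>+x. ennreal (D1 x / c) \<partial>N1) = ennreal (\<integral>x. D1 x / c \<partial>N1)"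
        by (rule nn_integral_eq_integral) (use i1 D1 c in auto)
      also have "(\<integral>x. D1 x / c \<partial>N1) = 1" using c by (simp add: c_def[symmetric])
      finally show "emeasure (density N1 (\<lambda>x. ennreal (D1 x / c))) (space (density N1 (\<lambda>x. ennreal (D1 x / c)))) = 1"
        by (simp add: emeasure_density cong: nn_integral_cong)
    qed
    have p2: "prob_space (density N2 (\<lambda>x. ennreal (D2 x / c)))"
    proof
      have "(\<integral>\<^sup>+x. ennreal (D2 x / c) \<partial>N2) = ennreal (\<integral>x. D2 x / c \<partial>N2)"
        by (rule nn_integral_eq_integral) (use i2 D2 c in auto)
      also have "(\<integral>x. D2 x / c \<partial>N2) = 1" using c by (simp add: c2[symmetric])
      finally show "emeasure (density N2 (\<lambda>x. ennreal (D2 x / c))) (space (density N2 (\<lambda>x. ennreal (D2 x / c)))) = 1"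
        by (simp add: emeasure_density cong: nn_integral_cong)
    qed
    have P1: "real_distribution P1" unfolding P1_def real_distribution_def real_distribution_axioms_def
      by (auto intro!: prob_space.prob_space_distr p1)
    have P2: "real_distribution P2" unfolding P2_def real_distribution_def real_distribution_axioms_def
      by (auto intro!: prob_space.prob_space_distr p2)
    have e1: "integral\<^sup>L P1 f = (\<integral>x. D1 x *\<^sub>R f (X1 x) \<partial>N1) /\<^sub>R c"
      if [measurable]: "f \<in> borel_measurable borel" for f :: "real \<Rightarrow> 'c::{banach, second_countable_topology}"
      unfolding P1_def using c D1
      by (simp add: integral_distr integral_density divide_inverse mult.commute[of _ "inverse c"]
          flip: scaleR_scaleR)
    have e2: "integral\<^sup>L P2 f = (\<integral>x. D2 x *\<^sub>R f (X2 x) \<partial>N2) /\<^sub>R c"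
      if [measurable]: "f \<in> borel_measurable borel" for f :: "real \<Rightarrow> 'c::{banach, second_countable_topology}"
      unfolding P2_def using c D2
      by (simp add: integral_distr integral_density divide_inverse mult.commute[of _ "inverse c"]
          flip: scaleR_scaleR)
    have "char P1 = char P2"
      unfolding char_def fun_eq_iff using eq by (simp add: e1 e2)
    with P1 P2 have "P1 = P2" by (rule Levy_uniqueness)
    then have "integral\<^sup>L P1 (indicator B :: real \<Rightarrow> real) = integral\<^sup>L P2 (indicator B)" by simp
    moreover have iB: "(indicator B :: real \<Rightarrow> real) \<in> borel_measurable borel" by measurable
    ultimately have "(\<integral>x. D1 x *\<^sub>R (indicator B (X1 x) :: real) \<partial>N1) /\<^sub>R c = (\<integral>x. D2 x *\<^sub>R indicator B (X2 x) \<partial>N2) /\<^sub>R (c :: real)"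
      by (simp only: e1[OF iB] e2[OF iB])
    then show ?thesis using c by simp
  qed
qed

text \<open>The finite index set and the coefficients are hidden, so that closure under sums and
  multiples needs no bookkeeping in the induction below.\<close>

definition fin_lin :: "'i set \<Rightarrow> (('i \<Rightarrow> real) \<Rightarrow> real) \<Rightarrow> bool" where
  "fin_lin I Y \<longleftrightarrow> (\<exists>J t. finite J \<and> J \<subseteq> I \<and> Y = (\<lambda>y. \<Sum>h\<in>J. t h * y h))"

lemma fin_lin_add:
  assumes "fin_lin I Y" "fin_lin I Z"
  shows "fin_lin I (\<lambda>y. Y y + Z y)"
proof -
  from assms obtain J t K r where Y: "finite J" "J \<subseteq> I" "Y = (\<lambda>y. \<Sum>h\<in>J. t h * y h)"
    and Z: "finite K" "K \<subseteq> I" "Z = (\<lambda>y. \<Sum>h\<in>K. r h * y h)"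
    unfolding fin_lin_def by blast
  have "(\<Sum>h\<in>J. t h * y h) = (\<Sum>h\<in>J\<union>K. (if h \<in> J then t h else 0) * y h)" for y :: "'a \<Rightarrow> real"
    using Y Z by (intro sum.mono_neutral_cong_left) auto
  moreover have "(\<Sum>h\<in>K. r h * y h) = (\<Sum>h\<in>J\<union>K. (if h \<in> K then r h else 0) * y h)" for y :: "'a \<Rightarrow> real"
    using Y Z by (intro sum.mono_neutral_cong_left) auto
  ultimately have "(\<lambda>y. Y y + Z y) =
      (\<lambda>y. \<Sum>h\<in>J\<union>K. ((if h \<in> J then t h else 0) + (if h \<in> K then r h else 0)) * y h)"
    by (simp add: Y(3) Z(3) sum.distrib distrib_right)
  then show ?thesis unfolding fin_lin_def using Y Z
    by (intro exI[of _ "J \<union> K"] exI[of _ "\<lambda>h. (if h \<in> J then t h else 0) + (if h \<in> K then r h else 0)"]) simp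
qed

lemma fin_lin_cmult:
  assumes "fin_lin I Y"
  shows "fin_lin I (\<lambda>y. c * Y y)"
proof -
  from assms obtain J t where Y: "finite J" "J \<subseteq> I" "Y = (\<lambda>y. \<Sum>h\<in>J. t h * y h)"
    unfolding fin_lin_def by blast
  then show ?thesis unfolding fin_lin_def
    by (intro exI[of _ J] exI[of _ "\<lambda>h. c * t h"]) (simp add: sum_distrib_left mult.assoc)
qed

lemma fin_lin_component:
  assumes "h \<in> I"
  shows "fin_lin I (\<lambda>y. y h)"
  unfolding fin_lin_def using assms by (intro exI[of _ "{h}"] exI[of _ "\<lambda>_. 1"]) simp

lemma fin_lin_zero: "fin_lin I (\<lambda>y. 0)"
  unfolding fin_lin_def by (intro exI[of _ "{}"]) simp

lemma fin_lin_measurable: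
  assumes "fin_lin I Y"
  shows "Y \<in> borel_measurable (\<Pi>\<^sub>M h\<in>I. borel)"
proof -
  from assms obtain J t where Y: "finite J" "J \<subseteq> I" "Y = (\<lambda>y. \<Sum>h\<in>J. t h * y h)"
    unfolding fin_lin_def by blast
  show ?thesis unfolding Y(3)
    by (intro borel_measurable_sum borel_measurable_times borel_measurable_const measurable_component_singleton)
       (use Y in auto)
qed

text \<open>The one-dimensional uniqueness theorem is applied one coordinate at a time; the remaining
  coordinates enter through the nonnegative weights \<open>1 + cos Y\<close> and \<open>1 + sin Y\<close>.\<close>

lemma PiM_borel_eqI_char:
  fixes N1 N2 :: "('i \<Rightarrow> real) measure"
  assumes N: "prob_space N1" "prob_space N2"
    and sets: "sets N1 = sets (\<Pi>\<^sub>M h\<in>I. borel)" "sets N2 = sets (\<Pi>\<^sub>M h\<in>I. borel)"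
    and eq: "\<And>Y. fin_lin I Y \<Longrightarrow> (\<integral>y. iexp (Y y) \<partial>N1) = (\<integral>y. iexp (Y y) \<partial>N2)"
  shows "N1 = N2"
proof -
  interpret N1: prob_space N1 by fact
  interpret N2: prob_space N2 by fact
  have m1: "Y \<in> borel_measurable N1" and m2: "Y \<in> borel_measurable N2" if "fin_lin I Y" for Y
    using fin_lin_measurable[OF that] sets by (simp_all cong: measurable_cong_sets)
  \<comment> \<open>\<open>Y\<close> stays arbitrary in the induction: moving coordinate k from the
    exponential into the indicators uses the hypothesis at t y k, at t y k + Y and at t y k -
    Y.\<close>
  have key: "(\<integral>y. (\<Prod>h\<in>J. indicator (B h) (y h)) *\<^sub>R iexp (Y y) \<partial>N1) =
             (\<integral>y. (\<Prod>h\<in>J. indicator (B h) (y h)) *\<^sub>R iexp (Y y) \<partial>N2)"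
    if J: "finite J" "J \<subseteq> I" "\<And>h. h \<in> J \<Longrightarrow> B h \<in> sets borel" and Y: "fin_lin I Y" for J B Y
    using J Y
  proof (induction J arbitrary: Y rule: finite_induct)
    case empty
    then show ?case by (simp add: eq)
  next
    case (insert k J)
    define G :: "('i \<Rightarrow> real) \<Rightarrow> real" where "G y = (\<Prod>h\<in>J. indicator (B h) (y h))" for y
    have k: "k \<in> I" and Bk: "B k \<in> sets borel" using insert.prems by auto
    have Gm0: "G \<in> borel_measurable (\<Pi>\<^sub>M h\<in>I. borel)"
    proof -
      have "(\<lambda>y. indicator (B h) (y h) :: real) \<in> borel_measurable (\<Pi>\<^sub>M h\<in>I. borel)" if "h \<in> J" for h
        using that insert.prems
        by (intro measurable_compose[OF measurable_component_singleton borel_measurable_indicator]) auto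
      then show ?thesis unfolding G_def by (intro borel_measurable_prod) auto
    qed
    then have Gm[measurable]: "G \<in> borel_measurable N1" "G \<in> borel_measurable N2"
      using sets by (simp_all cong: measurable_cong_sets)
    have G0: "0 \<le> G y" and G1: "G y \<le> 1" for y
      unfolding G_def by (auto intro!: prod_nonneg prod_le_1)
    have Geq: "(\<integral>y. G y *\<^sub>R iexp (Y y) \<partial>N1) = (\<integral>y. G y *\<^sub>R iexp (Y y) \<partial>N2)" if "fin_lin I Y" for Y
      unfolding G_def using insert that by auto
    have int1: "integrable N1 (\<lambda>y. G y *\<^sub>R iexp (Z y))"
      and int2: "integrable N2 (\<lambda>y. G y *\<^sub>R iexp (Z y))" if "fin_lin I Z" for Z
    proof -
      note [measurable] = m1[OF that] m2[OF that]
      show "integrable N1 (\<lambda>y. G y *\<^sub>R iexp (Z y))"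
        by (rule N1.integrable_const_bound[where B=1]) (use G0 G1 in \<open>auto simp: norm_mult\<close>)
      show "integrable N2 (\<lambda>y. G y *\<^sub>R iexp (Z y))"
        by (rule N2.integrable_const_bound[where B=1]) (use G0 G1 in \<open>auto simp: norm_mult\<close>)
    qed
    note Y = insert.prems(3)
    note [measurable] = m1[OF Y] m2[OF Y] m1[OF fin_lin_component[OF k]] m2[OF fin_lin_component[OF k]] Bk
    have lp: "fin_lin I (\<lambda>y. t * y k + Y y)" and lm: "fin_lin I (\<lambda>y. t * y k + (-1) * Y y)"
      and l0: "fin_lin I (\<lambda>y. t * y k)" for t
      by (intro fin_lin_add fin_lin_cmult fin_lin_component k Y)+
    \<comment> \<open>The weighted characteristic function at t becomes a combination of three
      integrals covered by the induction hypothesis.\<close>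
    have cosid: "(G y * (1 + cos (Y y))) *\<^sub>R iexp (t * y k) = G y *\<^sub>R iexp (t * y k)
        + (1/2) *\<^sub>R (G y *\<^sub>R iexp (t * y k + Y y)) + (1/2) *\<^sub>R (G y *\<^sub>R iexp (t * y k + (-1) * Y y))" for t y
      by (simp add: complex_eq_iff cos_add sin_add cos_diff sin_diff algebra_simps Re_exp Im_exp)
    have sinid: "(G y * (1 + sin (Y y))) *\<^sub>R iexp (t * y k) = G y *\<^sub>R iexp (t * y k)
        + (- \<i>/2) * (G y *\<^sub>R iexp (t * y k + Y y)) + (\<i>/2) * (G y *\<^sub>R iexp (t * y k + (-1) * Y y))" for t y
      by (simp add: complex_eq_iff cos_add sin_add cos_diff sin_diff field_simps Re_exp Im_exp)
    have w: "0 \<le> G y * (1 + u) \<and> G y * (1 + u) \<le> 2" if "\<bar>u\<bar> \<le> 1" for y u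
    proof -
      have "G y * (1 + u) \<le> 1 * 2" using G0[of y] G1[of y] that by (intro mult_mono) auto
      then show ?thesis using G0[of y] that by simp
    qed
    have bcos: "0 \<le> G y * (1 + cos (Y y))" "G y * (1 + cos (Y y)) \<le> 2"
      and bsin: "0 \<le> G y * (1 + sin (Y y))" "G y * (1 + sin (Y y)) \<le> 2" for y
      using w[of "cos (Y y)" y] w[of "sin (Y y)" y] by auto
    have c: "(\<integral>y. (G y * (1 + cos (Y y))) * indicator (B k) (y k) \<partial>N1) =
        (\<integral>y. (G y * (1 + cos (Y y))) * indicator (B k) (y k) \<partial>N2)"
    proof (rule weighted_law_eqI_char[where K=2, OF N])
      fix t
      show "(\<integral>y. (G y * (1 + cos (Y y))) *\<^sub>R iexp (t * y k) \<partial>N1) =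
        (\<integral>y. (G y * (1 + cos (Y y))) *\<^sub>R iexp (t * y k) \<partial>N2)"
        unfolding cosid
        by (simp only: int1 int2 lp lm l0 Geq Bochner_Integration.integral_add Bochner_Integration.integrable_add
            integrable_scaleR_right integral_scaleR_right integrable_mult_right integral_mult_right_zero simp_thms)
    qed (auto intro: bcos)
    have s: "(\<integral>y. (G y * (1 + sin (Y y))) * indicator (B k) (y k) \<partial>N1) =
        (\<integral>y. (G y * (1 + sin (Y y))) * indicator (B k) (y k) \<partial>N2)"
    proof (rule weighted_law_eqI_char[where K=2, OF N])
      fix t
      show "(\<integral>y. (G y * (1 + sin (Y y))) *\<^sub>R iexp (t * y k) \<partial>N1) =
        (\<integral>y. (G y * (1 + sin (Y y))) *\<^sub>R iexp (t * y k) \<partial>N2)"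
        unfolding sinid
        by (simp only: int1 int2 lp lm l0 Geq Bochner_Integration.integral_add Bochner_Integration.integrable_add
            integrable_scaleR_right integral_scaleR_right integrable_mult_right integral_mult_right_zero simp_thms)
    qed (auto intro: bsin)
    \<comment> \<open>The weight \<open>G\<close> alone; subtracting it from \<open>c\<close> and
      \<open>s\<close> leaves the integrals of \<open>G\<close> times cos Y and sin Y over
      \<open>B k\<close>, the real and imaginary parts of the goal.\<close>
    have o: "(\<integral>y. G y * indicator (B k) (y k) \<partial>N1) = (\<integral>y. G y * indicator (B k) (y k) \<partial>N2)"
    proof (rule weighted_law_eqI_char[where K=1, OF N])
      fix t
      show "(\<integral>y. G y *\<^sub>R iexp (t * y k) \<partial>N1) = (\<integral>y. G y *\<^sub>R iexp (t * y k) \<partial>N2)"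
        by (rule Geq[OF l0])
    qed (use G0 G1 in auto)
    define H where "H y = G y * indicator (B k) (y k)" for y
    have H: "0 \<le> H y" "H y \<le> 1" for y using G0[of y] G1[of y] by (auto simp: H_def indicator_def)
    have [measurable]: "H \<in> borel_measurable N1" "H \<in> borel_measurable N2"
      unfolding H_def by measurable
    have ab: "\<bar>H y * c\<bar> \<le> 1" if "\<bar>c\<bar> \<le> 1" for y c
      using H[of y] that by (simp add: abs_mult mult_le_one)
    have i: "integrable N1 H" "integrable N2 H"
      by (rule N1.integrable_const_bound[where B=1] N2.integrable_const_bound[where B=1];
          use H in auto)+
    have ic: "integrable N1 (\<lambda>y. H y * cos (Y y))" "integrable N2 (\<lambda>y. H y * cos (Y y))"
      by (rule N1.integrable_const_bound[where B=1] N2.integrable_const_bound[where B=1];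
          use ab in auto)+
    have isn: "integrable N1 (\<lambda>y. H y * sin (Y y))" "integrable N2 (\<lambda>y. H y * sin (Y y))"
      by (rule N1.integrable_const_bound[where B=1] N2.integrable_const_bound[where B=1];
          use ab in auto)+
    have c': "(\<integral>y. H y * cos (Y y) \<partial>N1) = (\<integral>y. H y * cos (Y y) \<partial>N2)"
    proof -
      have "(G y * (1 + cos (Y y))) * indicator (B k) (y k) = H y + H y * cos (Y y)" for y
        by (simp add: H_def algebra_simps)
      then show ?thesis using c o i ic by (simp add: H_def[symmetric])
    qed
    have s': "(\<integral>y. H y * sin (Y y) \<partial>N1) = (\<integral>y. H y * sin (Y y) \<partial>N2)"
    proof -
      have "(G y * (1 + sin (Y y))) * indicator (B k) (y k) = H y + H y * sin (Y y)" for y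
        by (simp add: H_def algebra_simps)
      then show ?thesis using s o i isn by (simp add: H_def[symmetric])
    qed
    have "(\<Prod>h\<in>insert k J. indicator (B h) (y h)) *\<^sub>R iexp (Y y) =
        complex_of_real (H y * cos (Y y)) + \<i> * complex_of_real (H y * sin (Y y))" for y
    proof -
      have "(\<Prod>h\<in>insert k J. indicator (B h) (y h)) = H y"
        using insert.hyps by (simp add: H_def G_def mult.commute)
      then show ?thesis by (simp add: complex_eq_iff Re_exp Im_exp)
    qed
    then show ?case using ic isn by (simp add: c' s' del: of_real_mult)
  qed
  show ?thesis
  proof (rule measure_eqI_PiM_infinite[OF sets])
    fix A J assume J: "finite J" "J \<subseteq> I" and A: "\<And>i. i \<in> J \<Longrightarrow> A i \<in> sets (borel :: real measure)"
    let ?E = "prod_emb I (\<lambda>_. borel :: real measure) J (Pi\<^sub>E J A)"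
    have E: "?E \<in> sets (\<Pi>\<^sub>M h\<in>I. borel)"
      using J A by (intro sets_PiM_I) auto
    have id: "(\<Prod>h\<in>J. indicator (A h) (y h)) = (indicator ?E y :: real)" if "y \<in> space (\<Pi>\<^sub>M h\<in>I. borel :: real measure)" for y
    proof (cases "\<forall>h\<in>J. y h \<in> A h")
      case True
      then have "y \<in> ?E" using that J by (auto simp: prod_emb_def space_PiM)
      then show ?thesis using True by (simp add: indicator_def)
    next
      case False
      then have "y \<notin> ?E" by (auto simp: prod_emb_def PiE_def Pi_iff restrict_def split: if_splits)
      then show ?thesis using False J(1) by (auto simp: indicator_def intro!: prod_zero)
    qed
    have sp: "space N1 = space (\<Pi>\<^sub>M h\<in>I. borel :: real measure)" "space N2 = space (\<Pi>\<^sub>M h\<in>I. borel :: real measure)"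
      using sets sets_eq_imp_space_eq by blast+
    \<comment> \<open>The factor \<open>iexp 0\<close> is kept so that \<open>key\<close> applies
      with the zero functional as \<open>Y\<close>.\<close>
    have ind: "complex_of_real (measure N ?E) = (\<integral>y. (\<Prod>h\<in>J. indicator (A h) (y h)) *\<^sub>R iexp 0 \<partial>N)"
      if "sets N = sets (\<Pi>\<^sub>M h\<in>I. borel)" "space N = space (\<Pi>\<^sub>M h\<in>I. borel :: real measure)" for N
    proof -
      have "(\<integral>y. (\<Prod>h\<in>J. indicator (A h) (y h)) *\<^sub>R iexp 0 \<partial>N) = (\<integral>y. complex_of_real (indicator ?E y) \<partial>N)"
        by (intro Bochner_Integration.integral_cong refl) (simp add: that id scaleR_conv_of_real)
      also have "\<dots> = complex_of_real (\<integral>y. indicator ?E y \<partial>N)" by (rule integral_complex_of_real)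
      also have "(\<integral>y. indicator ?E y \<partial>N) = measure N (?E \<inter> space N)" by simp
      also have "?E \<inter> space N = ?E" using sets.sets_into_space[OF E] that by blast
      finally show ?thesis by simp
    qed
    have "complex_of_real (measure N1 ?E) = complex_of_real (measure N2 ?E)"
      using key[OF J A fin_lin_zero] by (simp only: ind[OF sets(1) sp(1)] ind[OF sets(2) sp(2)])
    then show "emeasure N1 ?E = emeasure N2 ?E"
      by (simp add: N1.emeasure_eq_measure N2.emeasure_eq_measure)
  qed (use N1.finite_measure_axioms in auto)
qed

section \<open>Square integrable functions on the interval and the cube\<close>

lemma space_unit_leb [simp]: "space unit_leb = {0..1}"
  by (simp add: unit_leb_def space_restrict_space)

interpretation unit: prob_space unit_leb
  by standard (simp add: unit_leb_def emeasure_restrict_space space_restrict_space)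

interpretation cube: prob_space "cube_leb :: ('d::finite \<Rightarrow> real) measure"
  unfolding cube_leb_def by (intro prob_space_PiM) (rule unit.prob_space_axioms)

lemma borel_measurable_unit_leb:
  "f \<in> borel_measurable borel \<Longrightarrow> f \<in> borel_measurable unit_leb"
  unfolding unit_leb_def by (intro measurable_restrict_space1) simp

lemma measurable_ident_unit_leb [measurable]: "(\<lambda>x. x) \<in> borel_measurable unit_leb"
  by (intro borel_measurable_unit_leb) simp

lemma measurable_coord_unit [measurable]: "(\<lambda>x. x k) \<in> measurable cube_leb unit_leb"
  unfolding cube_leb_def by (rule measurable_component_singleton) simp

lemma borel_measurable_coord [measurable]: "(\<lambda>x. x k) \<in> borel_measurable cube_leb"
  using measurable_compose[OF measurable_coord_unit measurable_ident_unit_leb] by simp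

lemma distr_cube_coord: "distr cube_leb unit_leb (\<lambda>x. x k) = unit_leb"
  unfolding cube_leb_def by (rule distr_PiM_component) (auto intro: unit.prob_space_axioms)

section \<open>Integrals of functions of one or two coordinates of the cube\<close>

lemma integral_cube_coord:
  fixes u :: "real \<Rightarrow> real"
  assumes "u \<in> borel_measurable unit_leb"
  shows "(LINT x|cube_leb. u (x k)) = (LINT t|unit_leb. u t)"
  using integral_distr[OF measurable_coord_unit assms, of k] by (simp add: distr_cube_coord)

lemma integrable_cube_coord:
  fixes u :: "real \<Rightarrow> real"
  assumes "integrable unit_leb u"
  shows "integrable cube_leb (\<lambda>x. u (x k))"
  using integrable_distr_eq[OF measurable_coord_unit borel_measurable_integrable[OF assms], of k] assms
  by (simp add: distr_cube_coord)

lemma cube_coord_prod: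
  fixes u v :: "real \<Rightarrow> real"
  assumes "integrable unit_leb u" "integrable unit_leb v" and kl: "k \<noteq> l"
  shows "integrable cube_leb (\<lambda>x. u (x k) * v (x (l :: 'd :: finite)))"
    and "(LINT x|cube_leb. u (x k) * v (x l)) = (LINT t|unit_leb. u t) * (LINT t|unit_leb. v t)"
proof -
  interpret product_prob_space "\<lambda>_. unit_leb" UNIV ..
  \<comment> \<open>The remaining factors are 1 and integrate to 1, so the product formula over all
    coordinates reduces to two factors.\<close>
  define f where "f i = (if i = k then u else if i = l then v else (\<lambda>_. 1))" for i
  have f: "integrable unit_leb (f i)" for i using assms by (simp add: f_def)
  have e: "(\<Prod>i\<in>UNIV. g i) = g k * g l * (\<Prod>i\<in>UNIV - {k, l}. g i)" for g :: "'d \<Rightarrow> real"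
    using kl by (subst prod.subset_diff[of "{k, l}"]) (auto simp: mult.commute)
  have p: "(\<Prod>i\<in>UNIV. f i (x i)) = u (x k) * v (x l)" for x
    unfolding e by (subst prod.neutral) (use kl in \<open>auto simp: f_def\<close>)
  have q: "(\<Prod>i\<in>UNIV. integral\<^sup>L unit_leb (f i)) = (LINT t|unit_leb. u t) * (LINT t|unit_leb. v t)"
    unfolding e by (subst prod.neutral) (use kl unit.prob_space in \<open>auto simp: f_def\<close>)
  show "integrable cube_leb (\<lambda>x. u (x k) * v (x l))"
    using product_integrable_prod[of UNIV f] f by (simp add: p cube_leb_def)
  show "(LINT x|cube_leb. u (x k) * v (x l)) = (LINT t|unit_leb. u t) * (LINT t|unit_leb. v t)"
    using product_integral_prod[of UNIV f] f by (simp add: p q cube_leb_def)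
qed

section \<open>Hilbert space calculus for square integrable functions\<close>

lemma L2D: "f \<in> L2 M \<Longrightarrow> f \<in> borel_measurable M" "f \<in> L2 M \<Longrightarrow> integrable M (\<lambda>x. (f x)\<^sup>2)"
  by (simp_all add: L2_def)

lemma L2_mult_integrable:
  assumes "f \<in> L2 M" "g \<in> L2 M"
  shows "integrable M (\<lambda>x. f x * g x)"
proof (rule Bochner_Integration.integrable_bound)
  show "integrable M (\<lambda>x. (f x)\<^sup>2 + (g x)\<^sup>2)" using assms by (auto simp: L2_def)
  show "(\<lambda>x. f x * g x) \<in> borel_measurable M" using assms by (auto simp: L2_def)
  have "\<bar>x * y\<bar> \<le> x\<^sup>2 + y\<^sup>2" for x y :: real
  proof -
    have "2 * (\<bar>x\<bar> * \<bar>y\<bar>) \<le> x\<^sup>2 + y\<^sup>2" using sum_squares_bound[of "\<bar>x\<bar>" "\<bar>y\<bar>"] by simp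
    moreover have "0 \<le> \<bar>x\<bar> * \<bar>y\<bar>" by simp
    ultimately show ?thesis unfolding abs_mult by linarith
  qed
  then show "AE x in M. norm (f x * g x) \<le> norm ((f x)\<^sup>2 + (g x)\<^sup>2)" by simp
qed

lemma L2_zero [simp]: "(\<lambda>x. 0) \<in> L2 M"
  by (simp add: L2_def)

lemma L2_add: "f \<in> L2 M \<Longrightarrow> g \<in> L2 M \<Longrightarrow> (\<lambda>x. f x + g x) \<in> L2 M"
  using L2_mult_integrable[of f M g] by (auto simp: L2_def power2_sum mult.assoc)

lemma L2_cmult: "f \<in> L2 M \<Longrightarrow> (\<lambda>x. c * f x) \<in> L2 M"
  by (auto simp: L2_def power_mult_distrib)

lemma L2_diff: "f \<in> L2 M \<Longrightarrow> g \<in> L2 M \<Longrightarrow> (\<lambda>x. f x - g x) \<in> L2 M"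
  using L2_add[of f M "\<lambda>x. (-1) * g x"] L2_cmult[of g M "-1"] by simp

lemma L2_sum: "(\<And>i. i \<in> A \<Longrightarrow> f i \<in> L2 M) \<Longrightarrow> (\<lambda>x. \<Sum>i\<in>A. f i x) \<in> L2 M"
  by (induction A rule: infinite_finite_induct) (auto intro: L2_add)

lemma (in finite_measure) L2_bounded:
  assumes "f \<in> borel_measurable M" "\<And>x. \<bar>f x\<bar> \<le> B"
  shows "f \<in> L2 M"
proof -
  have "(f x)\<^sup>2 \<le> B\<^sup>2" for x using power_mono[OF assms(2)[of x], of 2] by simp
  then show ?thesis
    using assms by (auto simp: L2_def intro!: integrable_const_bound[where B="B\<^sup>2"])
qed

lemma (in finite_measure) L2_integrable: "f \<in> L2 M \<Longrightarrow> integrable M f"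
  using L2_mult_integrable[of f M "\<lambda>_. 1"] L2_bounded[of "\<lambda>_. 1" 1] by simp

lemma L2_norm_power2: "(L2_norm M f)\<^sup>2 = (LINT x|M. (f x)\<^sup>2)"
  unfolding L2_norm_def by (simp add: integral_nonneg_AE)

lemma L2_norm_nonneg [simp]: "0 \<le> L2_norm M f"
  by (simp add: L2_norm_def integral_nonneg_AE)

lemma L2_inner_self: "L2_inner M f f = (L2_norm M f)\<^sup>2"
  unfolding L2_norm_power2 L2_inner_def by (simp add: power2_eq_square)

lemma L2_inner_commute: "L2_inner M f g = L2_inner M g f"
  by (simp add: L2_inner_def mult.commute)

lemma L2_inner_add_left:
  "f \<in> L2 M \<Longrightarrow> g \<in> L2 M \<Longrightarrow> h \<in> L2 M \<Longrightarrow> L2_inner M (\<lambda>x. f x + g x) h = L2_inner M f h + L2_inner M g h"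
  by (simp add: L2_inner_def distrib_right L2_mult_integrable)

lemma L2_inner_diff_left:
  "f \<in> L2 M \<Longrightarrow> g \<in> L2 M \<Longrightarrow> h \<in> L2 M \<Longrightarrow> L2_inner M (\<lambda>x. f x - g x) h = L2_inner M f h - L2_inner M g h"
  by (simp add: L2_inner_def left_diff_distrib L2_mult_integrable)

lemma L2_inner_cmult_left: "L2_inner M (\<lambda>x. c * f x) h = c * L2_inner M f h"
  by (simp add: L2_inner_def mult.assoc)

lemma L2_inner_cmult_right: "L2_inner M h (\<lambda>x. c * f x) = c * L2_inner M h f"
  by (subst (1 2) L2_inner_commute) (rule L2_inner_cmult_left)

lemma L2_inner_sum_left:
  "(\<And>i. i \<in> A \<Longrightarrow> f i \<in> L2 M) \<Longrightarrow> h \<in> L2 M \<Longrightarrow> L2_inner M (\<lambda>x. \<Sum>i\<in>A. f i x) h = (\<Sum>i\<in>A. L2_inner M (f i) h)"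
  unfolding L2_inner_def sum_distrib_right
  by (rule Bochner_Integration.integral_sum) (auto intro: L2_mult_integrable)

lemma L2_inner_sum_right:
  "(\<And>i. i \<in> A \<Longrightarrow> f i \<in> L2 M) \<Longrightarrow> h \<in> L2 M \<Longrightarrow> L2_inner M h (\<lambda>x. \<Sum>i\<in>A. f i x) = (\<Sum>i\<in>A. L2_inner M h (f i))"
  using L2_inner_sum_left[of A f M h] by (simp add: L2_inner_commute[of M h])

lemma L2_norm_power2_diff:
  assumes "f \<in> L2 M" "g \<in> L2 M"
  shows "(L2_norm M (\<lambda>x. f x - g x))\<^sup>2 = (L2_norm M f)\<^sup>2 - 2 * L2_inner M f g + (L2_norm M g)\<^sup>2"
proof -
  have "(f x - g x)\<^sup>2 = (f x)\<^sup>2 - 2 * (f x * g x) + (g x)\<^sup>2" for x by (simp add: power2_diff)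
  then show ?thesis using assms L2_mult_integrable[OF assms]
    by (simp add: L2_norm_power2 L2_inner_def L2D)
qed

text \<open>The quadratic |f - t g|^2 in t is nonnegative; its minimum gives the inequality.\<close>

lemma L2_inner_le:
  assumes "f \<in> L2 M" "g \<in> L2 M"
  shows "\<bar>L2_inner M f g\<bar> \<le> L2_norm M f * L2_norm M g"
proof -
  have nn: "0 \<le> (L2_norm M f)\<^sup>2 - 2 * (t * L2_inner M f g) + t\<^sup>2 * (L2_norm M g)\<^sup>2" for t
  proof -
    have "(L2_norm M (\<lambda>x. t * g x))\<^sup>2 = t\<^sup>2 * (L2_norm M g)\<^sup>2"
      by (simp add: L2_norm_power2 power_mult_distrib)
    moreover have "L2_inner M f (\<lambda>x. t * g x) = t * L2_inner M f g"
      by (subst (1 2) L2_inner_commute) (rule L2_inner_cmult_left)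
    ultimately show ?thesis
      using L2_norm_power2_diff[OF assms(1) L2_cmult[OF assms(2)], of t]
        zero_le_power2[of "L2_norm M (\<lambda>x. f x - t * g x)"] by simp
  qed
  have "(L2_inner M f g)\<^sup>2 \<le> (L2_norm M f)\<^sup>2 * (L2_norm M g)\<^sup>2"
  proof (cases "(L2_norm M g)\<^sup>2 = 0")
    case True
    \<comment> \<open>Without a quadratic term the expression is affine in t, and the chosen t would
      give it the value -1.\<close>
    have "L2_inner M f g = 0"
    proof (rule ccontr)
      assume "L2_inner M f g \<noteq> 0"
      then show False
        using nn[of "((L2_norm M f)\<^sup>2 + 1) / (2 * L2_inner M f g)"] True by (simp add: field_simps)
    qed
    then show ?thesis by simp
  next
    case False
    then have G: "0 < (L2_norm M g)\<^sup>2" by (simp add: order_less_le)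
    have "0 \<le> (L2_norm M f)\<^sup>2 - (L2_inner M f g)\<^sup>2 / (L2_norm M g)\<^sup>2"
      using nn[of "L2_inner M f g / (L2_norm M g)\<^sup>2"] False by (simp add: power2_eq_square)
    with G show ?thesis by (simp add: pos_divide_le_eq)
  qed
  then show ?thesis
    by (metis L2_norm_nonneg abs_le_square_iff abs_of_nonneg mult_nonneg_nonneg power_mult_distrib)
qed

lemma L2_norm_diff_commute: "L2_norm M (\<lambda>x. f x - g x) = L2_norm M (\<lambda>x. g x - f x)"
  by (simp add: L2_norm_def power2_commute)

text \<open>By Cauchy-Schwarz the inner product with \<open>h\<close> is continuous, so it passes
  through the series; this is how coefficients are read off.\<close>

lemma L2_sums_inner:
  assumes f: "f \<in> L2 M" and g: "\<And>j. g j \<in> L2 M" and h: "h \<in> L2 M"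
    and sums: "L2_sums M g f"
  shows "(\<lambda>j. L2_inner M (g j) h) sums L2_inner M f h"
proof -
  have S: "(\<lambda>x. \<Sum>j<N. g j x) \<in> L2 M" for N using g by (rule L2_sum)
  have "(\<lambda>N. L2_inner M f h - (\<Sum>j<N. L2_inner M (g j) h)) \<longlonglongrightarrow> 0"
  proof (rule tendsto_0_le[where K="L2_norm M h"])
    show "(\<lambda>N. L2_norm M (\<lambda>x. f x - (\<Sum>j<N. g j x))) \<longlonglongrightarrow> 0"
      using sums by (simp add: L2_sums_def)
    have "norm (L2_inner M f h - (\<Sum>j<N. L2_inner M (g j) h)) \<le>
        norm (L2_norm M (\<lambda>x. f x - (\<Sum>j<N. g j x))) * L2_norm M h" for N
      using L2_inner_le[OF L2_diff[OF f S] h, of N]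
      by (simp add: L2_inner_diff_left[OF f S h] L2_inner_sum_left[OF g h])
    then show "\<forall>\<^sub>F N in sequentially. norm (L2_inner M f h - (\<Sum>j<N. L2_inner M (g j) h)) \<le>
        norm (L2_norm M (\<lambda>x. f x - (\<Sum>j<N. g j x))) * L2_norm M h" by simp
  qed
  then have "(\<lambda>N. L2_inner M f h - (L2_inner M f h - (\<Sum>j<N. L2_inner M (g j) h))) \<longlonglongrightarrow> L2_inner M f h - 0"
    by (intro tendsto_diff tendsto_const)
  then show ?thesis by (simp add: sums_def)
qed

text \<open>With \<open>S\<close> the projection onto the span of the \<open>e j\<close>, |f - S|^2
  is |f|^2 minus the sum of the squared coefficients.\<close>

lemma bessel:
  assumes f: "f \<in> L2 M" and e: "\<And>j. j \<in> J \<Longrightarrow> e j \<in> L2 M" and J: "finite J"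
    and on: "\<And>i j. i \<in> J \<Longrightarrow> j \<in> J \<Longrightarrow> L2_inner M (e i) (e j) = (if i = j then 1 else 0)"
  shows "(\<Sum>j\<in>J. (L2_inner M f (e j))\<^sup>2) \<le> (L2_norm M f)\<^sup>2"
proof -
  define c where "c j = L2_inner M f (e j)" for j
  define S where "S x = (\<Sum>j\<in>J. c j * e j x)" for x
  have ce: "(\<lambda>x. c j * e j x) \<in> L2 M" if "j \<in> J" for j using e[OF that] by (rule L2_cmult)
  have S: "S \<in> L2 M" unfolding S_def using ce by (rule L2_sum)
  have fS: "L2_inner M f S = (\<Sum>j\<in>J. (c j)\<^sup>2)"
    unfolding S_def by (subst L2_inner_sum_right[OF ce f])
      (simp_all add: L2_inner_commute[of M f] L2_inner_cmult_left c_def power2_eq_square)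
  have "L2_inner M S (\<lambda>x. c i * e i x) = (c i)\<^sup>2" if i: "i \<in> J" for i
  proof -
    have "L2_inner M S (\<lambda>x. c i * e i x) = c i * L2_inner M S (e i)"
      by (simp add: L2_inner_commute[of M S] L2_inner_cmult_left)
    also have "L2_inner M S (e i) = (\<Sum>j\<in>J. c j * L2_inner M (e j) (e i))"
      unfolding S_def by (subst L2_inner_sum_left[OF ce e[OF i]]) (simp_all add: L2_inner_cmult_left)
    also have "\<dots> = c i" using i J by (simp add: on if_distrib cong: if_cong)
    finally show ?thesis by (simp add: power2_eq_square)
  qed
  then have SS: "(L2_norm M S)\<^sup>2 = (\<Sum>j\<in>J. (c j)\<^sup>2)"
  proof -
    assume a: "\<And>i. i \<in> J \<Longrightarrow> L2_inner M S (\<lambda>x. c i * e i x) = (c i)\<^sup>2"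
    have "S = (\<lambda>x. \<Sum>j\<in>J. c j * e j x)" by (simp add: S_def fun_eq_iff)
    then have "L2_inner M S S = (\<Sum>j\<in>J. L2_inner M S (\<lambda>x. c j * e j x))"
      using L2_inner_sum_right[of J "\<lambda>j x. c j * e j x", OF ce S] by simp
    then show ?thesis by (simp add: a L2_inner_self)
  qed
  show ?thesis
    using L2_norm_power2_diff[OF f S] zero_le_power2[of "L2_norm M (\<lambda>x. f x - S x)"]
    by (simp add: fS SS c_def)
qed

section \<open>Functions of a single coordinate and additive functions in the cube\<close>

lemma L2_cube_coord: "u \<in> L2 unit_leb \<Longrightarrow> (\<lambda>x. u (x k)) \<in> L2 cube_leb"
  using integrable_cube_coord[of "\<lambda>t. (u t)\<^sup>2" k]
  by (auto simp: L2_def intro: measurable_compose[OF measurable_coord_unit])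

lemma L2_inner_cube_coord:
  assumes "u \<in> L2 unit_leb" "v \<in> L2 unit_leb"
  shows "L2_inner cube_leb (\<lambda>x. u (x k)) (\<lambda>x. v (x k)) = L2_inner unit_leb u v"
  unfolding L2_inner_def using assms by (intro integral_cube_coord) (auto simp: L2_def)

lemma L2_norm_cube_coord:
  assumes "u \<in> L2 unit_leb"
  shows "L2_norm cube_leb (\<lambda>x. u (x k)) = L2_norm unit_leb u"
  unfolding L2_norm_def
  using integral_cube_coord[of "\<lambda>t. (u t)\<^sup>2" k] assms by (auto simp: L2_def)

lemma L2_inner_cube_distinct:
  assumes "u \<in> L2 unit_leb" "v \<in> L2 unit_leb" "k \<noteq> l" "(LINT t|unit_leb. u t) = 0"
  shows "L2_inner cube_leb (\<lambda>x. u (x k)) (\<lambda>x. v (x l)) = 0"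
  unfolding L2_inner_def
  using cube_coord_prod(2)[of u v k l] assms by (simp add: unit.L2_integrable)

text \<open>A cross term between different coordinates is a product of two means, and the mean of
  \<open>u k\<close> is zero. This is what splits norms into coordinates.\<close>

lemma L2_inner_additive:
  fixes u v :: "'d::finite \<Rightarrow> real \<Rightarrow> real"
  assumes u: "\<And>k. u k \<in> L2 unit_leb" and v: "\<And>k. v k \<in> L2 unit_leb"
    and z: "\<And>k. (LINT t|unit_leb. u k t) = 0"
  shows "L2_inner cube_leb (\<lambda>x. \<Sum>k\<in>UNIV. u k (x k)) (\<lambda>x. \<Sum>k\<in>UNIV. v k (x k)) =
    (\<Sum>k\<in>UNIV. L2_inner unit_leb (u k) (v k))"
proof -
  have "L2_inner cube_leb (\<lambda>x. u k (x k)) (\<lambda>x. \<Sum>l\<in>UNIV. v l (x l)) = L2_inner unit_leb (u k) (v k)" for k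
  proof -
    have "L2_inner cube_leb (\<lambda>x. u k (x k)) (\<lambda>x. \<Sum>l\<in>UNIV. v l (x l)) =
        (\<Sum>l\<in>UNIV. L2_inner cube_leb (\<lambda>x. u k (x k)) (\<lambda>x. v l (x l)))"
      by (rule L2_inner_sum_right) (auto intro: L2_cube_coord u v)
    also have "\<dots> = (\<Sum>l\<in>UNIV. if l = k then L2_inner unit_leb (u k) (v k) else 0)"
      by (intro sum.cong refl) (auto simp: L2_inner_cube_coord u v intro!: L2_inner_cube_distinct z)
    finally show ?thesis by simp
  qed
  moreover have "(\<lambda>x. \<Sum>l\<in>UNIV. v l (x l)) \<in> L2 cube_leb"
    by (intro L2_sum L2_cube_coord v)
  ultimately show ?thesis
    using L2_inner_sum_left[of UNIV "\<lambda>k x. u k (x k)", OF L2_cube_coord[OF u]] by simp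
qed

lemma L2_norm_additive:
  fixes u :: "'d::finite \<Rightarrow> real \<Rightarrow> real"
  assumes "\<And>k. u k \<in> L2 unit_leb" "\<And>k. (LINT t|unit_leb. u k t) = 0"
  shows "(L2_norm cube_leb (\<lambda>x. \<Sum>k\<in>UNIV. u k (x k)))\<^sup>2 = (\<Sum>k\<in>UNIV. (L2_norm unit_leb (u k))\<^sup>2)"
  using L2_inner_additive[of u u] assms by (simp add: L2_inner_self)

section \<open>Cosine series\<close>

lemma integral_unit_FTC:
  fixes F f :: "real \<Rightarrow> real"
  assumes "\<And>x. DERIV F x :> f x" "\<And>x. isCont f x"
  shows "(LINT t|unit_leb. f t) = F 1 - F 0"
  using integral_FTC_Icc_real[of 0 1 F f] assms
  by (simp add: unit_leb_def integral_restrict_space mult.commute)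

text \<open>Integer frequencies, because the product formulas below produce the difference i -
  j.\<close>

lemma integral_cos_unit: "(LINT t|unit_leb. cos (2 * pi * real_of_int m * t)) = (if m = 0 then 1 else 0)"
proof (cases "m = 0")
  case True
  then show ?thesis using unit.prob_space by simp
next
  case False
  have "(LINT t|unit_leb. cos (2 * pi * real_of_int m * t)) =
      sin (2 * pi * real_of_int m * 1) / (2 * pi * real_of_int m) - sin (2 * pi * real_of_int m * 0) / (2 * pi * real_of_int m)"
    by (rule integral_unit_FTC) (use False in \<open>auto intro!: derivative_eq_intros\<close>)
  then show ?thesis using False by simp
qed

lemma integral_sin_unit: "(LINT t|unit_leb. sin (2 * pi * real_of_int m * t)) = 0"
proof (cases "m = 0")
  case False
  have "(LINT t|unit_leb. sin (2 * pi * real_of_int m * t)) =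
      - cos (2 * pi * real_of_int m * 1) / (2 * pi * real_of_int m) - (- cos (2 * pi * real_of_int m * 0) / (2 * pi * real_of_int m))"
    by (rule integral_unit_FTC) (use False in \<open>auto intro!: derivative_eq_intros\<close>)
  then show ?thesis by simp
qed simp

lemma cos_basis_measurable [measurable]: "cos_basis j \<in> borel_measurable borel"
  by (cases "j = 0") (simp_all add: cos_basis_def[abs_def])

lemma cos_basis_unit_measurable [measurable]: "cos_basis j \<in> borel_measurable unit_leb"
  by (rule borel_measurable_unit_leb) simp

lemma abs_cos_basis_le: "\<bar>cos_basis j t\<bar> \<le> 2"
proof -
  have "sqrt 2 * \<bar>cos u\<bar> \<le> 2" for u
    using mult_mono[of "sqrt 2" 2 "\<bar>cos u\<bar>" 1] real_sqrt_le_mono[of 2 4] by simp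
  then show ?thesis by (simp add: cos_basis_def abs_mult)
qed

lemma cos_basis_L2 [simp]: "cos_basis j \<in> L2 unit_leb"
  by (rule unit.L2_bounded[OF _ abs_cos_basis_le]) simp

lemma sin_L2 [simp]: "(\<lambda>t. sin (c * t)) \<in> L2 unit_leb"
  by (rule unit.L2_bounded[where B=1]) simp_all

lemma cos_basis_eq: "cos_basis j t = (if j = 0 then 1 else sqrt 2) * cos (2 * pi * real j * t)"
  by (simp add: cos_basis_def)

lemma integrable_cos_unit: "integrable unit_leb (\<lambda>t. cos (c * t))"
  by (rule unit.integrable_const_bound[where B=1]) simp_all

lemma integrable_sin_unit: "integrable unit_leb (\<lambda>t. sin (c * t))"
  by (rule unit.integrable_const_bound[where B=1]) simp_all

lemma cos_basis_orthonormal: "L2_inner unit_leb (cos_basis i) (cos_basis j) = (if i = j then 1 else 0)"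
proof -
  have "(LINT t|unit_leb. cos (2 * pi * real i * t) * cos (2 * pi * real j * t)) =
     (LINT t|unit_leb. (1/2) * cos (2 * pi * real_of_int (int i - int j) * t) + (1/2) * cos (2 * pi * real_of_int (int i + int j) * t))"
    by (intro Bochner_Integration.integral_cong refl) (simp add: cos_times_cos field_simps)
  \<comment> \<open>For i = j > 0 only the first summand survives and the two factors
    \<open>sqrt 2\<close> compensate for 1/2; for i = j = 0 both survive.\<close>
  also have "\<dots> = (1/2) * (if int i - int j = 0 then 1 else 0) + (1/2) * (if int i + int j = 0 then 1 else 0)"
    by (subst Bochner_Integration.integral_add)
       (simp_all only: integral_mult_right_zero integral_cos_unit integrable_mult_right integrable_cos_unit)
  finally have *: "(LINT t|unit_leb. cos (2 * pi * real i * t) * cos (2 * pi * real j * t)) = \<dots>" .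
  have "L2_inner unit_leb (cos_basis i) (cos_basis j) = (if i = 0 then 1 else sqrt 2) * (if j = 0 then 1 else sqrt 2) *
     (LINT t|unit_leb. cos (2 * pi * real i * t) * cos (2 * pi * real j * t))"
    unfolding L2_inner_def integral_mult_right_zero[symmetric] cos_basis_eq
    by (intro Bochner_Integration.integral_cong refl) simp
  then show ?thesis unfolding * by auto
qed

text \<open>Cosine series therefore have no sine coefficients, and the sines that the addition
  theorem produces for shifted cosines drop out of convolutions.\<close>

lemma cos_basis_inner_sin: "L2_inner unit_leb (cos_basis i) (\<lambda>t. sin (2 * pi * real j * t)) = 0"
proof -
  have "(LINT t|unit_leb. cos (2 * pi * real i * t) * sin (2 * pi * real j * t)) =
     (LINT t|unit_leb. (1/2) * sin (2 * pi * real_of_int (int i + int j) * t) - (1/2) * sin (2 * pi * real_of_int (int i - int j) * t))"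
    by (intro Bochner_Integration.integral_cong refl) (simp add: cos_times_sin field_simps)
  also have "\<dots> = 0"
    by (subst Bochner_Integration.integral_diff)
       (simp_all only: integral_mult_right_zero integral_sin_unit integrable_mult_right integrable_sin_unit mult_zero_right diff_self)
  finally have *: "(LINT t|unit_leb. cos (2 * pi * real i * t) * sin (2 * pi * real j * t)) = 0" .
  have "L2_inner unit_leb (cos_basis i) (\<lambda>t. sin (2 * pi * real j * t)) = (if i = 0 then 1 else sqrt 2) *
     (LINT t|unit_leb. cos (2 * pi * real i * t) * sin (2 * pi * real j * t))"
    unfolding L2_inner_def integral_mult_right_zero[symmetric] cos_basis_eq
    by (intro Bochner_Integration.integral_cong refl) simp
  then show ?thesis unfolding * by simp
qed

lemma integral_eq_inner_cos_basis_0: "(LINT t|unit_leb. f t) = L2_inner unit_leb f (cos_basis 0)"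
  by (simp add: L2_inner_def cos_basis_def)

lemma integral_cos_basis: "j \<ge> 1 \<Longrightarrow> (LINT t|unit_leb. cos_basis j t) = 0"
  by (simp add: integral_eq_inner_cos_basis_0 cos_basis_orthonormal)

lemma cos_basis_diff:
  assumes "j \<ge> 1"
  shows "cos_basis j (x - y) = cos_basis j x * cos (2 * pi * real j * y)
    + (sqrt 2 * sin (2 * pi * real j * x)) * sin (2 * pi * real j * y)"
  using assms by (simp add: cos_basis_def right_diff_distrib cos_diff algebra_simps)

lemma cos_basis_add:
  assumes "j \<ge> 1"
  shows "cos_basis j (x + y) = cos (2 * pi * real j * y) * cos_basis j x
    - (sqrt 2 * sin (2 * pi * real j * y)) * sin (2 * pi * real j * x)"
  using assms by (simp add: cos_basis_def distrib_left cos_add algebra_simps)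

lemma cos_basis_periodic: "periodic1 (cos_basis j)"
proof -
  have "cos (2 * pi * real j * t + 2 * pi * real j) = cos (2 * pi * real j * t)" for t
    using cos_int_2pin[of "int j"] sin_int_2pin[of "int j"] by (simp add: cos_add)
  then show ?thesis by (simp add: periodic1_def cos_basis_def distrib_left)
qed

text \<open>The injection \<open>r\<close> covers two indexings: the identity for a marginal, and
  \<open>Suc\<close> for a member of an ellipsoid, whose series has no constant term.\<close>

lemma cos_series_inner:
  assumes "f \<in> L2 unit_leb" "L2_sums unit_leb (\<lambda>j t. c j * cos_basis (r j) t) f" "inj r"
  shows "L2_inner unit_leb f (cos_basis (r i)) = c i"
    and "m \<notin> range r \<Longrightarrow> L2_inner unit_leb f (cos_basis m) = 0"
    and "L2_inner unit_leb f (\<lambda>t. sin (2 * pi * real m * t)) = 0"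
proof -
  have s: "(\<lambda>j. L2_inner unit_leb (\<lambda>t. c j * cos_basis (r j) t) h) sums L2_inner unit_leb f h"
    if "h \<in> L2 unit_leb" for h
    by (rule L2_sums_inner[OF assms(1) _ that assms(2)]) (simp add: L2_cmult)
  have "(\<lambda>j. if j = i then c j else 0) sums L2_inner unit_leb f (cos_basis (r i))"
    using s[of "cos_basis (r i)"] \<open>inj r\<close>
    by (simp add: L2_inner_cmult_left cos_basis_orthonormal inj_eq if_distrib cong: if_cong)
  then show "L2_inner unit_leb f (cos_basis (r i)) = c i"
    using sums_single[of i c] sums_unique2 by blast
  have "(\<lambda>j. 0) sums L2_inner unit_leb f (cos_basis m)" if "m \<notin> range r"
  proof -
    have "r j \<noteq> m" for j using that by auto
    then show ?thesis using s[of "cos_basis m"] by (simp add: L2_inner_cmult_left cos_basis_orthonormal)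
  qed
  then show "m \<notin> range r \<Longrightarrow> L2_inner unit_leb f (cos_basis m) = 0"
    using sums_zero sums_unique2 by blast
  have "(\<lambda>j. 0) sums L2_inner unit_leb f (\<lambda>t. sin (2 * pi * real m * t))"
    using s[of "\<lambda>t. sin (2 * pi * real m * t)"] by (simp add: L2_inner_cmult_left cos_basis_inner_sin)
  then show "L2_inner unit_leb f (\<lambda>t. sin (2 * pi * real m * t)) = 0"
    using sums_zero sums_unique2 by blast
qed

text \<open>What the upper bound retains of the series of an ellipsoid member: mean zero for
  orthogonality between coordinates, and vanishing sine coefficients for the diagonal action of
  convolution.\<close>

definition centered_cosine :: "(real \<Rightarrow> real) \<Rightarrow> bool" where
  "centered_cosine f \<longleftrightarrow> f \<in> borel_measurable borel \<and> periodic1 f \<and> f \<in> L2 unit_leb \<and>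
     (LINT t|unit_leb. f t) = 0 \<and> (\<forall>j. L2_inner unit_leb f (\<lambda>t. sin (2 * pi * real j * t)) = 0)"

lemma ellipsoid_centered_cosine:
  assumes "f \<in> ellipsoid w L"
  shows "centered_cosine f"
proof -
  from assms obtain \<theta> where f: "f \<in> borel_measurable borel" "periodic1 f" "f \<in> L2 unit_leb"
     "L2_sums unit_leb (\<lambda>j t. \<theta> (Suc j) * cos_basis (Suc j) t) f"
    unfolding ellipsoid_def by auto
  show ?thesis
    using f cos_series_inner(2,3)[of f "\<lambda>j. \<theta> (Suc j)" Suc] 
    by (simp add: centered_cosine_def integral_eq_inner_cos_basis_0)
qed

lemma trig_poly_L2: "(\<lambda>t. \<Sum>j\<in>J. \<theta> j * cos_basis j t) \<in> L2 unit_leb"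
  by (intro L2_sum L2_cmult cos_basis_L2)

lemma trig_poly_centered:
  assumes "\<And>j. j \<in> J \<Longrightarrow> j \<ge> 1"
  shows "(LINT t|unit_leb. (\<Sum>j\<in>J. \<theta> j * cos_basis j t)) = 0"
proof -
  have "0 \<notin> J" using assms by force
  then show ?thesis
    unfolding integral_eq_inner_cos_basis_0
    by (subst L2_inner_sum_left)
       (auto simp: L2_cmult L2_inner_cmult_left cos_basis_orthonormal intro!: sum.neutral)
qed

lemma trig_poly_norm:
  assumes "finite J"
  shows "(L2_norm unit_leb (\<lambda>t. \<Sum>j\<in>J. \<theta> j * cos_basis j t))\<^sup>2 = (\<Sum>j\<in>J. (\<theta> j)\<^sup>2)"
proof -
  have "L2_inner unit_leb (\<lambda>t. \<Sum>j\<in>J. \<theta> j * cos_basis j t) (\<lambda>t. \<theta> i * cos_basis i t) = (\<theta> i)\<^sup>2" if "i \<in> J" for i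
  proof -
    have "L2_inner unit_leb (\<lambda>t. \<Sum>j\<in>J. \<theta> j * cos_basis j t) (\<lambda>t. \<theta> i * cos_basis i t)
        = (\<Sum>j\<in>J. \<theta> j * (\<theta> i * L2_inner unit_leb (cos_basis j) (cos_basis i)))"
      by (subst L2_inner_sum_left)
         (simp_all add: L2_cmult L2_inner_cmult_left L2_inner_commute[of _ "cos_basis _" "\<lambda>t. _ * _ t"] L2_inner_commute[of _ "cos_basis i"])
    also have "\<dots> = (\<theta> i)\<^sup>2"
      using assms that by (simp add: cos_basis_orthonormal if_distrib power2_eq_square cong: if_cong)
    finally show ?thesis .
  qed
  then have "(\<Sum>i\<in>J. L2_inner unit_leb (\<lambda>t. \<Sum>j\<in>J. \<theta> j * cos_basis j t) (\<lambda>t. \<theta> i * cos_basis i t)) = (\<Sum>i\<in>J. (\<theta> i)\<^sup>2)"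
    by simp
  then show ?thesis
    unfolding L2_inner_self[symmetric]
    by (subst L2_inner_sum_right[of J "\<lambda>j t. \<theta> j * cos_basis j t"]) (simp_all add: L2_cmult trig_poly_L2)
qed


section \<open>Periodic functions and convolution\<close>

lemma periodic1_int:
  assumes "periodic1 f"
  shows "f (t + of_int n) = f t"
proof -
  have nat: "f (t + real m) = f t" for m t
  proof (induction m)
    case (Suc m)
    have e: "t + real (Suc m) = (t + real m) + 1" by simp
    have "f ((t + real m) + 1) = f (t + real m)"
      by (rule assms[unfolded periodic1_def, rule_format])
    then show ?case unfolding e Suc .
  qed simp
  show ?thesis
  proof (cases "n \<ge> 0")
    case True
    then show ?thesis using nat[of t "nat n"] by simp
  next
    case False
    then show ?thesis using nat[of "t + of_int n" "nat (- n)"] by simp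
  qed
qed

text \<open>The half-open interval tiles the line under integer shifts; the endpoint is a null
  set.\<close>

lemma nn_integral_unit:
  assumes [measurable]: "f \<in> borel_measurable borel"
  shows "(\<integral>\<^sup>+t. f t \<partial>unit_leb) = (\<integral>\<^sup>+t. f t * indicator {0..<1::real} t \<partial>lborel)"
proof -
  have "(\<integral>\<^sup>+t. f t \<partial>unit_leb) = (\<integral>\<^sup>+t. f t * indicator {0..1} t \<partial>lborel)"
    by (simp add: unit_leb_def nn_integral_restrict_space)
  also have "\<dots> = (\<integral>\<^sup>+t. f t * indicator {0..<1} t \<partial>lborel)"
  proof (rule nn_integral_cong_AE)
    show "AE t in lborel. f t * indicator {0..1} t = f t * indicator {0..<1} t"
      using AE_lborel_singleton[of "1::real"] by eventually_elim (auto simp: indicator_def)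
  qed
  finally show ?thesis .
qed

lemma nn_integral_unit_periodic:
  fixes f :: "real \<Rightarrow> ennreal"
  assumes f[measurable]: "f \<in> borel_measurable borel" and per: "\<And>t. f (t + 1) = f t" "\<And>t n. f (t + of_int n) = f t"
  shows "(\<integral>\<^sup>+t. f (t - y) \<partial>unit_leb) = (\<integral>\<^sup>+t. f t \<partial>unit_leb)"
proof -
  \<comment> \<open>By periodicity only the fractional part of the shift matters; the translated
    interval then meets two unit intervals, and its piece left of 0 is moved by one period.\<close>
  define z where "z = frac y"
  have z: "0 \<le> z" "z < 1" by (simp_all add: z_def frac_lt_1)
  have yz: "f (t - y) = f (t - z)" for t
    using per(2)[of "t - y" "\<lfloor>y\<rfloor>"] by (simp add: z_def frac_def algebra_simps)
  have "(\<integral>\<^sup>+t. f (t - y) \<partial>unit_leb) = (\<integral>\<^sup>+t. f (t - z) * indicator {0..<1} t \<partial>lborel)"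
    unfolding yz by (rule nn_integral_unit) simp
  also have "\<dots> = (\<integral>\<^sup>+t. f t * indicator {-z..<1-z} t \<partial>lborel)"
    by (subst nn_integral_real_affine[where c=1 and t=z])
       (auto intro!: nn_integral_cong simp: indicator_def)
  also have "\<dots> = (\<integral>\<^sup>+t. f t * indicator {-z..<0} t + f t * indicator {0..<1-z} t \<partial>lborel)"
    using z by (intro nn_integral_cong) (auto simp: indicator_def)
  also have "\<dots> = (\<integral>\<^sup>+t. f t * indicator {-z..<0} t \<partial>lborel) + (\<integral>\<^sup>+t. f t * indicator {0..<1-z} t \<partial>lborel)"
    by (rule nn_integral_add) simp_all
  also have "(\<integral>\<^sup>+t. f t * indicator {-z..<0} t \<partial>lborel) = (\<integral>\<^sup>+t. f t * indicator {1-z..<1} t \<partial>lborel)"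
    by (subst (2) nn_integral_real_affine[where c=1 and t=1])
       (auto intro!: nn_integral_cong simp: indicator_def per(1) add.commute[of 1])
  also have "(\<integral>\<^sup>+t. f t * indicator {1-z..<1} t \<partial>lborel) + (\<integral>\<^sup>+t. f t * indicator {0..<1-z} t \<partial>lborel) =
      (\<integral>\<^sup>+t. f t * indicator {1-z..<1} t + f t * indicator {0..<1-z} t \<partial>lborel)"
    by (rule nn_integral_add[symmetric]) simp_all
  also have "\<dots> = (\<integral>\<^sup>+t. f t * indicator {0..<1} t \<partial>lborel)"
    using z by (intro nn_integral_cong) (auto simp: indicator_def)
  also have "\<dots> = (\<integral>\<^sup>+t. f t \<partial>unit_leb)"
    by (rule nn_integral_unit[symmetric]) simp
  finally show ?thesis .
qed

lemma periodic_shift_unit: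
  fixes f :: "real \<Rightarrow> real"
  assumes f[measurable]: "f \<in> borel_measurable borel" and per: "periodic1 f"
  shows "(LINT t|unit_leb. f (t - y)) = (LINT t|unit_leb. f t)"
    and "integrable unit_leb f \<Longrightarrow> integrable unit_leb (\<lambda>t. f (t - y))"
proof -
  \<comment> \<open>\<open>ennreal\<close> truncates negative values to 0, so the identity and its
    negative yield the positive and negative parts, and the norm yields integrability.\<close>
  have *: "(\<integral>\<^sup>+t. ennreal (g (f (t - y))) \<partial>unit_leb) = (\<integral>\<^sup>+t. ennreal (g (f t)) \<partial>unit_leb)"
    if "g \<in> borel_measurable borel" for g :: "real \<Rightarrow> real"
    by (rule nn_integral_unit_periodic[of "\<lambda>t. ennreal (g (f t))"])
       (use that per periodic1_int[OF per] in \<open>auto simp: periodic1_def\<close>)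
  have m: "(\<lambda>t. f (t - y)) \<in> borel_measurable unit_leb" "f \<in> borel_measurable unit_leb"
    by (intro borel_measurable_unit_leb; simp)+
  show i: "integrable unit_leb f \<Longrightarrow> integrable unit_leb (\<lambda>t. f (t - y))"
    using *[of "\<lambda>x. norm x"] m by (simp add: integrable_iff_bounded)
  have i': "integrable unit_leb f \<longleftrightarrow> integrable unit_leb (\<lambda>t. f (t - y))"
    using *[of "\<lambda>x. norm x"] m by (simp add: integrable_iff_bounded)
  show "(LINT t|unit_leb. f (t - y)) = (LINT t|unit_leb. f t)"
  proof (cases "integrable unit_leb f")
    case True
    with i' show ?thesis using *[of "\<lambda>x. x"] *[of "\<lambda>x. - x"] by (simp add: real_lebesgue_integral_def)
  next
    \<comment> \<open>Neither function is integrable, and both integrals are 0 by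
      convention.\<close>
    case False
    with i' show ?thesis by (simp add: not_integrable_integral_eq)
  qed
qed

section \<open>Convolution as a Fourier multiplier\<close>

text \<open>Fubini's theorem with coordinate \<open>k\<close> separated from the others; boundedness
  of \<open>g\<close> keeps the product with \<open>a\<close> integrable.\<close>

lemma integral_marginal:
  fixes a :: "('d::finite \<Rightarrow> real) \<Rightarrow> real" and g :: "real \<Rightarrow> real"
  assumes a: "integrable cube_leb a" and m: "marginal k a \<in> L2 unit_leb"
    and g[measurable]: "g \<in> borel_measurable borel" and bd: "\<And>t. \<bar>g t\<bar> \<le> B"
  shows "integrable cube_leb (\<lambda>y. g (y k) * a y)"
    and "(LINT y|cube_leb. g (y k) * a y) = L2_inner unit_leb (marginal k a) g"
proof -
  interpret product_prob_space "\<lambda>_. unit_leb" UNIV ..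
  note [measurable] = borel_measurable_integrable[OF a]
  show i: "integrable cube_leb (\<lambda>y. g (y k) * a y)"
  proof (rule Bochner_Integration.integrable_bound)
    show "integrable cube_leb (\<lambda>y. B * a y)" using a by simp
    have "\<bar>g t * u\<bar> \<le> \<bar>B * u\<bar>" for t u
      using mult_right_mono[OF bd[of t] abs_ge_zero[of u]] bd[of t] by (simp add: abs_mult)
    then show "AE y in cube_leb. norm (g (y k) * a y) \<le> norm (B * a y)" by simp
  qed measurable
  have U: "{k} \<union> (UNIV - {k}) = (UNIV :: 'd set)" by auto
  have mg: "merge {k} (UNIV - {k}) (x, z) = z(k := x k)" for x z :: "'d \<Rightarrow> real"
    by (auto simp: merge_def fun_eq_iff)
  have gu: "g \<in> borel_measurable unit_leb" by (rule borel_measurable_unit_leb) simp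
  have "(LINT y|cube_leb. g (y k) * a y) =
      (\<integral>x. (\<integral>z. g ((z(k := x k)) k) * a (z(k := x k)) \<partial>Pi\<^sub>M (UNIV - {k}) (\<lambda>_. unit_leb)) \<partial>Pi\<^sub>M {k} (\<lambda>_. unit_leb))"
    using product_integral_fold[of "{k}" "UNIV - {k}" "\<lambda>y. g (y k) * a y"] i
    unfolding U mg by (simp add: cube_leb_def)
  also have "\<dots> = (\<integral>x. g (x k) * marginal k a (x k) \<partial>Pi\<^sub>M {k} (\<lambda>_. unit_leb))"
    by (simp add: marginal_def)
  also have "\<dots> = (\<integral>t. g t * marginal k a t \<partial>unit_leb)"
    by (rule product_integral_singleton[of "\<lambda>t. g t * marginal k a t"]) (use gu L2D(1)[OF m] in simp)
  finally show "(LINT y|cube_leb. g (y k) * a y) = L2_inner unit_leb (marginal k a) g"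
    by (simp add: L2_inner_def mult.commute)
qed

text \<open>\<open>b j / sqrt 2\<close> is the multiplier \<kappa> of convolution at frequency j,
  the root coming from the normalisation of \<open>cos_basis\<close>; the sine coefficients vanish
  since the marginal has a pure cosine series.\<close>

lemma marginal_coefficients:
  fixes a :: "('d::finite \<Rightarrow> real) \<Rightarrow> real"
  assumes a: "integrable cube_leb a" and m: "marginal k a \<in> L2 unit_leb"
    and ser: "L2_sums unit_leb (\<lambda>j t. b j * cos_basis j t) (marginal k a)" and j: "j \<ge> 1"
  shows "integrable cube_leb (\<lambda>y. cos (2 * pi * real j * y k) * a y)"
    and "integrable cube_leb (\<lambda>y. sin (2 * pi * real j * y k) * a y)"
    and "(LINT y|cube_leb. cos (2 * pi * real j * y k) * a y) = b j / sqrt 2"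
    and "(LINT y|cube_leb. sin (2 * pi * real j * y k) * a y) = 0"
proof -
  note c = integral_marginal[OF a m, of "\<lambda>t. cos (2 * pi * real j * t)" 1]
  note s = integral_marginal[OF a m, of "\<lambda>t. sin (2 * pi * real j * t)" 1]
  note f = cos_series_inner[OF m ser, of j]
  show "integrable cube_leb (\<lambda>y. cos (2 * pi * real j * y k) * a y)"
    and "integrable cube_leb (\<lambda>y. sin (2 * pi * real j * y k) * a y)" using c s by simp_all
  have "cos_basis j = (\<lambda>t. sqrt 2 * cos (2 * pi * real j * t))"
    using j by (simp add: cos_basis_def fun_eq_iff)
  then have "b j = sqrt 2 * L2_inner unit_leb (marginal k a) (\<lambda>t. cos (2 * pi * real j * t))"
    using f(1) by (simp add: L2_inner_commute[of _ "marginal k a"] L2_inner_cmult_left)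
  then show "(LINT y|cube_leb. cos (2 * pi * real j * y k) * a y) = b j / sqrt 2"
    using c by simp
  show "(LINT y|cube_leb. sin (2 * pi * real j * y k) * a y) = 0"
    using s f(3) by simp
qed

text \<open>Expanding cos(x - y) by the addition theorem leaves cosine and sine coefficients of the
  marginal, and the latter vanish.\<close>

lemma conv_trig_poly:
  fixes a :: "('d::finite \<Rightarrow> real) \<Rightarrow> real"
  assumes a: "integrable cube_leb a" and m: "marginal k a \<in> L2 unit_leb"
    and ser: "L2_sums unit_leb (\<lambda>j t. b j * cos_basis j t) (marginal k a)"
    and J: "\<And>j. j \<in> J \<Longrightarrow> j \<ge> 1"
  shows "conv a (\<lambda>x. \<Sum>j\<in>J. c j * cos_basis j (x k)) x = (\<Sum>j\<in>J. c j * (b j / sqrt 2) * cos_basis j (x k))"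
proof -
  note mc = marginal_coefficients[OF a m ser J]
  let ?g = "\<lambda>j y. (c j * cos_basis j (x k)) * (cos (2 * pi * real j * y k) * a y)
      + (c j * (sqrt 2 * sin (2 * pi * real j * x k))) * (sin (2 * pi * real j * y k) * a y)"
  have "conv a (\<lambda>x. \<Sum>j\<in>J. c j * cos_basis j (x k)) x = (LINT y|cube_leb. (\<Sum>j\<in>J. ?g j y))"
    unfolding conv_def sum_distrib_right
    by (intro Bochner_Integration.integral_cong refl sum.cong) (subst cos_basis_diff[OF J], assumption, simp add: algebra_simps)
  also have "\<dots> = (\<Sum>j\<in>J. (LINT y|cube_leb. ?g j y))"
    by (intro Bochner_Integration.integral_sum Bochner_Integration.integrable_add integrable_mult_right mc)
  also have "\<dots> = (\<Sum>j\<in>J. c j * (b j / sqrt 2) * cos_basis j (x k))"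
  proof (intro sum.cong refl)
    fix j assume j: "j \<in> J"
    have "(LINT y|cube_leb. ?g j y) = (LINT y|cube_leb. (c j * cos_basis j (x k)) * (cos (2 * pi * real j * y k) * a y))
      + (LINT y|cube_leb. (c j * (sqrt 2 * sin (2 * pi * real j * x k))) * (sin (2 * pi * real j * y k) * a y))"
      by (intro Bochner_Integration.integral_add integrable_mult_right mc j)
    then show "(LINT y|cube_leb. ?g j y) = c j * (b j / sqrt 2) * cos_basis j (x k)"
      unfolding integral_mult_right_zero mc(3,4)[OF j] by simp
  qed
  finally show ?thesis .
qed

text \<open>By periodicity the shift moves from \<open>f\<close> to the cosine; the sine term of its
  expansion is orthogonal to \<open>f\<close>.\<close>

lemma cos_basis_shift_integral:
  assumes f: "centered_cosine f" and j: "j \<ge> 1"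
  shows "(LINT t|unit_leb. cos_basis j t * f (t - y)) = cos (2 * pi * real j * y) * L2_inner unit_leb f (cos_basis j)"
proof -
  have fm[measurable]: "f \<in> borel_measurable borel" and per: "periodic1 f" and f2: "f \<in> L2 unit_leb"
    and fs: "L2_inner unit_leb f (\<lambda>t. sin (2 * pi * real j * t)) = 0"
    using f by (auto simp: centered_cosine_def)
  have "(LINT t|unit_leb. cos_basis j t * f (t - y)) = (LINT t|unit_leb. (\<lambda>u. cos_basis j (u + y) * f u) (t - y))"
    by simp
  also have "\<dots> = (LINT u|unit_leb. cos_basis j (u + y) * f u)"
  proof (rule periodic_shift_unit)
    have "cos_basis j (t + 1 + y) = cos_basis j (t + y)" for t
      using cos_basis_periodic[of j, unfolded periodic1_def, rule_format, of "t + y"] by (simp add: algebra_simps)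
    then show "periodic1 (\<lambda>u. cos_basis j (u + y) * f u)"
      using per by (simp add: periodic1_def)
  qed simp
  also have "\<dots> = L2_inner unit_leb (\<lambda>u. cos (2 * pi * real j * y) * cos_basis j u
      - (sqrt 2 * sin (2 * pi * real j * y)) * sin (2 * pi * real j * u)) f"
    by (simp add: L2_inner_def cos_basis_add[OF j])
  also have "\<dots> = cos (2 * pi * real j * y) * L2_inner unit_leb f (cos_basis j)"
    using fs by (subst L2_inner_diff_left)
       (simp_all add: f2 L2_cmult L2_inner_cmult_left L2_inner_commute[of _ f])
  finally show ?thesis .
qed

text \<open>Fubini's theorem moves the convolution onto the basis function, so that square integrability
  of \<open>conv a f\<close> is not needed.\<close>

lemma conv_coefficient:
  fixes a :: "('d::finite \<Rightarrow> real) \<Rightarrow> real" and f :: "'d \<Rightarrow> real \<Rightarrow> real"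
  assumes a: "integrable cube_leb a" and m: "marginal k a \<in> L2 unit_leb"
    and ser: "L2_sums unit_leb (\<lambda>j t. b j * cos_basis j t) (marginal k a)" and j: "j \<ge> 1"
    and f: "\<And>l. centered_cosine (f l)"
  shows "integrable cube_leb (\<lambda>x. cos_basis j (x k) * conv a (\<lambda>x. \<Sum>l\<in>UNIV. f l (x l)) x)"
    and "L2_inner cube_leb (\<lambda>x. cos_basis j (x k)) (conv a (\<lambda>x. \<Sum>l\<in>UNIV. f l (x l))) =
      b j / sqrt 2 * L2_inner unit_leb (f k) (cos_basis j)"
proof -
  interpret P: pair_sigma_finite "cube_leb :: ('d \<Rightarrow> real) measure" "cube_leb :: ('d \<Rightarrow> real) measure" ..
  note [measurable] = borel_measurable_integrable[OF a]
  have fm[measurable]: "f l \<in> borel_measurable borel" and per: "periodic1 (f l)" and f2: "f l \<in> L2 unit_leb" for l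
    using f by (auto simp: centered_cosine_def)
  define G where "G l y x = cos_basis j (x k) * f l (x l - y l) * a y" for l and y x :: "'d \<Rightarrow> real"
  define A where "A l = (LINT t|unit_leb. \<bar>f l t\<bar>)" for l
  have Gm[measurable]: "case_prod (G l) \<in> borel_measurable (cube_leb \<Otimes>\<^sub>M cube_leb)" for l
    unfolding G_def by measurable
  have fi: "integrable unit_leb (f l)" for l using f2 by (rule unit.L2_integrable)
  have sh: "integrable unit_leb (\<lambda>t. f l (t - y))" for l y
    using periodic_shift_unit(2)[OF fm per fi] .
  have sha: "(LINT t|unit_leb. \<bar>f l (t - y)\<bar>) = A l" for l y
    unfolding A_def using per by (intro periodic_shift_unit(1)) (auto simp: periodic1_def)
  have cubesh: "integrable cube_leb (\<lambda>x. f l (x l - y))" "(LINT x|cube_leb. \<bar>f l (x l - y)\<bar>) = A l"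
    "(LINT x|cube_leb. f l (x l - y)) = (LINT t|unit_leb. f l (t - y))" for l y
    using integrable_cube_coord[OF sh, of l l y] sha[of l y]
      integral_cube_coord[of "\<lambda>t. \<bar>f l (t - y)\<bar>" l] integral_cube_coord[of "\<lambda>t. f l (t - y)" l] sh[of l y]
    by auto
  have bnd: "\<bar>cos_basis j t * u\<bar> \<le> 2 * \<bar>u\<bar>" for t u
    using mult_right_mono[OF abs_cos_basis_le[of j t] abs_ge_zero[of u]] by (simp add: abs_mult)
  have cbi: "integrable cube_leb (\<lambda>x. cos_basis j (x k) * f l (x l - y))" for l y
    by (rule Bochner_Integration.integrable_bound[where f="\<lambda>x. 2 * f l (x l - y)"])
       (use cubesh(1)[of l y] bnd in \<open>auto simp: abs_mult\<close>)
  \<comment> \<open>Integrating over x first bounds the absolute value by a multiple of |a y|,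
    because the L1 norm of a periodic function does not depend on the shift.\<close>
  have Gi: "integrable (cube_leb \<Otimes>\<^sub>M cube_leb) (case_prod (G l))" for l
  proof (rule P.Fubini_integrable)
    show "integrable cube_leb (\<lambda>y. LINT x|cube_leb. norm (case_prod (G l) (y, x)))"
    proof (rule Bochner_Integration.integrable_bound[where f="\<lambda>y. 2 * A l * a y"])
      show "integrable cube_leb (\<lambda>y. 2 * A l * a y)" using a by simp
      show "AE y in cube_leb. norm (LINT x|cube_leb. norm (case_prod (G l) (y, x))) \<le> norm (2 * A l * a y)"
      proof (rule AE_I2)
        fix y :: "'d \<Rightarrow> real"
        have A0: "0 \<le> A l" unfolding A_def by (intro integral_nonneg_AE) simp
        have "(LINT x|cube_leb. norm (case_prod (G l) (y, x))) \<le> (LINT x|cube_leb. (2 * \<bar>a y\<bar>) * \<bar>f l (x l - y l)\<bar>)"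
        proof (rule integral_mono)
          show "integrable cube_leb (\<lambda>x. norm (case_prod (G l) (y, x)))"
            using cbi[of l "y l"] by (simp add: G_def)
          show "integrable cube_leb (\<lambda>x. (2 * \<bar>a y\<bar>) * \<bar>f l (x l - y l)\<bar>)"
            using cubesh(1)[of l "y l"] by simp
          show "norm (case_prod (G l) (y, x)) \<le> (2 * \<bar>a y\<bar>) * \<bar>f l (x l - y l)\<bar>" for x
            using mult_right_mono[OF bnd[of "x k" "f l (x l - y l)"] abs_ge_zero[of "a y"]]
            by (simp add: G_def abs_mult algebra_simps)
        qed
        also have "\<dots> = 2 * A l * \<bar>a y\<bar>" using cubesh(2)[of l "y l"] by simp
        finally show "norm (LINT x|cube_leb. norm (case_prod (G l) (y, x))) \<le> norm (2 * A l * a y)"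
          using A0 by (simp add: abs_mult integral_nonneg_AE)
      qed
    qed measurable
    show "AE y in cube_leb. integrable cube_leb (\<lambda>x. case_prod (G l) (y, x))"
      using cbi by (simp add: G_def)
  qed measurable
  \<comment> \<open>For l other than k the integral over x factors, and the factor of the cosine is
    its mean, which is zero for j \<ge> 1.\<close>
  have inner: "(LINT x|cube_leb. G l y x) =
      (if l = k then L2_inner unit_leb (f k) (cos_basis j) * (cos (2 * pi * real j * y k) * a y) else 0)" for l y
  proof (cases "l = k")
    case True
    have "(LINT x|cube_leb. cos_basis j (x k) * f k (x k - y k)) = (LINT t|unit_leb. cos_basis j t * f k (t - y k))"
      by (rule integral_cube_coord) (use sh[of k "y k"] in auto)
    then show ?thesis using True by (simp add: G_def cos_basis_shift_integral[OF f j])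
  next
    case False
    have "(LINT x|cube_leb. cos_basis j (x k) * f l (x l - y l)) = 0"
      using cube_coord_prod(2)[of "cos_basis j" "\<lambda>t. f l (t - y l)" k l] False sh
      by (simp add: unit.L2_integrable integral_cos_basis[OF j])
    then show ?thesis using False by (simp add: G_def)
  qed
  define H where "H y x = (\<Sum>l\<in>UNIV. G l y x)" for y x
  have Hi: "integrable (cube_leb \<Otimes>\<^sub>M cube_leb) (case_prod H)"
    unfolding H_def[abs_def] case_prod_beta' using Gi by (simp add: case_prod_beta')
  have Hc: "(LINT y|cube_leb. H y x) = cos_basis j (x k) * conv a (\<lambda>x. \<Sum>l\<in>UNIV. f l (x l)) x" for x
    unfolding conv_def integral_mult_right_zero[symmetric]
    by (intro Bochner_Integration.integral_cong refl) (simp add: H_def G_def sum_distrib_left sum_distrib_right mult.assoc)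
  show "integrable cube_leb (\<lambda>x. cos_basis j (x k) * conv a (\<lambda>x. \<Sum>l\<in>UNIV. f l (x l)) x)"
    using P.integrable_snd[OF Hi] by (simp add: Hc)
  have Gx: "integrable cube_leb (\<lambda>x. G l y x)" for l y
    using cbi[of l "y l"] by (simp add: G_def)
  have "L2_inner cube_leb (\<lambda>x. cos_basis j (x k)) (conv a (\<lambda>x. \<Sum>l\<in>UNIV. f l (x l))) =
      (LINT x|cube_leb. (LINT y|cube_leb. H y x))"
    by (simp add: L2_inner_def Hc)
  also have "\<dots> = (LINT y|cube_leb. (LINT x|cube_leb. H y x))"
    using P.integral_fst[OF Hi] P.integral_snd[OF Hi] by simp
  also have "\<dots> = (LINT y|cube_leb. L2_inner unit_leb (f k) (cos_basis j) * (cos (2 * pi * real j * y k) * a y))"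
    using Gx by (intro Bochner_Integration.integral_cong refl) (simp add: H_def inner)
  also have "\<dots> = b j / sqrt 2 * L2_inner unit_leb (f k) (cos_basis j)"
    by (simp add: marginal_coefficients(3)[OF a m ser j])
  finally show "L2_inner cube_leb (\<lambda>x. cos_basis j (x k)) (conv a (\<lambda>x. \<Sum>l\<in>UNIV. f l (x l))) =
      b j / sqrt 2 * L2_inner unit_leb (f k) (cos_basis j)" .
qed

section \<open>White noise\<close>

interpretation std_normal: real_distribution std_normal_distribution
  by (rule real_dist_normal_dist)

text \<open>Every variance, including 0, is obtained by scaling the standard normal law; this
  removes the case split from the lemmas that follow.\<close>

lemma centered_normal_eq:
  assumes "v \<ge> 0"
  shows "centered_normal v = distr std_normal_distribution borel (\<lambda>x. sqrt v * x)"
proof (cases "v = 0")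
  case True
  then show ?thesis by (simp add: centered_normal_def std_normal.distr_const)
next
  case False
  with assms have v: "v > 0" by simp
  have "distributed std_normal_distribution lborel (\<lambda>x. x) std_normal_density"
    by (simp add: distributed_def distr_id2)
  from std_normal.normal_density_affine[OF this, of "sqrt v" 0] v
  have "distr std_normal_distribution lborel (\<lambda>x. sqrt v * x) = density lborel (\<lambda>x. ennreal (normal_density 0 (sqrt v) x))"
    by (simp add: distributed_def)
  moreover have "distr std_normal_distribution lborel (\<lambda>x. sqrt v * x) = distr std_normal_distribution borel (\<lambda>x. sqrt v * x)"
    by (intro distr_cong) simp_all
  ultimately show ?thesis using False by (simp add: centered_normal_def)
qed

lemma centered_normal_char:
  assumes "v \<ge> 0"
  shows "(\<integral>x. iexp x \<partial>centered_normal v) = exp (- v / 2)"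
proof -
  have "(\<integral>x. iexp x \<partial>centered_normal v) = char std_normal_distribution (sqrt v)"
    unfolding centered_normal_eq[OF assms] char_def by (subst integral_distr) simp_all
  then show ?thesis using assms by (simp add: char_std_normal_distribution)
qed

lemma centered_normal_second_moment:
  assumes "v \<ge> 0"
  shows "(\<integral>x. x\<^sup>2 \<partial>centered_normal v) = v" "integrable (centered_normal v) (\<lambda>x. x\<^sup>2)"
proof -
  have m: "(LINT x|std_normal_distribution. x\<^sup>2) = 1" "integrable std_normal_distribution (\<lambda>x. x\<^sup>2)"
    using std_normal_distribution_even_moments[of 1] by (simp_all add: fact_numeral)
  show "(\<integral>x. x\<^sup>2 \<partial>centered_normal v) = v"
    unfolding centered_normal_eq[OF assms] using assms m by (simp add: integral_distr power_mult_distrib)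
  show "integrable (centered_normal v) (\<lambda>x. x\<^sup>2)"
    unfolding centered_normal_eq[OF assms] using assms m by (simp add: integrable_distr_eq power_mult_distrib)
qed

text \<open>With the exponent 1/4 the integrand becomes \<open>sqrt 2\<close> times the normal
  density of variance 2.\<close>

lemma std_normal_exp_square: "(\<integral>\<^sup>+x. ennreal (exp (x\<^sup>2 / 4)) \<partial>std_normal_distribution) = ennreal (sqrt 2)"
proof -
  have "(\<integral>\<^sup>+x. ennreal (exp (x\<^sup>2 / 4)) \<partial>std_normal_distribution) =
      (\<integral>\<^sup>+x. ennreal (std_normal_density x) * ennreal (exp (x\<^sup>2 / 4)) \<partial>lborel)"
    by (rule nn_integral_density) simp_all
  also have "\<dots> = (\<integral>\<^sup>+x. ennreal (sqrt 2) * ennreal (normal_density 0 (sqrt 2) x) \<partial>lborel)"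
  proof (rule nn_integral_cong)
    fix x :: real
    have "std_normal_density x * exp (x\<^sup>2 / 4) = (1 / sqrt (2 * pi)) * (exp (- x\<^sup>2 / 2) * exp (x\<^sup>2 / 4))"
      by (simp add: std_normal_density_def)
    also have "exp (- x\<^sup>2 / 2) * exp (x\<^sup>2 / 4) = exp (- x\<^sup>2 / 4)"
      by (simp add: exp_add[symmetric])
    also have "(1 / sqrt (2 * pi)) * exp (- x\<^sup>2 / 4) = sqrt 2 * normal_density 0 (sqrt 2) x"
      by (simp add: normal_density_def real_sqrt_mult field_simps)
    finally show "ennreal (std_normal_density x) * ennreal (exp (x\<^sup>2 / 4)) = ennreal (sqrt 2) * ennreal (normal_density 0 (sqrt 2) x)"
      by (simp add: ennreal_mult[symmetric])
  qed
  also have "\<dots> = ennreal (sqrt 2) * (\<integral>\<^sup>+x. ennreal (normal_density 0 (sqrt 2) x) \<partial>lborel)"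
    by (rule nn_integral_cmult) simp
  also have "(\<integral>\<^sup>+x. ennreal (normal_density 0 (sqrt 2) x) \<partial>lborel) = 1"
    by (subst nn_integral_eq_integral) simp_all
  finally show ?thesis by simp
qed

text \<open>For \<open>v = 0\<close> the quotient is \<open>0\<close>.\<close>

lemma centered_normal_exp_square:
  assumes "v \<ge> 0"
  shows "(\<integral>\<^sup>+x. ennreal (exp (x\<^sup>2 / (4 * v))) \<partial>centered_normal v) \<le> 2"
proof -
  have "(\<integral>\<^sup>+x. ennreal (exp (x\<^sup>2 / (4 * v))) \<partial>centered_normal v) =
      (\<integral>\<^sup>+x. ennreal (exp ((sqrt v * x)\<^sup>2 / (4 * v))) \<partial>std_normal_distribution)"
    unfolding centered_normal_eq[OF assms] by (subst nn_integral_distr) simp_all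
  also have "\<dots> \<le> (\<integral>\<^sup>+x. ennreal (exp (x\<^sup>2 / 4)) \<partial>std_normal_distribution)"
    using assms by (intro nn_integral_mono) (auto simp: power_mult_distrib)
  also have "\<dots> \<le> 2"
    unfolding std_normal_exp_square using real_sqrt_le_mono[of 2 4]
    by (simp flip: ennreal_numeral)
  finally show ?thesis .
qed

lemma L2_norm_zero_AE:
  assumes "f \<in> L2 M" "L2_norm M f = 0"
  shows "AE x in M. f x = 0"
proof -
  have "(LINT x|M. (f x)\<^sup>2) = 0" using assms(2) L2_norm_power2[of M f] by simp
  then show ?thesis
    using integral_nonneg_eq_0_iff_AE[OF L2D(2)[OF assms(1)]] by simp
qed

section \<open>White noise as an almost surely linear Gaussian isometry\<close>

locale noise =
  fixes M :: "'w measure" and W :: "(('d::finite \<Rightarrow> real) \<Rightarrow> real) \<Rightarrow> 'w \<Rightarrow> real"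
  assumes noise: "white_noise M W"
begin

sublocale prob_space M
  using noise by (simp add: white_noise_def)

lemma noise_measurable: "h \<in> L2 cube_leb \<Longrightarrow> W h \<in> borel_measurable M"
  using noise by (simp add: white_noise_def)

text \<open>The combination is written as a difference so that \<open>L2_norm_power2_diff\<close>
  expands its norm; the variance is thereby visibly nonnegative.\<close>

lemma distr_noise_pair:
  assumes "h\<^sub>1 \<in> L2 cube_leb" "h\<^sub>2 \<in> L2 cube_leb"
  shows "distr M borel (\<lambda>\<omega>. u * W h\<^sub>1 \<omega> + v * W h\<^sub>2 \<omega>) =
    centered_normal ((L2_norm cube_leb (\<lambda>x. u * h\<^sub>1 x - (- v) * h\<^sub>2 x))\<^sup>2)"
proof -
  have "(L2_norm cube_leb (\<lambda>x. u * h\<^sub>1 x - (- v) * h\<^sub>2 x))\<^sup>2 =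
      u\<^sup>2 * (L2_norm cube_leb h\<^sub>1)\<^sup>2 + 2 * u * v * L2_inner cube_leb h\<^sub>1 h\<^sub>2 + v\<^sup>2 * (L2_norm cube_leb h\<^sub>2)\<^sup>2"
    by (subst L2_norm_power2_diff[OF L2_cmult[OF assms(1)] L2_cmult[OF assms(2)]])
       (simp add: L2_norm_power2 power_mult_distrib L2_inner_def mult.commute mult.left_commute)
  then show ?thesis using noise assms by (simp add: white_noise_def)
qed

lemma distr_noise:
  assumes "h \<in> L2 cube_leb"
  shows "distr M borel (W h) = centered_normal ((L2_norm cube_leb h)\<^sup>2)"
  using distr_noise_pair[OF assms assms, of 1 0] by simp

lemma noise_L2: "h \<in> L2 cube_leb \<Longrightarrow> W h \<in> L2 M"
  using centered_normal_second_moment(2)[of "(L2_norm cube_leb h)\<^sup>2"] noise_measurable[of h]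
  by (simp add: L2_def integrable_distr_eq flip: distr_noise)

text \<open>Polarisation: the variances at \<open>h\<^sub>1\<close>, \<open>h\<^sub>2\<close> and
  their difference are second moments of the noise.\<close>

lemma noise_isometry:
  assumes h: "h\<^sub>1 \<in> L2 cube_leb" "h\<^sub>2 \<in> L2 cube_leb"
  shows "L2_inner M (W h\<^sub>1) (W h\<^sub>2) = L2_inner cube_leb h\<^sub>1 h\<^sub>2"
proof -
  note [measurable] = noise_measurable[OF h(1)] noise_measurable[OF h(2)]
  have n: "(L2_norm M (\<lambda>\<omega>. u * W h\<^sub>1 \<omega> + v * W h\<^sub>2 \<omega>))\<^sup>2 = (L2_norm cube_leb (\<lambda>x. u * h\<^sub>1 x - (- v) * h\<^sub>2 x))\<^sup>2" for u v
  proof -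
    have "(L2_norm M (\<lambda>\<omega>. u * W h\<^sub>1 \<omega> + v * W h\<^sub>2 \<omega>))\<^sup>2 = (\<integral>x. x\<^sup>2 \<partial>distr M borel (\<lambda>\<omega>. u * W h\<^sub>1 \<omega> + v * W h\<^sub>2 \<omega>))"
      by (simp add: L2_norm_power2 integral_distr)
    then show ?thesis
      unfolding distr_noise_pair[OF h] by (simp only: centered_normal_second_moment(1)[OF zero_le_power2])
  qed
  have a: "(L2_norm M (W h\<^sub>1))\<^sup>2 = (L2_norm cube_leb h\<^sub>1)\<^sup>2" using n[of 1 0] by simp
  have b: "(L2_norm M (W h\<^sub>2))\<^sup>2 = (L2_norm cube_leb h\<^sub>2)\<^sup>2" using n[of 0 1] by simp
  have "(L2_norm M (\<lambda>\<omega>. W h\<^sub>1 \<omega> - W h\<^sub>2 \<omega>))\<^sup>2 = (L2_norm cube_leb (\<lambda>x. h\<^sub>1 x - h\<^sub>2 x))\<^sup>2"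
    using n[of 1 "-1"] by simp
  then show ?thesis
    using L2_norm_power2_diff[OF noise_L2[OF h(1)] noise_L2[OF h(2)]] L2_norm_power2_diff[OF h] a b by simp
qed

text \<open>By the isometry |W H|^2, <W H, S> and |S|^2 are the same sum, so \<open>W H\<close> and
  \<open>S\<close> have L2 distance 0. The null set depends on the combination, so only finitely
  many combinations may be used at once.\<close>

lemma noise_linear:
  assumes A: "finite A" and h: "\<And>i. i \<in> A \<Longrightarrow> h i \<in> L2 cube_leb"
  shows "AE \<omega> in M. W (\<lambda>x. \<Sum>i\<in>A. c i * h i x) \<omega> = (\<Sum>i\<in>A. c i * W (h i) \<omega>)"
proof -
  define H where "H = (\<lambda>x. \<Sum>i\<in>A. c i * h i x)"
  define S where "S = (\<lambda>\<omega>. \<Sum>i\<in>A. c i * W (h i) \<omega>)"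
  have ch: "(\<lambda>x. c i * h i x) \<in> L2 cube_leb" and cW: "(\<lambda>\<omega>. c i * W (h i) \<omega>) \<in> L2 M" if "i \<in> A" for i
    using h[OF that] by (auto intro: L2_cmult noise_L2)
  have H: "H \<in> L2 cube_leb" unfolding H_def using ch by (rule L2_sum)
  have S: "S \<in> L2 M" unfolding S_def using cW by (rule L2_sum)
  have HS: "L2_inner M (W H) S = (\<Sum>i\<in>A. c i * L2_inner cube_leb H (h i))"
    unfolding S_def
    by (subst L2_inner_sum_right[OF cW noise_L2[OF H]])
       (simp_all add: L2_inner_cmult_right noise_isometry H h)
  have i: "L2_inner M S (W (h i)) = L2_inner cube_leb H (h i)" if "i \<in> A" for i
    unfolding S_def H_def
    by (subst L2_inner_sum_left[OF cW noise_L2[OF h[OF that]]], assumption, subst L2_inner_sum_left[OF ch h[OF that]], assumption)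
       (simp add: L2_inner_cmult_left noise_isometry h that)
  have "L2_inner M S S = (\<Sum>i\<in>A. L2_inner M S (\<lambda>\<omega>. c i * W (h i) \<omega>))"
    by (subst (2) S_def) (rule L2_inner_sum_right[OF cW S])
  then have SS: "(L2_norm M S)\<^sup>2 = (\<Sum>i\<in>A. c i * L2_inner cube_leb H (h i))"
    by (simp add: L2_inner_self L2_inner_cmult_right i)
  have "L2_inner cube_leb H H = (\<Sum>i\<in>A. L2_inner cube_leb H (\<lambda>x. c i * h i x))"
    by (subst (2) H_def) (rule L2_inner_sum_right[OF ch H])
  then have HH: "(L2_norm M (W H))\<^sup>2 = (\<Sum>i\<in>A. c i * L2_inner cube_leb H (h i))"
    by (simp add: L2_inner_self[symmetric] noise_isometry H L2_inner_cmult_right)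
  have "(L2_norm M (\<lambda>\<omega>. W H \<omega> - S \<omega>))\<^sup>2 = 0"
    by (subst L2_norm_power2_diff[OF noise_L2[OF H] S]) (simp add: HS SS HH)
  then have "AE \<omega> in M. W H \<omega> - S \<omega> = 0"
    by (intro L2_norm_zero_AE L2_diff noise_L2 H S) simp
  then show ?thesis by (simp add: H_def S_def)
qed

section \<open>The law of the noise on the product space, and the change of one direction\<close>

definition noise_data :: "'w \<Rightarrow> 'd data" where
  "noise_data \<omega> = (\<lambda>h\<in>L2 cube_leb. W h \<omega>)"

definition noise_law :: "'d data measure" where
  "noise_law = distr M data_space noise_data"

lemma noise_data_measurable [measurable]: "noise_data \<in> measurable M data_space"
  unfolding noise_data_def data_space_def
  by (rule measurable_restrict) (simp add: noise_measurable)

sublocale law: prob_space noise_law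
  unfolding noise_law_def by (rule prob_space_distr) simp

lemma sets_noise_law [measurable_cong, simp]: "sets noise_law = sets data_space"
  by (simp add: noise_law_def)

lemma space_noise_law [simp]: "space noise_law = space data_space"
  by (simp add: noise_law_def)

text \<open>Almost surely the exponent is the noise at a single function, hence centred normal with
  the squared norm of that function as variance.\<close>

lemma noise_law_char:
  assumes J: "finite J" "J \<subseteq> L2 cube_leb"
  shows "(\<integral>y. iexp (\<Sum>h\<in>J. t h * y h) \<partial>noise_law) = exp (- (L2_norm cube_leb (\<lambda>x. \<Sum>h\<in>J. t h * h x))\<^sup>2 / 2)"
proof -
  define H where "H = (\<lambda>x. \<Sum>h\<in>J. t h * h x)"
  have H: "H \<in> L2 cube_leb" unfolding H_def using J by (intro L2_sum L2_cmult) auto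
  have m: "(\<lambda>y. \<Sum>h\<in>J. t h * y h) \<in> borel_measurable data_space"
    unfolding data_space_def by (rule fin_lin_measurable) (use J in \<open>auto simp: fin_lin_def\<close>)
  have "(\<integral>y. iexp (\<Sum>h\<in>J. t h * y h) \<partial>noise_law) = (\<integral>\<omega>. iexp (\<Sum>h\<in>J. t h * noise_data \<omega> h) \<partial>M)"
    unfolding noise_law_def by (rule integral_distr) (use m in measurable)
  also have "\<dots> = (\<integral>\<omega>. iexp (W H \<omega>) \<partial>M)"
  proof (rule integral_cong_AE)
    have "AE \<omega> in M. W H \<omega> = (\<Sum>h\<in>J. t h * W h \<omega>)"
      using noise_linear[OF J(1), of "\<lambda>h. h" t] J(2) by (auto simp: H_def)
    moreover have "(\<Sum>h\<in>J. t h * noise_data \<omega> h) = (\<Sum>h\<in>J. t h * W h \<omega>)" for \<omega>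
      using J by (intro sum.cong) (auto simp: noise_data_def)
    ultimately show "AE \<omega> in M. iexp (\<Sum>h\<in>J. t h * noise_data \<omega> h) = iexp (W H \<omega>)"
      by auto
    show "(\<lambda>\<omega>. iexp (W H \<omega>)) \<in> borel_measurable M" using noise_measurable[OF H] by measurable
    show "(\<lambda>\<omega>. iexp (\<Sum>h\<in>J. t h * noise_data \<omega> h)) \<in> borel_measurable M"
      using measurable_compose[OF noise_data_measurable m] by measurable
  qed
  also have "\<dots> = (\<integral>x. iexp x \<partial>distr M borel (W H))"
    using noise_measurable[OF H] by (subst integral_distr) simp_all
  also have "\<dots> = exp (- (L2_norm cube_leb H)\<^sup>2 / 2)"
    unfolding distr_noise[OF H] by (rule centered_normal_char) simp
  finally show ?thesis by (simp add: H_def)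
qed

text \<open>For |u| = 1 the new value at \<open>u\<close> is \<open>z\<close>, and adding s to
  \<open>z\<close> adds s <h, u> at every h: a change of mean along \<open>u\<close> becomes a
  translation of one real variable.\<close>

definition replace_direction :: "(('d \<Rightarrow> real) \<Rightarrow> real) \<Rightarrow> 'd data \<Rightarrow> real \<Rightarrow> 'd data" where
  "replace_direction u y z = (\<lambda>h\<in>L2 cube_leb. y h + (z - y u) * L2_inner cube_leb h u)"

lemma component_measurable:
  "h \<in> L2 cube_leb \<Longrightarrow> (\<lambda>y. y h) \<in> borel_measurable data_space"
  unfolding data_space_def by (rule measurable_component_singleton)

lemma replace_direction_measurable:
  assumes "u \<in> L2 cube_leb"
  shows "case_prod (replace_direction u) \<in> measurable (data_space \<Otimes>\<^sub>M borel) data_space"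
proof -
  have "(\<lambda>(y, z). y h + (z - y u) * L2_inner cube_leb h u) \<in> borel_measurable (data_space \<Otimes>\<^sub>M borel)"
    if "h \<in> L2 cube_leb" for h
    using measurable_compose[OF measurable_fst component_measurable[OF that]]
      measurable_compose[OF measurable_fst component_measurable[OF assms]]
    unfolding case_prod_beta' by (intro borel_measurable_add borel_measurable_times borel_measurable_diff) auto
  then show ?thesis
    unfolding replace_direction_def case_prod_beta'
    by (subst (2) data_space_def) (auto intro!: measurable_restrict)
qed

text \<open>A combination represented by H turns into one represented by H - c u plus the
  independent variable c z, where c = <H, u>. By Pythagoras |H - c u|^2 + c^2 = |H|^2, so the
  characteristic functions agree.\<close>

lemma noise_law_replace:
  assumes u: "u \<in> L2 cube_leb" "L2_norm cube_leb u = 1"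
  shows "distr (noise_law \<Otimes>\<^sub>M std_normal_distribution) data_space (case_prod (replace_direction u)) = noise_law"
proof -
  interpret P: pair_sigma_finite noise_law std_normal_distribution ..
  interpret PP: pair_prob_space noise_law std_normal_distribution ..
  have Rm: "case_prod (replace_direction u) \<in> measurable (noise_law \<Otimes>\<^sub>M std_normal_distribution) data_space"
    using replace_direction_measurable[OF u(1)] by (simp cong: measurable_cong_sets sets_pair_measure_cong)
  show ?thesis
  proof (rule PiM_borel_eqI_char[where I="L2 cube_leb"])
    show "prob_space noise_law" by (rule law.prob_space_axioms)
    show "prob_space (distr (noise_law \<Otimes>\<^sub>M std_normal_distribution) data_space (case_prod (replace_direction u)))"
      by (rule PP.prob_space_distr[OF Rm])
    show "sets noise_law = sets (\<Pi>\<^sub>M h\<in>L2 cube_leb. borel)"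
      "sets (distr (noise_law \<Otimes>\<^sub>M std_normal_distribution) data_space (case_prod (replace_direction u))) = sets (\<Pi>\<^sub>M h\<in>L2 cube_leb. borel)"
      by (simp_all add: data_space_def)
    fix Y :: "'d data \<Rightarrow> real" assume Y: "fin_lin (L2 cube_leb) Y"
    then obtain J t where J: "finite J" "J \<subseteq> L2 cube_leb" and Yd: "Y = (\<lambda>y. \<Sum>h\<in>J. t h * y h)"
      unfolding fin_lin_def by blast
    define H where "H = (\<lambda>x. \<Sum>h\<in>J. t h * h x)"
    have H: "H \<in> L2 cube_leb" unfolding H_def using J by (intro L2_sum L2_cmult) auto
    define c where "c = L2_inner cube_leb H u"
    have c: "c = (\<Sum>h\<in>J. t h * L2_inner cube_leb h u)"
      unfolding c_def H_def using J by (subst L2_inner_sum_left) (auto simp: L2_cmult u L2_inner_cmult_left)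
    define Z :: "'d data \<Rightarrow> real" where "Z y = Y y + (- c) * y u" for y
    have Z: "fin_lin (L2 cube_leb) Z"
      unfolding Z_def by (intro fin_lin_add fin_lin_cmult fin_lin_component Y u)
    have Zm[measurable]: "Z \<in> borel_measurable data_space" and Ym: "Y \<in> borel_measurable data_space"
      unfolding data_space_def by (intro fin_lin_measurable Z Y)+
    have YR: "Y (replace_direction u y z) = Z y + z * c" for y z
    proof -
      have "Y (replace_direction u y z) = (\<Sum>h\<in>J. t h * y h + (z - y u) * (t h * L2_inner cube_leb h u))"
        unfolding Yd using J by (intro sum.cong) (auto simp: replace_direction_def algebra_simps)
      also have "\<dots> = Y y + (z - y u) * c"
        by (simp add: sum.distrib sum_distrib_left[symmetric] Yd c)
      finally show ?thesis by (simp add: Z_def algebra_simps)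
    qed
    obtain J' t' where J': "finite J'" "J' \<subseteq> L2 cube_leb" and Zd: "Z = (\<lambda>y. \<Sum>h\<in>J'. t' h * y h)"
      using Z unfolding fin_lin_def by blast
    define H' where "H' = (\<lambda>x. \<Sum>h\<in>J'. t' h * h x)"
    \<comment> \<open>\<open>Z\<close> applied to the evaluations at a point represents it as an element of \<open>L2\<close>.\<close>
    have H': "H' = (\<lambda>x. H x - c * u x)"
    proof
      fix x
      have "H' x = Z (\<lambda>h. h x)" by (simp add: H'_def Zd)
      also have "\<dots> = H x - c * u x" by (simp add: Z_def Yd H_def)
      finally show "H' x = H x - c * u x" .
    qed
    have nH': "(L2_norm cube_leb H')\<^sup>2 = (L2_norm cube_leb H)\<^sup>2 - c\<^sup>2"
    proof -
      have "(L2_norm cube_leb (\<lambda>x. c * u x))\<^sup>2 = c\<^sup>2 * (L2_norm cube_leb u)\<^sup>2"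
        by (simp add: L2_norm_power2 power_mult_distrib)
      moreover have "L2_inner cube_leb H (\<lambda>x. c * u x) = c * c"
        by (simp add: L2_inner_cmult_right c_def)
      ultimately show ?thesis unfolding H'
        by (subst L2_norm_power2_diff[OF H L2_cmult[OF u(1)]]) (simp add: u(2) power2_eq_square)
    qed
    have Yr: "(\<lambda>y. iexp (Y y)) \<in> borel_measurable data_space" using Ym by measurable
    have "(\<integral>y. iexp (Y y) \<partial>distr (noise_law \<Otimes>\<^sub>M std_normal_distribution) data_space (case_prod (replace_direction u)))
        = (\<integral>p. iexp (Y (case_prod (replace_direction u) p)) \<partial>(noise_law \<Otimes>\<^sub>M std_normal_distribution))"
      by (rule integral_distr[OF Rm Yr])
    also have "\<dots> = (\<integral>(y, z). iexp (Z y) * iexp (c * z) \<partial>(noise_law \<Otimes>\<^sub>M std_normal_distribution))"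
      by (intro Bochner_Integration.integral_cong refl)
         (auto simp: YR distrib_left exp_add mult.commute)
    also have "\<dots> = (\<integral>y. (\<integral>z. iexp (Z y) * iexp (c * z) \<partial>std_normal_distribution) \<partial>noise_law)"
    proof (rule P.integral_fst[symmetric])
      show "integrable (noise_law \<Otimes>\<^sub>M std_normal_distribution) (\<lambda>(y, z). iexp (Z y) * iexp (c * z))"
        by (rule PP.integrable_const_bound[where B=1]) (auto simp: norm_mult)
    qed
    also have "\<dots> = (\<integral>y. iexp (Z y) \<partial>noise_law) * char std_normal_distribution c"
      by (simp add: char_def)
    also have "\<dots> = complex_of_real (exp (- (L2_norm cube_leb H')\<^sup>2 / 2) * exp (- c\<^sup>2 / 2))"
      using noise_law_char[OF J', of t'] by (simp add: Zd H'_def char_std_normal_distribution)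
    also have "exp (- (L2_norm cube_leb H')\<^sup>2 / 2) * exp (- c\<^sup>2 / 2) = exp (- (L2_norm cube_leb H)\<^sup>2 / 2)"
      unfolding nH' by (simp add: exp_add[symmetric] field_simps)
    also have "complex_of_real \<dots> = (\<integral>y. iexp (Y y) \<partial>noise_law)"
      using noise_law_char[OF J, of t] by (simp add: Yd H_def)
    finally show "(\<integral>y. iexp (Y y) \<partial>distr (noise_law \<Otimes>\<^sub>M std_normal_distribution) data_space (case_prod (replace_direction u)))
        = (\<integral>y. iexp (Y y) \<partial>noise_law)" .
  qed
qed

end

text \<open>The two densities are bounded below by the density at \<open>2\<close> on \<open>[-1, 1]\<close>.\<close>

lemma two_point_normal:
  fixes V :: "real \<Rightarrow> real"
  assumes V[measurable]: "V \<in> borel_measurable borel" and r: "\<bar>r\<bar> \<le> 1"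
  shows "ennreal (4 * std_normal_density 2 * \<eta>\<^sup>2) \<le>
    (\<integral>\<^sup>+z. ennreal ((V (z + r) - \<eta>)\<^sup>2) \<partial>std_normal_distribution) +
    (\<integral>\<^sup>+z. ennreal ((V (z - r) + \<eta>)\<^sup>2) \<partial>std_normal_distribution)"
proof -
  let ?p = std_normal_density
  have dens: "?p 2 \<le> ?p x" if "\<bar>x\<bar> \<le> 2" for x
  proof -
    have "x\<^sup>2 \<le> 2\<^sup>2" using that power_mono[of "\<bar>x\<bar>" 2 2] by simp
    then show ?thesis by (simp add: std_normal_density_def divide_right_mono)
  qed
  have shift: "(\<integral>\<^sup>+z. ennreal ((V (z + q) - s)\<^sup>2) \<partial>std_normal_distribution) =
      (\<integral>\<^sup>+x. ennreal (?p (x - q)) * ennreal ((V x - s)\<^sup>2) \<partial>lborel)" for q s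
  proof -
    have "(\<integral>\<^sup>+z. ennreal ((V (z + q) - s)\<^sup>2) \<partial>std_normal_distribution) =
      (\<integral>\<^sup>+z. ennreal (?p z) * ennreal ((V (z + q) - s)\<^sup>2) \<partial>lborel)"
      by (rule nn_integral_density) simp_all
    also have "\<dots> = (\<integral>\<^sup>+x. ennreal (?p (x - q)) * ennreal ((V x - s)\<^sup>2) \<partial>lborel)"
      by (subst nn_integral_real_affine[where c=1 and t="- q"]) simp_all
    finally show ?thesis .
  qed
  \<comment> \<open>The interval [-1, 1] has length 2, and at any point the two losses sum to at
    least \<open>2 * \<eta>\<^sup>2\<close>; this gives the factor 4.\<close>
  have "ennreal (4 * ?p 2 * \<eta>\<^sup>2) = ennreal (?p 2 * (2 * \<eta>\<^sup>2)) * emeasure lborel {-1..1::real}"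
    by (simp add: ennreal_mult[symmetric] flip: ennreal_numeral)
  also have "\<dots> = (\<integral>\<^sup>+x. ennreal (?p 2 * (2 * \<eta>\<^sup>2)) * indicator {-1..1::real} x \<partial>lborel)"
    by (simp add: nn_integral_cmult_indicator)
  also have "\<dots> \<le> (\<integral>\<^sup>+x. ennreal (?p (x - r)) * ennreal ((V x - \<eta>)\<^sup>2) + ennreal (?p (x - (- r))) * ennreal ((V x - (- \<eta>))\<^sup>2) \<partial>lborel)"
  proof (rule nn_integral_mono)
    fix x :: real
    show "ennreal (?p 2 * (2 * \<eta>\<^sup>2)) * indicator {-1..1} x \<le>
        ennreal (?p (x - r)) * ennreal ((V x - \<eta>)\<^sup>2) + ennreal (?p (x - (- r))) * ennreal ((V x - (- \<eta>))\<^sup>2)"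
    proof (cases "x \<in> {-1..1}")
      case True
      then have x: "\<bar>x - r\<bar> \<le> 2" "\<bar>x - (- r)\<bar> \<le> 2" using r by auto
      have "?p 2 * (2 * \<eta>\<^sup>2) \<le> ?p 2 * ((V x - \<eta>)\<^sup>2 + (V x - (- \<eta>))\<^sup>2)"
        by (intro mult_left_mono) (simp_all add: power2_eq_square algebra_simps)
      also have "\<dots> \<le> ?p (x - r) * (V x - \<eta>)\<^sup>2 + ?p (x - (- r)) * (V x - (- \<eta>))\<^sup>2"
        unfolding distrib_left using x by (intro add_mono mult_right_mono dens) simp_all
      finally show ?thesis using True
        by (simp add: ennreal_mult[symmetric] ennreal_plus[symmetric] del: ennreal_plus)
    qed simp
  qed
  also have "\<dots> = (\<integral>\<^sup>+x. ennreal (?p (x - r)) * ennreal ((V x - \<eta>)\<^sup>2) \<partial>lborel) +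
      (\<integral>\<^sup>+x. ennreal (?p (x - (- r))) * ennreal ((V x - (- \<eta>))\<^sup>2) \<partial>lborel)"
    by (rule nn_integral_add) simp_all
  also have "\<dots> = (\<integral>\<^sup>+z. ennreal ((V (z + r) - \<eta>)\<^sup>2) \<partial>std_normal_distribution) +
    (\<integral>\<^sup>+z. ennreal ((V (z - r) + \<eta>)\<^sup>2) \<partial>std_normal_distribution)"
    unfolding shift[symmetric] by simp
  finally show ?thesis .
qed

text \<open>The observation as a function of the noise data alone, with mean function
  \<open>g\<close> in place of \<open>conv a f\<close>, so that equality of noise laws can be
  applied to it.\<close>

definition shifted_data :: "(('d::finite \<Rightarrow> real) \<Rightarrow> real) \<Rightarrow> real \<Rightarrow> 'd data \<Rightarrow> 'd data" where
  "shifted_data g \<epsilon> y = (\<lambda>h\<in>L2 cube_leb. L2_inner cube_leb h g + \<epsilon> * y h)"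

lemma (in noise) shifted_data_measurable [measurable]: "shifted_data g \<epsilon> \<in> measurable data_space data_space"
proof -
  have "(\<lambda>y. L2_inner cube_leb h g + \<epsilon> * y h) \<in> borel_measurable data_space" if "h \<in> L2 cube_leb" for h
    using component_measurable[OF that]
    by (intro borel_measurable_add borel_measurable_times borel_measurable_const)
  then have "(\<lambda>y. \<lambda>h\<in>L2 cube_leb. L2_inner cube_leb h g + \<epsilon> * y h) \<in> measurable data_space (\<Pi>\<^sub>M h\<in>L2 cube_leb. borel)"
    by (rule measurable_restrict)
  then show ?thesis by (simp add: shifted_data_def[abs_def] data_space_def)
qed

text \<open>For fixed \<open>y\<close> the two hypotheses translate a standard normal variable by
  \<tau>/\<epsilon> and by -\<tau>/\<epsilon>; the bound on the line is then integrated over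
  \<open>y\<close>.\<close>

lemma (in noise) two_point_bound:
  fixes G :: "'d data \<Rightarrow> real"
  assumes G[measurable]: "G \<in> borel_measurable data_space"
    and u: "u \<in> L2 cube_leb" "L2_norm cube_leb u = 1" and g: "g \<in> L2 cube_leb"
    and \<epsilon>: "\<epsilon> > 0" and \<tau>: "\<bar>\<tau>\<bar> \<le> \<epsilon>"
  shows "ennreal (4 * std_normal_density 2 * \<eta>\<^sup>2) \<le>
    (\<integral>\<^sup>+\<omega>. ennreal ((G (shifted_data (\<lambda>x. g x + \<tau> * u x) \<epsilon> (noise_data \<omega>)) - \<eta>)\<^sup>2) \<partial>M) +
    (\<integral>\<^sup>+\<omega>. ennreal ((G (shifted_data (\<lambda>x. g x - \<tau> * u x) \<epsilon> (noise_data \<omega>)) + \<eta>)\<^sup>2) \<partial>M)"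
proof -
  interpret P: pair_sigma_finite noise_law std_normal_distribution ..
  have Rm[measurable]: "case_prod (replace_direction u) \<in> measurable (noise_law \<Otimes>\<^sub>M std_normal_distribution) data_space"
    using replace_direction_measurable[OF u(1)] by (simp cong: measurable_cong_sets sets_pair_measure_cong)
  \<comment> \<open>An expectation over the noise becomes an iterated integral whose inner variable
    is the standard normal \<open>z\<close>.\<close>
  have red: "(\<integral>\<^sup>+\<omega>. ennreal (F (noise_data \<omega>)) \<partial>M) =
      (\<integral>\<^sup>+y. (\<integral>\<^sup>+z. ennreal (F (replace_direction u y z)) \<partial>std_normal_distribution) \<partial>noise_law)"
    if [measurable]: "F \<in> borel_measurable data_space" for F :: "'d data \<Rightarrow> real"
  proof -
    have "(\<integral>\<^sup>+\<omega>. ennreal (F (noise_data \<omega>)) \<partial>M) = (\<integral>\<^sup>+y. ennreal (F y) \<partial>noise_law)"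
      unfolding noise_law_def by (rule nn_integral_distr[symmetric]) measurable
    also have "\<dots> = (\<integral>\<^sup>+y. ennreal (F y) \<partial>distr (noise_law \<Otimes>\<^sub>M std_normal_distribution) data_space (case_prod (replace_direction u)))"
      by (simp only: noise_law_replace[OF u])
    also have "\<dots> = (\<integral>\<^sup>+p. ennreal (F (case_prod (replace_direction u) p)) \<partial>(noise_law \<Otimes>\<^sub>M std_normal_distribution))"
      by (rule nn_integral_distr) measurable
    also have "\<dots> = (\<integral>\<^sup>+y. (\<integral>\<^sup>+z. ennreal (F (replace_direction u y z)) \<partial>std_normal_distribution) \<partial>noise_law)"
      by (subst std_normal.nn_integral_fst[symmetric]) simp_all
    finally show ?thesis .
  qed
  define r where "r = \<tau> / \<epsilon>"
  have r: "\<bar>r\<bar> \<le> 1" using \<epsilon> \<tau> by (simp add: r_def)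
  have \<tau>r: "\<tau> = \<epsilon> * r" using \<epsilon> by (simp add: r_def)
  \<comment> \<open>A mean shift s u at noise level \<epsilon> is the translation of
    \<open>z\<close> by s/\<epsilon>, so both hypotheses share the function \<open>V y\<close>
    defined below.\<close>
  have sh: "shifted_data (\<lambda>x. g x + s * u x) \<epsilon> (replace_direction u y z) =
      shifted_data g \<epsilon> (replace_direction u y (z + s / \<epsilon>))" for y z s
  proof -
    have "L2_inner cube_leb h (\<lambda>x. g x + s * u x) = L2_inner cube_leb h g + s * L2_inner cube_leb h u"
      if "h \<in> L2 cube_leb" for h
      by (simp add: L2_inner_commute[of _ h] L2_inner_add_left g L2_cmult u that L2_inner_cmult_left)
    then show ?thesis using \<epsilon>
      by (simp add: shifted_data_def replace_direction_def fun_eq_iff restrict_def field_simps)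
  qed
  define V where "V y z = G (shifted_data g \<epsilon> (replace_direction u y z))" for y z
  have V: "V y \<in> borel_measurable borel" if y: "y \<in> space data_space" for y
  proof -
    have "(\<lambda>z. case_prod (replace_direction u) (y, z)) \<in> measurable borel data_space"
      by (rule measurable_compose[OF measurable_Pair1' replace_direction_measurable]) (use y u in simp_all)
    then have [measurable]: "replace_direction u y \<in> measurable borel data_space" by simp
    show ?thesis unfolding V_def by measurable
  qed
  have 1: "(\<integral>\<^sup>+\<omega>. ennreal ((G (shifted_data (\<lambda>x. g x + \<tau> * u x) \<epsilon> (noise_data \<omega>)) - \<eta>)\<^sup>2) \<partial>M) =
      (\<integral>\<^sup>+y. (\<integral>\<^sup>+z. ennreal ((V y (z + r) - \<eta>)\<^sup>2) \<partial>std_normal_distribution) \<partial>noise_law)"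
    by (subst red[of "\<lambda>y. (G (shifted_data (\<lambda>x. g x + \<tau> * u x) \<epsilon> y) - \<eta>)\<^sup>2"]) (simp_all add: sh V_def r_def)
  have 2: "(\<integral>\<^sup>+\<omega>. ennreal ((G (shifted_data (\<lambda>x. g x - \<tau> * u x) \<epsilon> (noise_data \<omega>)) + \<eta>)\<^sup>2) \<partial>M) =
      (\<integral>\<^sup>+y. (\<integral>\<^sup>+z. ennreal ((V y (z - r) + \<eta>)\<^sup>2) \<partial>std_normal_distribution) \<partial>noise_law)"
    using sh[of "- \<tau>"]
    by (subst red[of "\<lambda>y. (G (shifted_data (\<lambda>x. g x - \<tau> * u x) \<epsilon> y) + \<eta>)\<^sup>2"]) (simp_all add: V_def r_def)
  have Vp[measurable]: "case_prod V \<in> borel_measurable (noise_law \<Otimes>\<^sub>M std_normal_distribution)"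
    unfolding V_def case_prod_beta' using Rm by (simp add: case_prod_beta') measurable
  have "ennreal (4 * std_normal_density 2 * \<eta>\<^sup>2) = (\<integral>\<^sup>+y. ennreal (4 * std_normal_density 2 * \<eta>\<^sup>2) \<partial>noise_law)"
    by (simp add: law.emeasure_space_1[simplified])
  also have "\<dots> \<le> (\<integral>\<^sup>+y. (\<integral>\<^sup>+z. ennreal ((V y (z + r) - \<eta>)\<^sup>2) \<partial>std_normal_distribution)
     + (\<integral>\<^sup>+z. ennreal ((V y (z - r) + \<eta>)\<^sup>2) \<partial>std_normal_distribution) \<partial>noise_law)"
    by (intro nn_integral_mono two_point_normal V r) simp
  also have "\<dots> = (\<integral>\<^sup>+y. (\<integral>\<^sup>+z. ennreal ((V y (z + r) - \<eta>)\<^sup>2) \<partial>std_normal_distribution) \<partial>noise_law)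
     + (\<integral>\<^sup>+y. (\<integral>\<^sup>+z. ennreal ((V y (z - r) + \<eta>)\<^sup>2) \<partial>std_normal_distribution) \<partial>noise_law)"
  proof (rule nn_integral_add)
    have [measurable]: "(\<lambda>p. V (fst p) (snd p + q)) \<in> borel_measurable (noise_law \<Otimes>\<^sub>M std_normal_distribution)" for q
    proof -
      have "(\<lambda>p. (fst p, snd p + q)) \<in> measurable (noise_law \<Otimes>\<^sub>M std_normal_distribution) (noise_law \<Otimes>\<^sub>M std_normal_distribution)"
        by measurable
      from measurable_compose[OF this Vp] show ?thesis by simp
    qed
    show "(\<lambda>y. \<integral>\<^sup>+z. ennreal ((V y (z + r) - \<eta>)\<^sup>2) \<partial>std_normal_distribution) \<in> borel_measurable noise_law"
      by (rule std_normal.borel_measurable_nn_integral) (simp add: case_prod_beta')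
    show "(\<lambda>y. \<integral>\<^sup>+z. ennreal ((V y (z - r) + \<eta>)\<^sup>2) \<partial>std_normal_distribution) \<in> borel_measurable noise_law"
      using \<open>\<And>q. (\<lambda>p. V (fst p) (snd p + q)) \<in> borel_measurable (noise_law \<Otimes>\<^sub>M std_normal_distribution)\<close>[of "- r"]
      by (intro std_normal.borel_measurable_nn_integral) (simp add: case_prod_beta')
  qed
  finally show ?thesis unfolding 1 2 .
qed

section \<open>The lower bound\<close>

text \<open>A set \<open>S\<close> of frequencies encodes a vertex of the sign cube. The amplitudes
  may depend on the frequency because convolution multiplies them by different factors.\<close>

definition sign_poly :: "'d \<Rightarrow> nat set \<Rightarrow> (nat \<Rightarrow> real) \<Rightarrow> nat set \<Rightarrow> ('d::finite \<Rightarrow> real) \<Rightarrow> real" where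
  "sign_poly k J c S x = (\<Sum>j\<in>J. (if j \<in> S then c j else - c j) * cos_basis j (x k))"

lemma coord_basis_L2: "(\<lambda>x. cos_basis j (x k)) \<in> L2 cube_leb"
  by (rule L2_cube_coord) simp

lemma coord_basis_norm: "L2_norm cube_leb (\<lambda>x. cos_basis j (x k)) = 1"
proof -
  have "(L2_norm unit_leb (cos_basis j))\<^sup>2 = 1"
    by (simp add: cos_basis_orthonormal flip: L2_inner_self)
  then show ?thesis by (simp add: L2_norm_cube_coord power2_eq_1_iff) (smt (verit) L2_norm_nonneg)
qed

lemma sign_poly_L2: "sign_poly k J c S \<in> L2 cube_leb"
  unfolding sign_poly_def[abs_def] by (intro L2_sum L2_cmult coord_basis_L2)

text \<open>Neighbouring vertices have a common centre and differ in the sign of one term, the form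
  required by \<open>two_point_bound\<close>.\<close>

lemma sign_poly_insert:
  assumes "finite J" "j \<in> J" "j \<notin> S"
  shows "sign_poly k J c (insert j S) = (\<lambda>x. sign_poly k (J - {j}) c S x + c j * cos_basis j (x k))"
    and "sign_poly k J c S = (\<lambda>x. sign_poly k (J - {j}) c S x - c j * cos_basis j (x k))"
proof -
  have *: "(\<Sum>i\<in>J - {j}. (if i = j \<or> i \<in> S then c i else - c i) * cos_basis i (x k)) =
      (\<Sum>i\<in>J - {j}. (if i \<in> S then c i else - c i) * cos_basis i (x k))" for x :: "'a \<Rightarrow> real"
    by (intro sum.cong) auto
  show "sign_poly k J c (insert j S) = (\<lambda>x. sign_poly k (J - {j}) c S x + c j * cos_basis j (x k))"
    and "sign_poly k J c S = (\<lambda>x. sign_poly k (J - {j}) c S x - c j * cos_basis j (x k))"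
    using assms by (auto simp: sign_poly_def fun_eq_iff sum.remove[OF assms(1,2)] *)
qed

text \<open>Estimators come with measurable distances to fixed functions; polarisation turns these
  into inner products.\<close>

lemma estimator_coefficient_measurable:
  fixes T :: "'d::finite data \<Rightarrow> ('d \<Rightarrow> real) \<Rightarrow> real"
  assumes T: "T \<in> estimators" and e: "e \<in> L2 cube_leb"
  shows "(\<lambda>y. L2_inner cube_leb (T y) e) \<in> borel_measurable data_space"
proof -
  have m[measurable]: "(\<lambda>y. L2_norm cube_leb (\<lambda>x. T y x - g x)) \<in> borel_measurable data_space" if "g \<in> L2 cube_leb" for g
    using T that by (simp add: estimators_def)
  have "(\<lambda>y. ((L2_norm cube_leb (\<lambda>x. T y x - 0))\<^sup>2 + (L2_norm cube_leb e)\<^sup>2 - (L2_norm cube_leb (\<lambda>x. T y x - e x))\<^sup>2) / 2)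
      \<in> borel_measurable data_space"
    using m[OF e] m[OF L2_zero] by measurable
  moreover have eq: "L2_inner cube_leb (T y) e =
      ((L2_norm cube_leb (\<lambda>x. T y x - 0))\<^sup>2 + (L2_norm cube_leb e)\<^sup>2 - (L2_norm cube_leb (\<lambda>x. T y x - e x))\<^sup>2) / 2"
    if "y \<in> space data_space" for y
    using L2_norm_power2_diff[of "T y" cube_leb e] T that e by (simp add: estimators_def)
  ultimately show ?thesis by (subst measurable_cong[OF eq])
qed

text \<open>By Bessel's inequality the loss dominates the sum of the squared coefficient errors. For
  each j the sign patterns are grouped into pairs differing at j, every pair costs at least the
  two-point bound, and the average risk over all patterns is at most \<open>X\<close>.\<close>

lemma (in noise) assouad:
  fixes a :: "('d \<Rightarrow> real) \<Rightarrow> real"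
  assumes a: "integrable cube_leb a" and m: "marginal k a \<in> L2 unit_leb"
    and ser: "L2_sums unit_leb (\<lambda>j t. b j * cos_basis j t) (marginal k a)"
    and J: "finite J" "\<And>j. j \<in> J \<Longrightarrow> j \<ge> 1"
    and n: "n \<ge> 1" and small: "\<And>j. j \<in> J \<Longrightarrow> \<bar>\<eta> * (b j / sqrt 2)\<bar> \<le> real n powr (- 1 / 2)"
    and T: "T \<in> estimators"
    and X: "\<And>S. S \<subseteq> J \<Longrightarrow> risk a M W n T (sign_poly k J (\<lambda>_. \<eta>) S) \<le> X"
  shows "ennreal (real (card J) * (2 * std_normal_density 2 * \<eta>\<^sup>2)) \<le> X"
proof -
  define e where "e j = (\<lambda>x::'d \<Rightarrow> real. cos_basis j (x k))" for j
  define c where "c j = \<eta> * (b j / sqrt 2)" for j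
  define \<epsilon> where "\<epsilon> = real n powr (- 1 / 2)"
  define G where "G j y = L2_inner cube_leb (T y) (e j)" for j y
  define D where "D S \<omega> = shifted_data (sign_poly k J c S) \<epsilon> (noise_data \<omega>)" for S \<omega>
  define R where "R S j = (\<integral>\<^sup>+\<omega>. ennreal ((G j (D S \<omega>) - (if j \<in> S then \<eta> else - \<eta>))\<^sup>2) \<partial>M)" for S j
  have \<epsilon>: "\<epsilon> > 0" using n by (simp add: \<epsilon>_def)
  have e: "e j \<in> L2 cube_leb" and e1: "L2_norm cube_leb (e j) = 1" for j
    unfolding e_def by (rule coord_basis_L2, rule coord_basis_norm)
  have eon: "L2_inner cube_leb (e i) (e j) = (if i = j then 1 else 0)" for i j
    unfolding e_def by (simp add: L2_inner_cube_coord cos_basis_orthonormal)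
  have Gm[measurable]: "G j \<in> borel_measurable data_space" for j
    unfolding G_def by (rule estimator_coefficient_measurable[OF T e])
  have Dm[measurable]: "D S \<in> measurable M data_space" for S
    unfolding D_def by measurable
  \<comment> \<open>The mean of the data has amplitudes \<open>c\<close> while the target has
    amplitude \<eta>; the ill-posedness of the problem enters through their ratio.\<close>
  have conv: "conv a (sign_poly k J (\<lambda>_. \<eta>) S) = sign_poly k J c S" for S
    using conv_trig_poly[OF a m ser J(2), where c="\<lambda>j. if j \<in> S then \<eta> else - \<eta>"]
    by (simp add: sign_poly_def[abs_def] fun_eq_iff c_def) (intro allI sum.cong refl, auto simp: c_def)
  have obs: "observation a W n (sign_poly k J (\<lambda>_. \<eta>) S) \<omega> = D S \<omega>" for S \<omega>
    by (auto simp: observation_def conv D_def shifted_data_def noise_data_def \<epsilon>_def restrict_def fun_eq_iff)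
  have bes: "(\<Sum>j\<in>J. (G j y - (if j \<in> S then \<eta> else - \<eta>))\<^sup>2) \<le>
      (L2_norm cube_leb (\<lambda>x. T y x - sign_poly k J (\<lambda>_. \<eta>) S x))\<^sup>2" if y: "y \<in> space data_space" for y S
  proof -
    have Ty: "T y \<in> L2 cube_leb" using T y by (simp add: estimators_def)
    have "L2_inner cube_leb (sign_poly k J (\<lambda>_. \<eta>) S) (e i) = (if i \<in> S then \<eta> else - \<eta>)" if "i \<in> J" for i
    proof -
      have "L2_inner cube_leb (sign_poly k J (\<lambda>_. \<eta>) S) (e i) =
          (\<Sum>j\<in>J. (if j \<in> S then \<eta> else - \<eta>) * L2_inner cube_leb (e j) (e i))"
        unfolding sign_poly_def[abs_def] e_def[symmetric]
        using L2_inner_sum_left[of J "\<lambda>j x. (if j \<in> S then \<eta> else - \<eta>) * e j x" cube_leb "e i"] e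
        by (simp add: L2_cmult L2_inner_cmult_left e_def[symmetric] fun_cong[OF e_def, symmetric])
      also have "\<dots> = (\<Sum>j\<in>J. if j = i then (if j \<in> S then \<eta> else - \<eta>) else 0)"
        by (intro sum.cong refl) (auto simp: eon)
      also have "\<dots> = (if i \<in> S then \<eta> else - \<eta>)"
        using that J(1) by simp
      finally show ?thesis .
    qed
    then have "G i y - (if i \<in> S then \<eta> else - \<eta>) = L2_inner cube_leb (\<lambda>x. T y x - sign_poly k J (\<lambda>_. \<eta>) S x) (e i)"
      if "i \<in> J" for i
      using that by (simp add: G_def L2_inner_diff_left[OF Ty sign_poly_L2 e])
    then have "(\<Sum>j\<in>J. (G j y - (if j \<in> S then \<eta> else - \<eta>))\<^sup>2) =
       (\<Sum>j\<in>J. (L2_inner cube_leb (\<lambda>x. T y x - sign_poly k J (\<lambda>_. \<eta>) S x) (e j))\<^sup>2)"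
      by simp
    also have "\<dots> \<le> (L2_norm cube_leb (\<lambda>x. T y x - sign_poly k J (\<lambda>_. \<eta>) S x))\<^sup>2"
      by (intro bessel L2_diff Ty sign_poly_L2 e J eon)
    finally show ?thesis .
  qed
  have risk_ge: "(\<Sum>j\<in>J. R S j) \<le> risk a M W n T (sign_poly k J (\<lambda>_. \<eta>) S)" for S
  proof -
    have "(\<Sum>j\<in>J. R S j) = (\<integral>\<^sup>+\<omega>. (\<Sum>j\<in>J. ennreal ((G j (D S \<omega>) - (if j \<in> S then \<eta> else - \<eta>))\<^sup>2)) \<partial>M)"
      unfolding R_def by (rule nn_integral_sum[symmetric]) measurable
    also have "\<dots> \<le> risk a M W n T (sign_poly k J (\<lambda>_. \<eta>) S)"
      unfolding risk_def obs
      by (intro nn_integral_mono) (use bes measurable_space[OF Dm] in \<open>simp add: sum_ennreal\<close>)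
    finally show ?thesis .
  qed
  let ?q = "4 * std_normal_density 2 * \<eta>\<^sup>2"
  have pair: "ennreal ?q \<le> R (insert j S) j + R S j" if j: "j \<in> J" "j \<notin> S" for j S
  proof -
    have "\<bar>c j\<bar> \<le> \<epsilon>" using small[OF j(1)] by (simp add: c_def \<epsilon>_def)
    from two_point_bound[OF Gm[of j] e[of j] e1[of j] sign_poly_L2[of k "J - {j}" c S] \<epsilon> this, where \<eta>=\<eta>]
    show ?thesis
      using j by (simp add: R_def D_def sign_poly_insert[OF J(1) j] e_def)
  qed
  have half: "ennreal (2 ^ (card J - 1) * ?q) \<le> (\<Sum>S\<in>Pow J. R S j)" if j: "j \<in> J" for j
  proof -
    \<comment> \<open>Each pair is represented by its member without j, which leaves 2^(card J - 1)
      pairs.\<close>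
    have Pow: "Pow J = Pow (J - {j}) \<union> insert j ` Pow (J - {j})"
      using Pow_insert[of j "J - {j}"] j by (simp add: insert_absorb)
    have "ennreal (2 ^ (card J - 1) * ?q) = (\<Sum>S\<in>Pow (J - {j}). ennreal ?q)"
      using J(1) j by (simp add: card_Pow ennreal_mult' ennreal_of_nat_eq_real_of_nat flip: ennreal_power)
    also have "\<dots> \<le> (\<Sum>S\<in>Pow (J - {j}). R (insert j S) j + R S j)"
      by (intro sum_mono pair j) auto
    also have "\<dots> = (\<Sum>S\<in>insert j ` Pow (J - {j}). R S j) + (\<Sum>S\<in>Pow (J - {j}). R S j)"
    proof -
      have "inj_on (insert j) (Pow (J - {j}))" by (auto simp: inj_on_def)
      then show ?thesis by (simp add: sum.distrib sum.reindex)
    qed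
    also have "\<dots> = (\<Sum>S\<in>Pow J. R S j)"
      unfolding Pow using J(1) by (subst sum.union_disjoint) (auto simp: add.commute)
    finally show ?thesis .
  qed
  \<comment> \<open>There are half as many pairs as patterns, hence the constant 2 in place of 4.
    For empty \<open>J\<close>, where card J - 1 is truncated, both sides are 0.\<close>
  have "ennreal (2 ^ card J) * ennreal (real (card J) * (2 * std_normal_density 2 * \<eta>\<^sup>2)) = (\<Sum>j\<in>J. ennreal (2 ^ (card J - 1) * ?q))"
  proof (cases "card J")
    case (Suc p)
    then show ?thesis
      by (simp add: ennreal_of_nat_eq_real_of_nat ennreal_mult[symmetric] algebra_simps)
  qed (simp add: J(1))
  also have "\<dots> \<le> (\<Sum>j\<in>J. \<Sum>S\<in>Pow J. R S j)"
    by (intro sum_mono half)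
  also have "\<dots> = (\<Sum>S\<in>Pow J. \<Sum>j\<in>J. R S j)" by (rule sum.swap)
  also have "\<dots> \<le> (\<Sum>S\<in>Pow J. X)"
    by (intro sum_mono order_trans[OF risk_ge X]) auto
  also have "\<dots> = ennreal (2 ^ card J) * X"
    using J(1) by (simp add: card_Pow ennreal_of_nat_eq_real_of_nat)
  finally show ?thesis
    by (subst (asm) ennreal_mult_le_mult_iff) auto
qed

lemma sign_poly_in_class:
  fixes w :: "'d::finite \<Rightarrow> nat \<Rightarrow> real"
  assumes J: "finite J" "\<And>j. j \<in> J \<Longrightarrow> j \<ge> 1" and bd: "(\<Sum>j\<in>J. (w k j)\<^sup>2 * \<eta>\<^sup>2) \<le> (L k)\<^sup>2"
  shows "sign_poly k J (\<lambda>_. \<eta>) S \<in> additive_class (\<lambda>k. ellipsoid (w k) (L k))"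
proof -
  define \<theta> where "\<theta> j = (if j \<in> J then if j \<in> S then \<eta> else - \<eta> else 0)" for j
  define p where "p t = (\<Sum>j\<in>J. \<theta> j * cos_basis j t)" for t
  \<comment> \<open>The zero function serves as the component in all coordinates other than
    k.\<close>
  have zero: "(\<lambda>t. 0) \<in> ellipsoid v l" for v l
    unfolding ellipsoid_def by (auto simp: periodic1_def L2_sums_def L2_norm_def intro!: exI[of _ "\<lambda>_. 0"])
  have fin: "finite (Suc -` J)" using J(1) by (simp add: finite_vimageI)
  \<comment> \<open>Series in \<open>ellipsoid\<close> are indexed through \<open>Suc\<close>; since
    all frequencies in \<open>J\<close> are at least 1, none is lost.\<close>
  have img: "Suc ` (Suc -` J) = J"
    using J(2) by (auto simp: image_iff) (metis Suc_le_D One_nat_def)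
  have reind: "(\<Sum>i\<in>Suc -` J. h (Suc i)) = (\<Sum>j\<in>J. h j)" for h :: "nat \<Rightarrow> real"
    using sum.reindex[of Suc "Suc -` J" h] by (simp only: img o_def inj_Suc simp_thms)
  have \<theta>0: "\<theta> (Suc i) = 0" if "i \<notin> Suc -` J" for i using that by (simp add: \<theta>_def)
  have s: "(\<lambda>j. (w k (Suc j))\<^sup>2 * (\<theta> (Suc j))\<^sup>2) sums (\<Sum>j\<in>J. (w k j)\<^sup>2 * \<eta>\<^sup>2)"
  proof -
    have "(\<lambda>j. (w k (Suc j))\<^sup>2 * (\<theta> (Suc j))\<^sup>2) sums (\<Sum>j\<in>Suc -` J. (w k (Suc j))\<^sup>2 * (\<theta> (Suc j))\<^sup>2)"
      by (rule sums_finite[OF fin]) (simp add: \<theta>0)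
    also have "(\<Sum>j\<in>Suc -` J. (w k (Suc j))\<^sup>2 * (\<theta> (Suc j))\<^sup>2) = (\<Sum>j\<in>J. (w k j)\<^sup>2 * (\<theta> j)\<^sup>2)"
      by (rule reind)
    also have "\<dots> = (\<Sum>j\<in>J. (w k j)\<^sup>2 * \<eta>\<^sup>2)" by (intro sum.cong) (auto simp: \<theta>_def)
    finally show ?thesis .
  qed
  have "p \<in> ellipsoid (w k) (L k)"
    unfolding ellipsoid_def
  proof (intro CollectI conjI exI[of _ \<theta>])
    show "p \<in> borel_measurable borel" unfolding p_def by measurable
    show "periodic1 p" using cos_basis_periodic by (simp add: periodic1_def p_def)
    show "p \<in> L2 unit_leb" unfolding p_def by (rule trig_poly_L2)
    show "summable (\<lambda>j. (w k (Suc j))\<^sup>2 * (\<theta> (Suc j))\<^sup>2)"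
      and "(\<Sum>j. (w k (Suc j))\<^sup>2 * (\<theta> (Suc j))\<^sup>2) \<le> (L k)\<^sup>2"
      using s bd by (simp_all add: sums_iff)
    \<comment> \<open>The partial sums equal \<open>p\<close> once they contain all frequencies, so
      the L2 error is eventually 0.\<close>
    have "p t - (\<Sum>j<N. \<theta> (Suc j) * cos_basis (Suc j) t) = 0" if "Suc -` J \<subseteq> {..<N}" for N t
    proof -
      have "(\<Sum>j<N. \<theta> (Suc j) * cos_basis (Suc j) t) = (\<Sum>j\<in>Suc -` J. \<theta> (Suc j) * cos_basis (Suc j) t)"
        using that by (intro sum.mono_neutral_right) (auto simp: \<theta>_def)
      also have "\<dots> = p t" unfolding p_def by (rule reind)
      finally show ?thesis by simp
    qed
    then have "L2_norm unit_leb (\<lambda>t. p t - (\<Sum>j<N. \<theta> (Suc j) * cos_basis (Suc j) t)) = 0" if "Suc -` J \<subseteq> {..<N}" for N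
      using that by (simp add: L2_norm_def)
    moreover obtain N0 where "Suc -` J \<subseteq> {..<N0}"
      using fin by (metis finite_nat_iff_bounded)
    ultimately have "\<forall>N\<ge>N0. L2_norm unit_leb (\<lambda>t. p t - (\<Sum>j<N. \<theta> (Suc j) * cos_basis (Suc j) t)) = 0"
      by (meson lessThan_subset_iff order_trans)
    then show "L2_sums unit_leb (\<lambda>j t. \<theta> (Suc j) * cos_basis (Suc j) t) p"
      unfolding L2_sums_def by (intro tendsto_eventually) (auto simp: eventually_sequentially)
  qed
  moreover have "sign_poly k J (\<lambda>_. \<eta>) S = (\<lambda>x. \<Sum>l\<in>UNIV. (if l = k then p else (\<lambda>t. 0)) (x l))"
  proof
    fix x :: "'d \<Rightarrow> real"
    have "(\<Sum>l\<in>UNIV. (if l = k then p else (\<lambda>t. 0)) (x l)) = (\<Sum>l\<in>UNIV. if l = k then p (x l) else 0)"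
      by (intro sum.cong) auto
    then show "sign_poly k J (\<lambda>_. \<eta>) S x = (\<Sum>l\<in>UNIV. (if l = k then p else (\<lambda>t. 0)) (x l))"
      by (auto simp: sign_poly_def p_def \<theta>_def intro!: sum.cong)
  qed
  ultimately show ?thesis
    unfolding additive_class_def using zero
    by (auto intro!: exI[of _ "\<lambda>l. if l = k then p else (\<lambda>t. 0)"])
qed

lemma (in noise) minimax_lower_bound:
  fixes a :: "('d \<Rightarrow> real) \<Rightarrow> real" and b w :: "'d \<Rightarrow> nat \<Rightarrow> real"
  assumes a: "integrable cube_leb a" and m: "marginal k a \<in> L2 unit_leb"
    and ser: "L2_sums unit_leb (\<lambda>j t. b k j * cos_basis j t) (marginal k a)"
    and q: "q \<ge> 0" and C: "C\<^sub>2 > 0" "C\<^sub>3 > 0"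
    and b: "\<And>j. j \<ge> 1 \<Longrightarrow> C\<^sub>2 * real j powr (- q) \<le> b k j \<and> b k j \<le> C\<^sub>3 * real j powr (- q)"
    and L: "L k > 0" and s: "s > 0" and c: "c\<^sub>1 > 0" "c\<^sub>2 > 0"
    and w: "\<And>j. j \<ge> 1 \<Longrightarrow> c\<^sub>1 * real j powr s \<le> w k j \<and> w k j \<le> c\<^sub>2 * real j powr s"
  shows "\<exists>c>0. \<forall>n\<ge>1. \<forall>T\<in>estimators.
    ennreal c \<le> ennreal (real n powr (2 * s / (2 * s + 2 * q + 1))) *
      (SUP f\<in>additive_class (\<lambda>k. ellipsoid (w k) (L k)). risk a M W n T f)"
proof -
  define p where "p = 2 * s + 2 * q + 1"
  have p: "p > 0" using s q by (simp add: p_def)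
  \<comment> \<open>The first bound keeps the shift of the data below the noise level, the second
    keeps the sign polynomials in the ellipsoid; 2 powr (2 * s) accounts for frequencies up to 2
    N.\<close>
  define c0 where "c0 = min (1 / C\<^sub>3\<^sup>2) ((L k)\<^sup>2 / (c\<^sub>2\<^sup>2 * 2 powr (2 * s)))"
  have c0: "c0 > 0" using C c L by (simp add: c0_def)
  \<comment> \<open>The constant of \<open>assouad\<close>, reduced by 2 powr (- 2 * s) because N
    may be as large as 2 r.\<close>
  define c' where "c' = 2 * std_normal_density 2 * c0 * 2 powr (- 2 * s)"
  have c': "c' > 0" using c0 normal_density_pos[of 1 0 2] by (simp add: c'_def)
  show ?thesis
  proof (intro exI[of _ c'] conjI c' allI impI ballI)
    fix n :: nat and T :: "'d data \<Rightarrow> ('d \<Rightarrow> real) \<Rightarrow> real"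
    assume n: "n \<ge> 1" and T: "T \<in> estimators"
    define r where "r = real n powr (1 / p)"
    have r1: "r \<ge> 1" using n p by (simp add: r_def ge_one_powr_ge_zero)
    \<comment> \<open>As r \<ge> 1, rounding up costs at most a factor 2.\<close>
    define N where "N = nat \<lceil>r\<rceil>"
    have N: "r \<le> real N" "real N \<le> 2 * r" "N \<ge> 1"
      using r1 unfolding N_def by linarith+
    \<comment> \<open>A block of N frequencies, all comparable to N, so that the bounds on
      \<open>b\<close> and \<open>w\<close> are uniform over it.\<close>
    define J where "J = {N<..2 * N}"
    have J: "finite J" "\<And>j. j \<in> J \<Longrightarrow> j \<ge> 1" "card J = N" by (auto simp: J_def)
    have Jb: "real N \<le> real j" "real j \<le> 2 * real N" if "j \<in> J" for j using that by (auto simp: J_def)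
    have N0: "real N > 0" using N(3) by simp
    define \<eta> where "\<eta> = sqrt (c0 * real N powr (- 2 * s - 1))"
    have \<eta>2: "\<eta>\<^sup>2 = c0 * real N powr (- 2 * s - 1)" using c0 by (simp add: \<eta>_def)
    have \<eta>0: "\<eta> \<ge> 0" using c0 by (simp add: \<eta>_def)
    have small: "\<bar>\<eta> * (b k j / sqrt 2)\<bar> \<le> real n powr (- 1 / 2)" if j: "j \<in> J" for j
    proof -
      have b0: "0 \<le> b k j" using b[OF J(2)[OF j]] C by (smt (verit) mult_nonneg_nonneg powr_ge_zero)
      have "b k j \<le> C\<^sub>3 * real N powr (- q)"
        using b[OF J(2)[OF j]] C q powr_mono2'[of "- q" "real N" "real j"] Jb(1)[OF j] N0
        by (smt (verit) mult_left_mono)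
      then have bsq: "(b k j)\<^sup>2 \<le> C\<^sub>3\<^sup>2 * real N powr (- 2 * q)"
        using power_mono[of "b k j" "C\<^sub>3 * real N powr (- q)" 2] b0 N0
        by (simp add: power_mult_distrib powr_power mult.commute)
      have "(\<eta> * (b k j / sqrt 2))\<^sup>2 \<le> \<eta>\<^sup>2 * (C\<^sub>3\<^sup>2 * real N powr (- 2 * q))"
      proof -
        have "(b k j / sqrt 2)\<^sup>2 \<le> (b k j)\<^sup>2" by (simp add: power_divide)
        also note bsq
        finally show ?thesis unfolding power_mult_distrib by (rule mult_left_mono) simp
      qed
      also have "\<dots> = (c0 * C\<^sub>3\<^sup>2) * real N powr (- p)"
      proof -
        have "- p = (- 2 * s - 1) + (- 2 * q)" by (simp add: p_def)
        then have "real N powr (- p) = real N powr (- 2 * s - 1) * real N powr (- 2 * q)"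
          by (simp only: powr_add)
        then show ?thesis by (simp add: \<eta>2)
      qed
      also have "\<dots> \<le> 1 * real N powr (- p)"
      proof (rule mult_right_mono)
        have "c0 \<le> 1 / C\<^sub>3\<^sup>2" by (simp add: c0_def)
        then show "c0 * C\<^sub>3\<^sup>2 \<le> 1" using C by (simp add: field_simps)
      qed simp
      \<comment> \<open>r powr (- p) is 1/n, the squared noise level.\<close>
      also have "\<dots> \<le> r powr (- p)" using N r1 p by (simp add: powr_mono2')
      also have "\<dots> = (real n powr (- 1 / 2))\<^sup>2"
        using p n by (simp add: r_def powr_powr powr_power)
      finally have "\<bar>\<eta> * (b k j / sqrt 2)\<bar> \<le> \<bar>real n powr (- 1 / 2)\<bar>"
        by (simp only: abs_le_square_iff)
      then show ?thesis by simp
    qed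
    have "(\<Sum>j\<in>J. (w k j)\<^sup>2 * \<eta>\<^sup>2) \<le> (\<Sum>j\<in>J. c\<^sub>2\<^sup>2 * (2 * real N) powr (2 * s) * \<eta>\<^sup>2)"
    proof (intro sum_mono mult_right_mono)
      fix j assume j: "j \<in> J"
      have w0: "0 \<le> w k j" using w[OF J(2)[OF j]] c by (smt (verit) mult_nonneg_nonneg powr_ge_zero)
      have "w k j \<le> c\<^sub>2 * (2 * real N) powr s"
        using w[OF J(2)[OF j]] c s powr_mono2[of s "real j" "2 * real N"] Jb(2)[OF j]
        by (smt (verit) mult_left_mono of_nat_0_le_iff)
      then show "(w k j)\<^sup>2 \<le> c\<^sub>2\<^sup>2 * (2 * real N) powr (2 * s)"
        using power_mono[of "w k j" "c\<^sub>2 * (2 * real N) powr s" 2] w0 N0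
        by (simp add: power_mult_distrib powr_power mult.commute)
    qed simp
    also have "\<dots> = (real N powr 1 * real N powr (2 * s) * real N powr (- 2 * s - 1)) * (c0 * (c\<^sub>2\<^sup>2 * 2 powr (2 * s)))"
      using N0 by (simp add: J(3) \<eta>2 powr_mult algebra_simps)
    \<comment> \<open>The number of terms, the weights of order N^(2s) and \<eta>^2 of order
      N^(-2s-1) cancel exactly.\<close>
    also have "real N powr 1 * real N powr (2 * s) * real N powr (- 2 * s - 1) = 1"
      using N0 by (simp only: powr_add[symmetric]) simp
    also have "1 * (c0 * (c\<^sub>2\<^sup>2 * 2 powr (2 * s))) \<le> (L k)\<^sup>2"
    proof -
      have "c0 \<le> (L k)\<^sup>2 / (c\<^sub>2\<^sup>2 * 2 powr (2 * s))" by (simp add: c0_def)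
      then show ?thesis using c by (simp add: pos_le_divide_eq)
    qed
    finally have cls: "(\<Sum>j\<in>J. (w k j)\<^sup>2 * \<eta>\<^sup>2) \<le> (L k)\<^sup>2" .
    define X where "X = (SUP f\<in>additive_class (\<lambda>k. ellipsoid (w k) (L k)). risk a M W n T f)"
    have "ennreal (real (card J) * (2 * std_normal_density 2 * \<eta>\<^sup>2)) \<le> X"
      unfolding X_def
      by (rule assouad[OF a m ser J(1,2) n small T])
         (auto intro!: SUP_upper sign_poly_in_class J cls)
    moreover have "c' \<le> real n powr (2 * s / p) * (real (card J) * (2 * std_normal_density 2 * \<eta>\<^sup>2))"
    proof -
      have "real (card J) * (2 * std_normal_density 2 * \<eta>\<^sup>2) =
          2 * std_normal_density 2 * c0 * (real N powr 1 * real N powr (- 2 * s - 1))"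
        using N0 by (simp add: J(3) \<eta>2)
      also have "real N powr 1 * real N powr (- 2 * s - 1) = real N powr (- 2 * s)"
        by (simp only: powr_add[symmetric]) simp
      finally have e: "real (card J) * (2 * std_normal_density 2 * \<eta>\<^sup>2) = 2 * std_normal_density 2 * c0 * real N powr (- 2 * s)" .
      have "real n powr (2 * s / p) * (2 * r) powr (- 2 * s) = 2 powr (- 2 * s)"
      proof -
        have "(2 * r) powr (- 2 * s) = 2 powr (- 2 * s) * real n powr (- (2 * s / p))"
          by (simp add: powr_mult r_def powr_powr)
        then show ?thesis using n by (simp add: powr_add[symmetric] mult.left_commute)
      qed
      moreover have "(2 * r) powr (- 2 * s) \<le> real N powr (- 2 * s)"
        using N N0 s by (intro powr_mono2') auto
      ultimately have "2 powr (- 2 * s) \<le> real n powr (2 * s / p) * real N powr (- 2 * s)"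
        by (metis mult_left_mono powr_ge_zero)
      then have "(2 * std_normal_density 2 * c0) * 2 powr (- 2 * s) \<le>
          (2 * std_normal_density 2 * c0) * (real n powr (2 * s / p) * real N powr (- 2 * s))"
        using c0 by (intro mult_left_mono) auto
      then show ?thesis unfolding e c'_def by (simp add: mult_ac)
    qed
    ultimately have "ennreal c' \<le> ennreal (real n powr (2 * s / p)) * X"
      using c0 by (smt (verit) ennreal_leI ennreal_mult' mult_left_mono order_trans powr_ge_zero zero_le)
    then show "ennreal c' \<le> ennreal (real n powr (2 * s / (2 * s + 2 * q + 1))) *
      (SUP f\<in>additive_class (\<lambda>k. ellipsoid (w k) (L k)). risk a M W n T f)"
      by (simp add: X_def p_def)
  qed
qed

section \<open>The upper bound\<close>

lemma trig_span_zero: "(\<lambda>x. 0) \<in> (trig_span :: (('d::finite \<Rightarrow> real) \<Rightarrow> real) set)"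
  unfolding trig_span_def by (auto intro!: exI[of _ "\<lambda>_ _. 0"])

lemma trig_span_cmult: "g \<in> trig_span \<Longrightarrow> (\<lambda>x. c * g x) \<in> trig_span"
proof -
  assume "g \<in> trig_span"
  then obtain \<theta> m where "g = (\<lambda>x. \<Sum>k\<in>UNIV. \<Sum>j=1..m. \<theta> k j * cos_basis j (x k))"
    unfolding trig_span_def by blast
  then have "(\<lambda>x. c * g x) = (\<lambda>x. \<Sum>k\<in>UNIV. \<Sum>j=1..m. (c * \<theta> k j) * cos_basis j (x k))"
    by (simp add: sum_distrib_left mult.assoc)
  then show ?thesis unfolding trig_span_def by (intro CollectI exI[of _ "\<lambda>k j. c * \<theta> k j"] exI[of _ m]) simp
qed

lemma trig_span_add: "g \<in> trig_span \<Longrightarrow> h \<in> trig_span \<Longrightarrow> (\<lambda>x. g x + h x) \<in> trig_span"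
proof -
  assume "g \<in> trig_span" "h \<in> trig_span"
  then obtain \<theta> m \<zeta> r where g: "g = (\<lambda>x. \<Sum>k\<in>UNIV. \<Sum>j=1..m. \<theta> k j * cos_basis j (x k))"
    and h: "h = (\<lambda>x. \<Sum>k\<in>UNIV. \<Sum>j=1..r. \<zeta> k j * cos_basis j (x k))"
    unfolding trig_span_def by blast
  \<comment> \<open>Coefficients are padded with zeros up to a common degree.\<close>
  have pad: "(\<Sum>j=1..m. c j * d j) = (\<Sum>j=1..max m r. (if j \<le> m then c j else 0) * d j)"
    for c d :: "nat \<Rightarrow> real" and m r
    by (rule sum.mono_neutral_cong_left) auto
  define \<xi> where "\<xi> k j = (if j \<le> m then \<theta> k j else 0) + (if j \<le> r then \<zeta> k j else 0)" for k j
  have "(\<lambda>x. g x + h x) = (\<lambda>x. \<Sum>k\<in>UNIV. \<Sum>j=1..max m r. \<xi> k j * cos_basis j (x k))"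
    unfolding g h \<xi>_def pad[where m=m and r=r] pad[where m=r and r=m] max.commute[of r m]
    by (simp add: sum.distrib distrib_right)
  then show ?thesis unfolding trig_span_def by (intro CollectI exI[of _ \<xi>] exI[of _ "max m r"]) simp
qed

lemma trig_span_basis:
  assumes "j \<ge> 1"
  shows "(\<lambda>x. cos_basis j (x k)) \<in> trig_span"
proof -
  have inner: "(\<Sum>i=1..j. (if l = k \<and> i = j then 1 else 0) * cos_basis i (x l)) = (if l = k then cos_basis j (x k) else 0)"
    for l and x :: "'a \<Rightarrow> real"
  proof -
    have "(\<Sum>i=1..j. (if l = k \<and> i = j then 1 else 0) * cos_basis i (x l)) =
        (\<Sum>i=1..j. if i = j then (if l = k then cos_basis j (x k) else 0) else 0)"
      by (intro sum.cong) auto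
    then show ?thesis using assms by simp
  qed
  have "(\<lambda>x. cos_basis j (x k)) = (\<lambda>x. \<Sum>l\<in>UNIV. \<Sum>i=1..j. (if l = k \<and> i = j then 1 else 0) * cos_basis i (x l))"
    unfolding inner by simp
  then show ?thesis unfolding trig_span_def
    by (intro CollectI exI[of _ "\<lambda>l i. if l = k \<and> i = j then 1 else 0"] exI[of _ j]) simp
qed

text \<open>Linearity of \<open>Q\<close> is available on \<open>trig_span\<close> only, so
  membership of the partial sums is carried through the induction.\<close>

lemma inverse_adjoint_sum:
  assumes Q: "inverse_adjoint b Q" and A: "finite A" and h: "\<And>i. i \<in> A \<Longrightarrow> h i \<in> trig_span"
  shows "Q (\<lambda>x. \<Sum>i\<in>A. c i * h i x) = (\<lambda>x. \<Sum>i\<in>A. c i * Q (h i) x)"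
    and "(\<lambda>x. \<Sum>i\<in>A. c i * h i x) \<in> trig_span"
proof -
  have add: "\<And>g h. g \<in> trig_span \<Longrightarrow> h \<in> trig_span \<Longrightarrow> Q (\<lambda>x. g x + h x) = (\<lambda>x. Q g x + Q h x)"
    and cm: "\<And>c g. g \<in> trig_span \<Longrightarrow> Q (\<lambda>x. c * g x) = (\<lambda>x. c * Q g x)"
    using Q unfolding inverse_adjoint_def by blast+
  have "Q (\<lambda>x. \<Sum>i\<in>A. c i * h i x) = (\<lambda>x. \<Sum>i\<in>A. c i * Q (h i) x) \<and> (\<lambda>x. \<Sum>i\<in>A. c i * h i x) \<in> trig_span"
    using A h
  proof (induction A rule: finite_induct)
    case empty
    \<comment> \<open>\<open>Q\<close> maps 0 to 0 by homogeneity with the factor 0.\<close>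
    show ?case using cm[OF trig_span_zero, of 0] trig_span_zero by simp
  next
    case (insert i A)
    then show ?case by (simp add: add cm trig_span_add trig_span_cmult)
  qed
  then show "Q (\<lambda>x. \<Sum>i\<in>A. c i * h i x) = (\<lambda>x. \<Sum>i\<in>A. c i * Q (h i) x)"
    and "(\<lambda>x. \<Sum>i\<in>A. c i * h i x) \<in> trig_span" by auto
qed

text \<open>\<open>Q\<close> in one coordinate, on polynomials of degree m. It is written through
  Fourier coefficients, so that it depends on the function and not on a chosen
  representation.\<close>

definition inverse_series :: "(nat \<Rightarrow> real) \<Rightarrow> nat \<Rightarrow> (real \<Rightarrow> real) \<Rightarrow> real \<Rightarrow> real" where
  "inverse_series b m g t =
     (\<Sum>j=1..m. (inverse (b j / sqrt 2) * L2_inner unit_leb g (cos_basis j)) * cos_basis j t)"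

lemma inverse_series_L2: "inverse_series b m g \<in> L2 unit_leb"
  unfolding inverse_series_def[abs_def] by (rule trig_poly_L2)

lemma trig_poly_expansion:
  assumes "g \<in> trig_polys m"
  shows "g t = (\<Sum>j=1..m. L2_inner unit_leb g (cos_basis j) * cos_basis j t)"
proof -
  from assms obtain \<theta> where g: "g = (\<lambda>t. \<Sum>j=1..m. \<theta> j * cos_basis j t)"
    unfolding trig_polys_def by blast
  have "L2_inner unit_leb g (cos_basis i) = \<theta> i" if "i \<in> {1..m}" for i
  proof -
    have "L2_inner unit_leb g (cos_basis i) = (\<Sum>j=1..m. \<theta> j * L2_inner unit_leb (cos_basis j) (cos_basis i))"
      unfolding g by (subst L2_inner_sum_left) (auto simp: L2_cmult L2_inner_cmult_left)
    also have "\<dots> = (\<Sum>j=1..m. if j = i then \<theta> j else 0)"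
      by (intro sum.cong) (auto simp: cos_basis_orthonormal)
    finally show ?thesis using that by simp
  qed
  then show ?thesis unfolding g by (intro sum.cong) auto
qed

lemma trig_polys_L2: "g \<in> trig_polys m \<Longrightarrow> g \<in> L2 unit_leb"
  by (auto simp: trig_polys_def trig_poly_L2)

lemma trig_polys_centered: "g \<in> trig_polys m \<Longrightarrow> (LINT t|unit_leb. g t) = 0"
  by (auto simp: trig_polys_def intro!: trig_poly_centered)

lemma inverse_adjoint_additive:
  fixes g :: "'d::finite \<Rightarrow> real \<Rightarrow> real"
  assumes Q: "inverse_adjoint b Q" and g: "\<And>k. g k \<in> trig_polys (m k)"
  shows "Q (\<lambda>x. \<Sum>k\<in>UNIV. g k (x k)) = (\<lambda>x. \<Sum>k\<in>UNIV. inverse_series (b k) (m k) (g k) (x k))"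
proof -
  \<comment> \<open>The degrees differ between coordinates; the pairs (k, j) turn the double sum
    into one finite sum to which \<open>inverse_adjoint_sum\<close> applies.\<close>
  define A where "A = (SIGMA k:UNIV. {1..m k})"
  define c where "c p = L2_inner unit_leb (g (fst p)) (cos_basis (snd p))" for p
  have "(\<lambda>x. \<Sum>k\<in>UNIV. g k (x k)) = (\<lambda>x. \<Sum>p\<in>A. c p * cos_basis (snd p) (x (fst p)))"
    unfolding A_def c_def
    by (subst trig_poly_expansion[OF g], subst sum.Sigma) (auto simp: case_prod_beta')
  then have "Q (\<lambda>x. \<Sum>k\<in>UNIV. g k (x k)) = (\<lambda>x. \<Sum>p\<in>A. c p * Q (\<lambda>x. cos_basis (snd p) (x (fst p))) x)"
    by (simp only:) (rule inverse_adjoint_sum[OF Q], auto simp: A_def intro!: trig_span_basis)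
  also have "\<dots> = (\<lambda>x. \<Sum>p\<in>A. c p * (inverse (b (fst p) (snd p) / sqrt 2) * cos_basis (snd p) (x (fst p))))"
  proof -
    have "Q (\<lambda>x. cos_basis (snd p) (x (fst p))) = (\<lambda>x. inverse (b (fst p) (snd p) / sqrt 2) * cos_basis (snd p) (x (fst p)))"
      if "p \<in> A" for p
      using Q that unfolding inverse_adjoint_def A_def by auto
    then show ?thesis by (intro ext sum.cong) auto
  qed
  also have "\<dots> = (\<lambda>x. \<Sum>k\<in>UNIV. inverse_series (b k) (m k) (g k) (x k))"
    unfolding inverse_series_def A_def c_def
    by (subst sum.Sigma) (auto simp: case_prod_beta' mult_ac fun_eq_iff intro!: sum.cong)
  finally show ?thesis .
qed

text \<open>The identity <Q g, A f> = <g, f>: at each frequency the multiplier of the convolution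
  cancels its inverse. Integrability belongs to the claim because it is used to split the inner
  product over coordinates.\<close>

lemma inverse_series_inner_conv:
  fixes a :: "('d::finite \<Rightarrow> real) \<Rightarrow> real" and f :: "'d \<Rightarrow> real \<Rightarrow> real"
  assumes a: "integrable cube_leb a" and mar: "marginal k a \<in> L2 unit_leb"
    and ser: "L2_sums unit_leb (\<lambda>j t. b j * cos_basis j t) (marginal k a)"
    and b: "\<And>j. j \<ge> 1 \<Longrightarrow> b j > 0"
    and f: "\<And>l. centered_cosine (f l)" and g: "g \<in> trig_polys m"
  shows "integrable cube_leb (\<lambda>x. inverse_series b m g (x k) * conv a (\<lambda>x. \<Sum>l\<in>UNIV. f l (x l)) x)"
    and "L2_inner cube_leb (\<lambda>x. inverse_series b m g (x k)) (conv a (\<lambda>x. \<Sum>l\<in>UNIV. f l (x l))) =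
      L2_inner unit_leb g (f k)"
proof -
  let ?h = "conv a (\<lambda>x. \<Sum>l\<in>UNIV. f l (x l))"
  let ?c = "\<lambda>j. inverse (b j / sqrt 2) * L2_inner unit_leb g (cos_basis j)"
  note cc = conv_coefficient[OF a mar ser _ f]
  have e: "inverse_series b m g (x k) * ?h x = (\<Sum>j=1..m. ?c j * (cos_basis j (x k) * ?h x))" for x
    by (simp add: inverse_series_def sum_distrib_right mult.assoc)
  have i: "integrable cube_leb (\<lambda>x. ?c j * (cos_basis j (x k) * ?h x))" if "j \<in> {1..m}" for j
    using that by (intro integrable_mult_right cc(1)) auto
  show "integrable cube_leb (\<lambda>x. inverse_series b m g (x k) * ?h x)"
    unfolding e using i by (rule Bochner_Integration.integrable_sum)
  have f2: "f k \<in> L2 unit_leb" using f by (simp add: centered_cosine_def)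
  have "L2_inner cube_leb (\<lambda>x. inverse_series b m g (x k)) ?h = (\<Sum>j=1..m. LINT x|cube_leb. ?c j * (cos_basis j (x k) * ?h x))"
    unfolding L2_inner_def[of cube_leb] e using i by (rule Bochner_Integration.integral_sum)
  also have "\<dots> = (\<Sum>j=1..m. L2_inner unit_leb g (cos_basis j) * L2_inner unit_leb (f k) (cos_basis j))"
  proof (intro sum.cong refl)
    fix j assume j: "j \<in> {1..m}"
    then have "b j > 0" using b by simp
    have "(LINT x|cube_leb. ?c j * (cos_basis j (x k) * ?h x)) = ?c j * L2_inner cube_leb (\<lambda>x. cos_basis j (x k)) ?h"
      unfolding L2_inner_def[of cube_leb] by (rule integral_mult_right_zero)
    also have "\<dots> = ?c j * (b j / sqrt 2 * L2_inner unit_leb (f k) (cos_basis j))"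
      using cc(2)[of j] j by simp
    finally show "(LINT x|cube_leb. ?c j * (cos_basis j (x k) * ?h x)) =
        L2_inner unit_leb g (cos_basis j) * L2_inner unit_leb (f k) (cos_basis j)"
      using \<open>b j > 0\<close> by simp
  qed
  also have "\<dots> = L2_inner unit_leb (\<lambda>t. \<Sum>j=1..m. L2_inner unit_leb g (cos_basis j) * cos_basis j t) (f k)"
    by (subst L2_inner_sum_left[OF _ f2])
       (simp_all add: L2_cmult L2_inner_cmult_left L2_inner_commute[of _ "f k"])
  also have "(\<lambda>t. \<Sum>j=1..m. L2_inner unit_leb g (cos_basis j) * cos_basis j t) = g"
    using trig_poly_expansion[OF g] by auto
  finally show "L2_inner cube_leb (\<lambda>x. inverse_series b m g (x k)) ?h = L2_inner unit_leb g (f k)" .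
qed

text \<open>Parseval's identity for the polynomial on the left, Bessel's inequality for g - h, and
  \<rho> as a bound for all multipliers.\<close>

lemma inverse_series_norm_diff:
  assumes g: "g \<in> L2 unit_leb" "h \<in> L2 unit_leb"
    and \<rho>: "\<And>j. 1 \<le> j \<Longrightarrow> j \<le> m \<Longrightarrow> \<bar>inverse (b j / sqrt 2)\<bar> \<le> \<rho>"
  shows "(L2_norm unit_leb (\<lambda>t. inverse_series b m g t - inverse_series b m h t))\<^sup>2 \<le>
    \<rho>\<^sup>2 * (L2_norm unit_leb (\<lambda>t. g t - h t))\<^sup>2"
proof -
  let ?d = "\<lambda>t. g t - h t"
  have "(\<lambda>t. inverse_series b m g t - inverse_series b m h t) =
      (\<lambda>t. \<Sum>j=1..m. (inverse (b j / sqrt 2) * L2_inner unit_leb ?d (cos_basis j)) * cos_basis j t)"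
    by (simp add: inverse_series_def L2_inner_diff_left g sum_subtractf algebra_simps)
  then have "(L2_norm unit_leb (\<lambda>t. inverse_series b m g t - inverse_series b m h t))\<^sup>2 =
      (\<Sum>j=1..m. (inverse (b j / sqrt 2))\<^sup>2 * (L2_inner unit_leb ?d (cos_basis j))\<^sup>2)"
    by (simp only: trig_poly_norm[OF finite_atLeastAtMost] power_mult_distrib)
  also have "\<dots> \<le> (\<Sum>j=1..m. \<rho>\<^sup>2 * (L2_inner unit_leb ?d (cos_basis j))\<^sup>2)"
  proof (intro sum_mono mult_right_mono)
    fix j assume "j \<in> {1..m}"
    then have "\<bar>inverse (b j / sqrt 2)\<bar>\<^sup>2 \<le> \<rho>\<^sup>2"
      by (intro power_mono \<rho>) auto
    then show "(inverse (b j / sqrt 2))\<^sup>2 \<le> \<rho>\<^sup>2"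
      by (simp only: power2_abs)
  qed simp
  also have "\<dots> \<le> \<rho>\<^sup>2 * (L2_norm unit_leb ?d)\<^sup>2"
    unfolding sum_distrib_left[symmetric]
    by (intro mult_left_mono bessel L2_diff g) (simp_all add: cos_basis_orthonormal)
  finally show ?thesis .
qed

section \<open>The maximal inequality over the net and the risk of the minimiser\<close>

text \<open>\<open>D\<close> is the squared loss, \<open>r\<close> the distance to the comparison
  point and \<open>V\<close> the noise increment, whose variance scales with r^2. The noise costs at
  most (D + \<delta>^2)/2 plus a remainder; moving D/2 to the left doubles the rest, whence 3 and
  32.\<close>

lemma peeling_bound:
  fixes D r V v \<epsilon> \<rho> \<delta> Lb :: real
  assumes D: "D \<le> \<delta>\<^sup>2 + 2 * \<epsilon> * V" and r: "r\<^sup>2 \<le> 2 * D + 2 * \<delta>\<^sup>2"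
    and V: "V\<^sup>2 \<le> 4 * v * Lb" and v: "v \<le> \<rho>\<^sup>2 * r\<^sup>2" and Lb: "Lb \<ge> 0"
  shows "D \<le> 3 * \<delta>\<^sup>2 + 32 * \<epsilon>\<^sup>2 * \<rho>\<^sup>2 * Lb"
proof -
  have V2: "V\<^sup>2 \<le> 4 * (\<rho>\<^sup>2 * r\<^sup>2) * Lb"
    using V mult_right_mono[OF v Lb] by simp
  have "2 * \<epsilon> * V \<le> r\<^sup>2 / 4 + 16 * \<epsilon>\<^sup>2 * \<rho>\<^sup>2 * Lb"
  proof (cases "r = 0")
    case True
    then show ?thesis using V2 Lb by simp
  next
    case False
    \<comment> \<open>The weights of this arithmetic-geometric inequality are chosen to leave r^2/4,
      which is at most (D + \<delta>^2)/2.\<close>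
    have "0 \<le> (r / 2 - 2 * \<epsilon> * V / r)\<^sup>2" by simp
    then have "2 * \<epsilon> * V \<le> r\<^sup>2 / 4 + 4 * \<epsilon>\<^sup>2 * (V\<^sup>2 / r\<^sup>2)"
      using False by (simp add: power2_diff power_divide power_mult_distrib)
    also have "4 * \<epsilon>\<^sup>2 * (V\<^sup>2 / r\<^sup>2) \<le> 4 * \<epsilon>\<^sup>2 * (4 * \<rho>\<^sup>2 * Lb)"
      using V2 False by (intro mult_left_mono) (simp_all add: pos_divide_le_eq mult_ac)
    finally show ?thesis by (simp add: mult_ac)
  qed
  then show ?thesis using D r by linarith
qed

text \<open>All randomness is collected in one variable \<open>B k\<close> per coordinate, with
  expectation at most 2; off a null set the remaining argument is deterministic.\<close>

lemma (in noise) net_risk_bound: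
  fixes a :: "('d \<Rightarrow> real) \<Rightarrow> real" and f :: "'d \<Rightarrow> real \<Rightarrow> real"
  assumes a: "integrable cube_leb a" and mar: "\<And>k. marginal k a \<in> L2 unit_leb"
    and ser: "\<And>k. L2_sums unit_leb (\<lambda>j t. b k j * cos_basis j t) (marginal k a)"
    and b: "\<And>k j. j \<ge> 1 \<Longrightarrow> b k j > 0"
    and Q: "inverse_adjoint b Q"
    and N: "\<And>k. finite (N k)" "\<And>k. N k \<subseteq> trig_polys (m k)"
    and f: "\<And>k. centered_cosine (f k)"
    and g0: "\<And>k. g0 k \<in> N k" "\<And>k. L2_norm unit_leb (\<lambda>t. f k t - g0 k t) \<le> \<delta> k"
    and \<rho>: "\<And>k j. 1 \<le> j \<Longrightarrow> j \<le> m k \<Longrightarrow> inverse (b k j / sqrt 2) \<le> \<rho> k"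
    and T: "net_estimator Q (additive_class N) T"
  shows "risk a M W n T (\<lambda>x. \<Sum>k\<in>UNIV. f k (x k)) \<le>
    ennreal (\<Sum>k\<in>UNIV. 3 * (\<delta> k)\<^sup>2 + 32 * (real n powr (- 1 / 2))\<^sup>2 * (\<rho> k)\<^sup>2 * (ln (real (card (N k))) + 2))"
proof -
  define \<epsilon> where "\<epsilon> = real n powr (- 1 / 2)"
  define F where "F = (\<lambda>x::'d \<Rightarrow> real. \<Sum>k\<in>UNIV. f k (x k))"
  define S where "S k g = (\<lambda>x::'d \<Rightarrow> real. inverse_series (b k) (m k) g (x k))" for k g
  define D where "D k g = (\<lambda>x. S k g x - S k (g0 k) x)" for k g
  define v where "v k g = (L2_norm cube_leb (D k g))\<^sup>2" for k g
  define c where "c k = real (card (N k))" for k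
  \<comment> \<open>The average over the net of exponentials of normalised squared increments. Its
    expectation is at most 2 whatever the size of the net; the size reappears as
    \<open>ln (c k)\<close> when one term is bounded by the average.\<close>
  define B where "B k \<omega> = (\<Sum>g\<in>N k. exp ((W (D k g) \<omega>)\<^sup>2 / (4 * v k g))) / c k" for k \<omega>
  have S2: "S k g \<in> L2 cube_leb" for k g unfolding S_def by (intro L2_cube_coord inverse_series_L2)
  have D2: "D k g \<in> L2 cube_leb" for k g unfolding D_def by (intro L2_diff S2)
  have f2: "f k \<in> L2 unit_leb" and fz: "(LINT t|unit_leb. f k t) = 0" for k
    using f[of k] by (simp_all add: centered_cosine_def)
  have N2: "g \<in> L2 unit_leb" and Nz: "(LINT t|unit_leb. g t) = 0" if "g \<in> N k" for g k
    using that N(2)[of k] trig_polys_L2 trig_polys_centered by blast+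
  have cpos: "c k \<ge> 1" for k
    using g0(1)[of k] N(1)[of k] by (simp add: c_def Suc_le_eq card_gt_0_iff) blast
  have B0: "0 \<le> B k \<omega>" for k \<omega> using cpos[of k] by (auto simp: B_def intro!: divide_nonneg_nonneg sum_nonneg)
  note [measurable] = noise_measurable[OF D2]
  have Bm[measurable]: "B k \<in> borel_measurable M" for k unfolding B_def by measurable
  have EB: "(\<integral>\<^sup>+\<omega>. ennreal (B k \<omega>) \<partial>M) \<le> 2" for k
  proof -
    have "(\<integral>\<^sup>+\<omega>. ennreal (B k \<omega>) \<partial>M) = (\<integral>\<^sup>+\<omega>. (\<Sum>g\<in>N k. ennreal (1 / c k) * ennreal (exp ((W (D k g) \<omega>)\<^sup>2 / (4 * v k g)))) \<partial>M)"
      using cpos[of k]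
      by (intro nn_integral_cong) (simp add: B_def ennreal_mult[symmetric] sum_ennreal sum_divide_distrib)
    also have "\<dots> = (\<Sum>g\<in>N k. ennreal (1 / c k) * (\<integral>\<^sup>+\<omega>. ennreal (exp ((W (D k g) \<omega>)\<^sup>2 / (4 * v k g))) \<partial>M))"
      by (subst nn_integral_sum) (simp_all add: nn_integral_cmult)
    also have "\<dots> \<le> (\<Sum>g\<in>N k. ennreal (1 / c k) * 2)"
    proof (intro sum_mono mult_left_mono)
      fix g
      have "(\<integral>\<^sup>+\<omega>. ennreal (exp ((W (D k g) \<omega>)\<^sup>2 / (4 * v k g))) \<partial>M) =
          (\<integral>\<^sup>+x. ennreal (exp (x\<^sup>2 / (4 * v k g))) \<partial>distr M borel (W (D k g)))"
        by (rule nn_integral_distr[symmetric]) (use noise_measurable[OF D2] in simp_all)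
      also have "\<dots> \<le> 2"
        unfolding distr_noise[OF D2] v_def by (rule centered_normal_exp_square) simp
      finally show "(\<integral>\<^sup>+\<omega>. ennreal (exp ((W (D k g) \<omega>)\<^sup>2 / (4 * v k g))) \<partial>M) \<le> 2" .
    qed simp
    also have "\<dots> = ennreal (c k * (1 / c k * 2))"
      using cpos[of k] by (simp add: ennreal_of_nat_eq_real_of_nat c_def ennreal_mult[symmetric] flip: ennreal_numeral)
    also have "c k * (1 / c k * 2) = 2" using cpos[of k] by simp
    finally show ?thesis by simp
  qed
  \<comment> \<open>The random minimiser may be any tuple of net points, so linearity must hold for
    all of them on one event; there are finitely many.\<close>
  have lin: "AE \<omega> in M. \<forall>g\<in>PiE UNIV N. W (\<lambda>x. \<Sum>k\<in>UNIV. S k (g k) x) \<omega> = (\<Sum>k\<in>UNIV. W (S k (g k)) \<omega>)"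
  proof -
    have "finite (PiE UNIV N)" using N(1) by (intro finite_PiE) auto
    moreover have "AE \<omega> in M. W (\<lambda>x. \<Sum>k\<in>UNIV. S k (g k) x) \<omega> = (\<Sum>k\<in>UNIV. W (S k (g k)) \<omega>)" for g
      using noise_linear[of UNIV "\<lambda>k. S k (g k)" "\<lambda>_. 1"] S2 by simp
    ultimately show ?thesis by (subst AE_finite_all) auto
  qed
  have dif: "AE \<omega> in M. \<forall>g\<in>N k. W (D k g) \<omega> = W (S k g) \<omega> - W (S k (g0 k)) \<omega>" for k
  proof -
    \<comment> \<open>The difference is a combination over the index set {True, False} with
      coefficients 1 and -1.\<close>
    have "AE \<omega> in M. W (D k g) \<omega> = W (S k g) \<omega> - W (S k (g0 k)) \<omega>" for g
      using noise_linear[of "{True, False}" "\<lambda>i. if i then S k g else S k (g0 k)" "\<lambda>i. if i then 1 else -1"] S2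
      by (simp add: D_def if_distrib if_distribR split: if_splits)
    then show ?thesis using N(1)[of k] by (subst AE_finite_all) auto
  qed
  \<comment> \<open>For variance 0 the quotient in \<open>B\<close> is 0 and controls nothing; the
    increment itself then vanishes almost surely.\<close>
  have zer: "AE \<omega> in M. \<forall>g\<in>N k. v k g = 0 \<longrightarrow> W (D k g) \<omega> = 0" for k
  proof -
    have "AE \<omega> in M. v k g = 0 \<longrightarrow> W (D k g) \<omega> = 0" for g
    proof (cases "v k g = 0")
      case True
      have "(L2_norm M (W (D k g)))\<^sup>2 = 0"
        using True by (simp add: L2_inner_self[symmetric] noise_isometry D2 v_def)
      then show ?thesis using L2_norm_zero_AE[OF noise_L2[OF D2[of k g]]] by auto
    qed simp
    then show ?thesis using N(1)[of k] by (subst AE_finite_all) auto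
  qed
  have ptw: "(L2_norm cube_leb (\<lambda>x. T (observation a W n F \<omega>) x - F x))\<^sup>2 \<le>
      (\<Sum>k\<in>UNIV. 3 * (\<delta> k)\<^sup>2 + 32 * \<epsilon>\<^sup>2 * (\<rho> k)\<^sup>2 * (ln (c k) + B k \<omega>))"
    if lin: "\<forall>g\<in>PiE UNIV N. W (\<lambda>x. \<Sum>k\<in>UNIV. S k (g k) x) \<omega> = (\<Sum>k\<in>UNIV. W (S k (g k)) \<omega>)"
      and dif: "\<forall>k. \<forall>g\<in>N k. W (D k g) \<omega> = W (S k g) \<omega> - W (S k (g0 k)) \<omega>"
      and zer: "\<forall>k. \<forall>g\<in>N k. v k g = 0 \<longrightarrow> W (D k g) \<omega> = 0" for \<omega>
  proof -
    define y where "y = observation a W n F \<omega>"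
    have ysp: "y \<in> space data_space" by (simp add: y_def observation_def data_space_def space_PiM)
    have yh: "y h = L2_inner cube_leb h (conv a F) + \<epsilon> * W h \<omega>" if "h \<in> L2 cube_leb" for h
      using that by (simp add: y_def observation_def \<epsilon>_def)
    define \<Phi> where "\<Phi> k g = - 2 * (L2_inner unit_leb g (f k) + \<epsilon> * W (S k g) \<omega>) + (L2_norm unit_leb g)\<^sup>2" for k g
    \<comment> \<open>Orthogonality splits the squared norm, the identity for \<open>Q\<close>
      splits the mean, and linearity on the chosen event splits the noise.\<close>
    have emp: "empirical_risk Q y (\<lambda>x. \<Sum>k\<in>UNIV. g k (x k)) = (\<Sum>k\<in>UNIV. \<Phi> k (g k))" if g: "\<And>k. g k \<in> N k" for g
    proof -
      have gt: "g k \<in> trig_polys (m k)" for k using g N(2) by blast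
      have Qg: "Q (\<lambda>x. \<Sum>k\<in>UNIV. g k (x k)) = (\<lambda>x. \<Sum>k\<in>UNIV. S k (g k) x)"
        unfolding S_def by (rule inverse_adjoint_additive[OF Q gt])
      have "L2_inner cube_leb (\<lambda>x. \<Sum>k\<in>UNIV. S k (g k) x) (conv a F) = (\<Sum>k\<in>UNIV. LINT x|cube_leb. S k (g k) x * conv a F x)"
        unfolding L2_inner_def sum_distrib_right S_def F_def
        by (intro Bochner_Integration.integral_sum inverse_series_inner_conv(1)[OF a mar ser b f gt])
      also have "\<dots> = (\<Sum>k\<in>UNIV. L2_inner unit_leb (g k) (f k))"
        using inverse_series_inner_conv(2)[OF a mar ser b f gt]
        by (simp add: S_def F_def L2_inner_def[of cube_leb])
      finally have "y (\<lambda>x. \<Sum>k\<in>UNIV. S k (g k) x) = (\<Sum>k\<in>UNIV. L2_inner unit_leb (g k) (f k) + \<epsilon> * W (S k (g k)) \<omega>)"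
        using lin g by (subst yh) (auto intro: L2_sum S2 simp: sum.distrib sum_distrib_left PiE_def)
      moreover have "(L2_norm cube_leb (\<lambda>x. \<Sum>k\<in>UNIV. g k (x k)))\<^sup>2 = (\<Sum>k\<in>UNIV. (L2_norm unit_leb (g k))\<^sup>2)"
        by (rule L2_norm_additive) (use N2[OF g] Nz[OF g] in auto)
      ultimately show ?thesis
        by (simp add: empirical_risk_def Qg \<Phi>_def sum.distrib sum_distrib_left sum_subtractf sum_negf)
    qed
    have am: "is_arg_min (empirical_risk Q y) (\<lambda>g. g \<in> additive_class N) (T y)"
      using T ysp by (simp add: net_estimator_def)
    then have "T y \<in> additive_class N" by (simp add: is_arg_min_def)
    then obtain g where g: "\<And>k. g k \<in> N k" and Ty: "T y = (\<lambda>x. \<Sum>k\<in>UNIV. g k (x k))"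
      unfolding additive_class_def by auto
    \<comment> \<open>Changing one component of the minimiser stays in the additive net and leaves
      the other summands alone, so every component minimises its own
      \<open>\<Phi> k\<close>.\<close>
    have \<Phi>_le: "\<Phi> k (g k) \<le> \<Phi> k h" if h: "h \<in> N k" for k h
    proof -
      define g' where "g' = g(k := h)"
      have g': "g' l \<in> N l" for l using g h by (simp add: g'_def)
      have "(\<lambda>x. \<Sum>k\<in>UNIV. g' k (x k)) \<in> additive_class N"
        unfolding additive_class_def using g' by auto
      then have "empirical_risk Q y (T y) \<le> empirical_risk Q y (\<lambda>x. \<Sum>k\<in>UNIV. g' k (x k))"
        using am by (auto simp: is_arg_min_def not_less)
      then have "(\<Sum>k\<in>UNIV. \<Phi> k (g k)) \<le> (\<Sum>k\<in>UNIV. \<Phi> k (g' k))"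
        by (simp add: Ty emp[of g, OF g] emp[of g', OF g'])
      moreover have "(\<Sum>l\<in>UNIV - {k}. \<Phi> l (g' l)) = (\<Sum>l\<in>UNIV - {k}. \<Phi> l (g l))"
        by (intro sum.cong) (auto simp: g'_def)
      ultimately show ?thesis
        by (simp add: sum.remove[of UNIV k] g'_def)
    qed
    have one: "(L2_norm unit_leb (\<lambda>t. g k t - f k t))\<^sup>2 \<le> 3 * (\<delta> k)\<^sup>2 + 32 * \<epsilon>\<^sup>2 * (\<rho> k)\<^sup>2 * (ln (c k) + B k \<omega>)" for k
    proof (rule peeling_bound)
      let ?V = "W (D k (g k)) \<omega>"
      note gk = N2[OF g[of k]] and g0k = N2[OF g0(1)[of k]]
      have d0: "(L2_norm unit_leb (\<lambda>t. g0 k t - f k t))\<^sup>2 \<le> (\<delta> k)\<^sup>2"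
        using g0(2)[of k] by (subst L2_norm_diff_commute) (simp add: power_mono)
      \<comment> \<open>Up to the common term |f k|^2, \<open>\<Phi> k h\<close> is |h - f k|^2
        minus 2 \<epsilon> times the noise at \<open>S k h\<close>; comparison with
        \<open>g0\<close> bounds the loss by \<delta>^2 and a noise increment.\<close>
      have "\<Phi> k (g k) \<le> \<Phi> k (g0 k)" by (rule \<Phi>_le[OF g0(1)])
      moreover have V: "?V = W (S k (g k)) \<omega> - W (S k (g0 k)) \<omega>" using dif g by simp
      ultimately show "(L2_norm unit_leb (\<lambda>t. g k t - f k t))\<^sup>2 \<le> (\<delta> k)\<^sup>2 + 2 * \<epsilon> * ?V"
        using d0 unfolding V by (simp add: \<Phi>_def L2_norm_power2_diff gk g0k f2 algebra_simps)
      show "(L2_norm unit_leb (\<lambda>t. g k t - g0 k t))\<^sup>2 \<le> 2 * (L2_norm unit_leb (\<lambda>t. g k t - f k t))\<^sup>2 + 2 * (\<delta> k)\<^sup>2"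
      proof -
        have "(L2_norm unit_leb (\<lambda>t. g k t - g0 k t))\<^sup>2 \<le> (LINT t|unit_leb. 2 * (g k t - f k t)\<^sup>2 + 2 * (g0 k t - f k t)\<^sup>2)"
          unfolding L2_norm_power2
        proof (rule integral_mono)
          show "(g k t - g0 k t)\<^sup>2 \<le> 2 * (g k t - f k t)\<^sup>2 + 2 * (g0 k t - f k t)\<^sup>2" for t
            using zero_le_power2[of "(g k t - f k t) + (g0 k t - f k t)"] by (simp add: power2_eq_square algebra_simps)
        qed (use L2D(2)[OF L2_diff[OF gk g0k]] L2D(2)[OF L2_diff[OF gk f2]] L2D(2)[OF L2_diff[OF g0k f2]] in auto)
        also have "\<dots> = 2 * (L2_norm unit_leb (\<lambda>t. g k t - f k t))\<^sup>2 + 2 * (L2_norm unit_leb (\<lambda>t. g0 k t - f k t))\<^sup>2"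
          using L2D(2)[OF L2_diff[OF gk f2]] L2D(2)[OF L2_diff[OF g0k f2]] by (simp add: L2_norm_power2)
        finally show ?thesis using d0 by simp
      qed
      have "v k (g k) = (L2_norm unit_leb (\<lambda>t. inverse_series (b k) (m k) (g k) t - inverse_series (b k) (m k) (g0 k) t))\<^sup>2"
        unfolding v_def D_def S_def
        by (subst L2_norm_cube_coord[where u="\<lambda>t. inverse_series (b k) (m k) (g k) t - inverse_series (b k) (m k) (g0 k) t"])
           (simp_all add: L2_diff inverse_series_L2)
      also have "\<dots> \<le> (\<rho> k)\<^sup>2 * (L2_norm unit_leb (\<lambda>t. g k t - g0 k t))\<^sup>2"
      proof (rule inverse_series_norm_diff[OF gk g0k])
        fix j assume "1 \<le> j" "j \<le> m k"
        then show "\<bar>inverse (b k j / sqrt 2)\<bar> \<le> \<rho> k" using \<rho>[of j k] b[of j k] by simp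
      qed
      finally show "v k (g k) \<le> (\<rho> k)\<^sup>2 * (L2_norm unit_leb (\<lambda>t. g k t - g0 k t))\<^sup>2" .
      show "0 \<le> ln (c k) + B k \<omega>" using cpos B0 by (simp add: add_nonneg_nonneg)
      show "?V\<^sup>2 \<le> 4 * v k (g k) * (ln (c k) + B k \<omega>)"
      proof (cases "v k (g k) = 0")
        case True
        then show ?thesis using zer g by simp
      next
        case False
        then have vpos: "v k (g k) > 0" by (simp add: v_def)
        \<comment> \<open>The inequality x \<le> exp x is applied after subtracting
          \<open>ln (c k)\<close>, which turns the exponential into one term of the average
          \<open>B k\<close>.\<close>
        have "?V\<^sup>2 / (4 * v k (g k)) - ln (c k) \<le> exp (?V\<^sup>2 / (4 * v k (g k)) - ln (c k))"
          using exp_ge_add_one_self[of "?V\<^sup>2 / (4 * v k (g k)) - ln (c k)"] by linarith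
        also have "\<dots> = exp (?V\<^sup>2 / (4 * v k (g k))) / c k"
          using cpos[of k] by (simp add: exp_diff)
        also have "\<dots> \<le> B k \<omega>"
          unfolding B_def using cpos[of k] N(1)[of k] g[of k]
          by (intro divide_right_mono member_le_sum) auto
        finally have "?V\<^sup>2 / (4 * v k (g k)) \<le> ln (c k) + B k \<omega>" by simp
        then show ?thesis using vpos by (simp add: pos_divide_le_eq mult_ac)
      qed
    qed
    have "(L2_norm cube_leb (\<lambda>x. T y x - F x))\<^sup>2 = (L2_norm cube_leb (\<lambda>x. \<Sum>k\<in>UNIV. (\<lambda>t. g k t - f k t) (x k)))\<^sup>2"
      by (simp add: Ty F_def sum_subtractf)
    also have "\<dots> = (\<Sum>k\<in>UNIV. (L2_norm unit_leb (\<lambda>t. g k t - f k t))\<^sup>2)"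
      using N2[OF g] Nz[OF g] f2 fz
      by (intro L2_norm_additive L2_diff) (auto simp: unit.L2_integrable)
    also have "\<dots> \<le> (\<Sum>k\<in>UNIV. 3 * (\<delta> k)\<^sup>2 + 32 * \<epsilon>\<^sup>2 * (\<rho> k)\<^sup>2 * (ln (c k) + B k \<omega>))"
      by (intro sum_mono one)
    finally show ?thesis by (simp add: y_def)
  qed
  have "AE \<omega> in M. \<forall>k\<in>UNIV. \<forall>g\<in>N k. W (D k g) \<omega> = W (S k g) \<omega> - W (S k (g0 k)) \<omega>"
    using dif by (subst AE_finite_all) auto
  moreover have "AE \<omega> in M. \<forall>k\<in>UNIV. \<forall>g\<in>N k. v k g = 0 \<longrightarrow> W (D k g) \<omega> = 0"
    using zer by (subst AE_finite_all) auto
  ultimately have "AE \<omega> in M. ennreal ((L2_norm cube_leb (\<lambda>x. T (observation a W n F \<omega>) x - F x))\<^sup>2) \<le>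
      ennreal (\<Sum>k\<in>UNIV. 3 * (\<delta> k)\<^sup>2 + 32 * \<epsilon>\<^sup>2 * (\<rho> k)\<^sup>2 * (ln (c k) + B k \<omega>))"
    using lin by eventually_elim (intro ennreal_leI ptw, auto)
  then have "risk a M W n T F \<le> (\<integral>\<^sup>+\<omega>. ennreal (\<Sum>k\<in>UNIV. 3 * (\<delta> k)\<^sup>2 + 32 * \<epsilon>\<^sup>2 * (\<rho> k)\<^sup>2 * (ln (c k) + B k \<omega>)) \<partial>M)"
    unfolding risk_def by (rule nn_integral_mono_AE)
  \<comment> \<open>The constant and the term with \<open>B k\<close> are both nonnegative, so the
    expectation can be taken termwise and \<open>EB\<close> inserted.\<close>
  also have "\<dots> = (\<integral>\<^sup>+\<omega>. (\<Sum>k\<in>UNIV. ennreal (3 * (\<delta> k)\<^sup>2 + 32 * \<epsilon>\<^sup>2 * (\<rho> k)\<^sup>2 * ln (c k)) + ennreal (32 * \<epsilon>\<^sup>2 * (\<rho> k)\<^sup>2) * ennreal (B k \<omega>)) \<partial>M)"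
  proof (rule nn_integral_cong)
    fix \<omega>
    have nn: "0 \<le> 3 * (\<delta> k)\<^sup>2 + 32 * \<epsilon>\<^sup>2 * (\<rho> k)\<^sup>2 * ln (c k)" "0 \<le> 32 * \<epsilon>\<^sup>2 * (\<rho> k)\<^sup>2 * B k \<omega>" for k
      using cpos[of k] B0[of k \<omega>] by (auto intro!: add_nonneg_nonneg mult_nonneg_nonneg)
    have e: "ennreal (3 * (\<delta> k)\<^sup>2 + 32 * \<epsilon>\<^sup>2 * (\<rho> k)\<^sup>2 * ln (c k)) + ennreal (32 * \<epsilon>\<^sup>2 * (\<rho> k)\<^sup>2) * ennreal (B k \<omega>) =
        ennreal (3 * (\<delta> k)\<^sup>2 + 32 * \<epsilon>\<^sup>2 * (\<rho> k)\<^sup>2 * (ln (c k) + B k \<omega>))" for k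
      using nn[of k] B0[of k \<omega>] by (simp add: ennreal_mult[symmetric] ennreal_plus[symmetric] distrib_left add.assoc del: ennreal_plus)
    then show "ennreal (\<Sum>k\<in>UNIV. 3 * (\<delta> k)\<^sup>2 + 32 * \<epsilon>\<^sup>2 * (\<rho> k)\<^sup>2 * (ln (c k) + B k \<omega>)) =
      (\<Sum>k\<in>UNIV. ennreal (3 * (\<delta> k)\<^sup>2 + 32 * \<epsilon>\<^sup>2 * (\<rho> k)\<^sup>2 * ln (c k)) + ennreal (32 * \<epsilon>\<^sup>2 * (\<rho> k)\<^sup>2) * ennreal (B k \<omega>))"
      unfolding e using nn by (intro sum_ennreal[symmetric]) (simp add: distrib_left add.assoc[symmetric])
  qed
  also have "\<dots> = (\<Sum>k\<in>UNIV. ennreal (3 * (\<delta> k)\<^sup>2 + 32 * \<epsilon>\<^sup>2 * (\<rho> k)\<^sup>2 * ln (c k)) + ennreal (32 * \<epsilon>\<^sup>2 * (\<rho> k)\<^sup>2) * (\<integral>\<^sup>+\<omega>. ennreal (B k \<omega>) \<partial>M))"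
    by (subst nn_integral_sum) (simp_all add: nn_integral_add nn_integral_cmult emeasure_space_1)
  also have "\<dots> \<le> (\<Sum>k\<in>UNIV. ennreal (3 * (\<delta> k)\<^sup>2 + 32 * \<epsilon>\<^sup>2 * (\<rho> k)\<^sup>2 * ln (c k)) + ennreal (32 * \<epsilon>\<^sup>2 * (\<rho> k)\<^sup>2) * 2)"
    by (intro sum_mono add_left_mono mult_left_mono EB) simp
  also have "\<dots> = (\<Sum>k\<in>UNIV. ennreal (3 * (\<delta> k)\<^sup>2 + 32 * \<epsilon>\<^sup>2 * (\<rho> k)\<^sup>2 * (ln (c k) + 2)))"
  proof (intro sum.cong refl)
    fix k
    have nn: "0 \<le> 3 * (\<delta> k)\<^sup>2 + 32 * \<epsilon>\<^sup>2 * (\<rho> k)\<^sup>2 * ln (c k)"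
      using cpos[of k] by (auto intro!: add_nonneg_nonneg mult_nonneg_nonneg)
    have "ennreal (32 * \<epsilon>\<^sup>2 * (\<rho> k)\<^sup>2) * 2 = ennreal (32 * \<epsilon>\<^sup>2 * (\<rho> k)\<^sup>2 * 2)"
      by (subst ennreal_numeral[symmetric], subst ennreal_mult[symmetric]) simp_all
    then show "ennreal (3 * (\<delta> k)\<^sup>2 + 32 * \<epsilon>\<^sup>2 * (\<rho> k)\<^sup>2 * ln (c k)) + ennreal (32 * \<epsilon>\<^sup>2 * (\<rho> k)\<^sup>2) * 2 =
        ennreal (3 * (\<delta> k)\<^sup>2 + 32 * \<epsilon>\<^sup>2 * (\<rho> k)\<^sup>2 * (ln (c k) + 2))"
      using nn by (simp add: ennreal_plus[symmetric] distrib_left add.assoc del: ennreal_plus)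
  qed
  also have "\<dots> = ennreal (\<Sum>k\<in>UNIV. 3 * (\<delta> k)\<^sup>2 + 32 * \<epsilon>\<^sup>2 * (\<rho> k)\<^sup>2 * (ln (c k) + 2))"
    using cpos by (intro sum_ennreal add_nonneg_nonneg mult_nonneg_nonneg) auto
  finally show ?thesis by (simp add: F_def \<epsilon>_def c_def)
qed

section \<open>From the risk bound to the rate\<close>

lemma net_term_bound:
  fixes \<delta> \<rho> K K' s q C :: real and n :: nat
  assumes n: "n \<ge> 1" and s: "s > 0" and q: "q \<ge> 0" and C: "C \<ge> 0" and K: "K \<ge> 0" "K' \<ge> 0"
    and \<delta>: "\<delta> = net_radius s q n"
    and \<rho>: "\<rho> = C * (K * \<delta> powr (- 1 / s)) powr q"
    and l: "l \<le> K' * \<delta> powr (- 1 / s)"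
  shows "3 * \<delta>\<^sup>2 + 32 * (real n powr (- 1 / 2))\<^sup>2 * \<rho>\<^sup>2 * (l + 2) \<le>
    (3 + 32 * C\<^sup>2 * (K powr q)\<^sup>2 * (K' + 2)) * real n powr (- (2 * s / (2 * s + 2 * q + 1)))"
proof -
  define p where "p = 2 * s + 2 * q + 1"
  have p: "p > 0" using s q by (simp add: p_def)
  have n0: "real n > 0" using n by simp
  have d: "\<delta> = real n powr (- s / p)" by (simp add: \<delta> net_radius_def p_def)
  have d1: "\<delta> powr (- 1 / s) = real n powr (1 / p)" using s by (simp add: d powr_powr)
  have ge1: "1 \<le> real n powr (1 / p)" using n p by (simp add: ge_one_powr_ge_zero)
  \<comment> \<open>n^(1/p) \<ge> 1 lets the entropy term absorb the additive 2.\<close>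
  have l2: "l + 2 \<le> (K' + 2) * real n powr (1 / p)"
    using l ge1 unfolding d1 by (simp add: distrib_right)
  have \<rho>2: "\<rho>\<^sup>2 = C\<^sup>2 * (K powr q)\<^sup>2 * real n powr (2 * q / p)"
    unfolding \<rho> d1 using K n0 by (simp add: powr_mult powr_powr power_mult_distrib powr_power mult.assoc)
  have n2: "(real n powr (- 1 / 2))\<^sup>2 = real n powr (- 1)"
    using n0 by (simp add: powr_power)
  have \<delta>2: "\<delta>\<^sup>2 = real n powr (- (2 * s / p))" using n0 by (simp add: d powr_power)
  have ex: "real n powr (- 1) * real n powr (2 * q / p) * real n powr (1 / p) = real n powr (- (2 * s / p))"
  proof -
    have "- 1 + 2 * q / p + 1 / p = - (2 * s / p)" using p by (simp add: field_simps p_def)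
    then show ?thesis by (simp only: powr_add[symmetric])
  qed
  have "32 * (real n powr (- 1 / 2))\<^sup>2 * \<rho>\<^sup>2 * (l + 2) \<le> 32 * (real n powr (- 1 / 2))\<^sup>2 * \<rho>\<^sup>2 * ((K' + 2) * real n powr (1 / p))"
    by (intro mult_left_mono l2) simp
  also have "\<dots> = (32 * C\<^sup>2 * (K powr q)\<^sup>2 * (K' + 2)) * (real n powr (- 1) * real n powr (2 * q / p) * real n powr (1 / p))"
    by (simp only: n2 \<rho>2 mult_ac)
  finally show ?thesis unfolding ex \<delta>2 p_def[symmetric] by (simp add: distrib_right)
qed

text \<open>The size bounds in \<open>delta_nets\<close> hold for small positive radii; this
  transfers them to all large n.\<close>

lemma net_radius_tendsto:
  assumes "s > 0" "q \<ge> 0"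
  shows "filterlim (net_radius s q) (at_right 0) sequentially"
proof -
  have p: "2 * s + 2 * q + 1 > 0" using assms by simp
  have "(\<lambda>n. real n powr (- (s / (2 * s + 2 * q + 1)))) \<longlonglongrightarrow> 0"
    using assms p by (intro tendsto_neg_powr filterlim_real_sequentially) simp
  moreover have "\<forall>\<^sub>F n in sequentially. net_radius s q n > 0"
    using eventually_gt_at_top[of 0] by eventually_elim (simp add: net_radius_def)
  ultimately show ?thesis
    by (simp add: filterlim_at net_radius_def[abs_def] eventually_mono)
qed

text \<open>\<alpha> is at most the exponent of every coordinate, so for n \<ge> 1 each of the
  finitely many error terms is at most a constant times n powr (- \<alpha>), uniformly over the
  class.\<close>

lemma (in noise) net_estimator_rate:
  fixes a :: "('d \<Rightarrow> real) \<Rightarrow> real" and b w :: "'d \<Rightarrow> nat \<Rightarrow> real" and s q L :: "'d \<Rightarrow> real"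
  assumes a: "integrable cube_leb a" and mar: "\<And>k. marginal k a \<in> L2 unit_leb"
    and ser: "\<And>k. L2_sums unit_leb (\<lambda>j t. b k j * cos_basis j t) (marginal k a)"
    and q: "\<And>k. q k \<ge> 0" and C: "C\<^sub>2 > 0"
    and b: "\<And>k j. j \<ge> 1 \<Longrightarrow> C\<^sub>2 * real j powr (- q k) \<le> b k j"
    and s: "\<And>k. s k > 0"
    and Q: "inverse_adjoint b Q"
    and net: "\<And>k. delta_nets (ellipsoid (w k) (L k)) (s k) (net k)"
    and T: "\<And>n. n \<ge> 1 \<Longrightarrow> net_estimator Q (additive_class (\<lambda>k. net k (net_radius (s k) (q k) n))) (T n)"
    and \<alpha>: "\<And>k. \<alpha> \<le> 2 * s k / (2 * s k + 2 * q k + 1)"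
  shows "\<exists>C. \<forall>\<^sub>F n in sequentially.
    ennreal (real n powr \<alpha>) * (SUP f\<in>additive_class (\<lambda>k. ellipsoid (w k) (L k)). risk a M W n (T n) f) \<le> ennreal C"
proof -
  have bpos: "b k j > 0" if "j \<ge> 1" for k j
  proof -
    have "0 < C\<^sub>2 * real j powr (- q k)" using C that by simp
    then show ?thesis using b[OF that, of k] by linarith
  qed
  define P where "P k K K' \<longleftrightarrow> (\<forall>\<^sub>F \<delta> in at_right 0.
      (\<exists>m. real m \<le> K * \<delta> powr (- 1 / s k) \<and> net k \<delta> \<subseteq> trig_polys m) \<and>
      ln (real (card (net k \<delta>))) \<le> K' * \<delta> powr (- 1 / s k))" for k K K'
  have "\<exists>K K'. P k K K'" for k
    using net[of k] by (simp add: delta_nets_def P_def)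
  then obtain K0 K0' where "\<And>k. P k (K0 k) (K0' k)" by metis
  note K0 = this[unfolded P_def]
  \<comment> \<open>Replacing the constants by nonnegative ones, as \<open>net_term_bound\<close>
    requires, preserves the bounds because they multiply nonnegative powers.\<close>
  define K where "K k = max (K0 k) 0" for k
  define K' where "K' k = max (K0' k) 0" for k
  have K: "K k \<ge> 0" "K' k \<ge> 0" "K0 k \<le> K k" "K0' k \<le> K' k" for k by (simp_all add: K_def K'_def)
  define Ck where "Ck k = 3 + 32 * (sqrt 2 / C\<^sub>2)\<^sup>2 * (K k powr q k)\<^sup>2 * (K' k + 2)" for k
  have Ck: "Ck k \<ge> 0" for k using K(2)[of k] by (simp add: Ck_def add_nonneg_nonneg)
  define \<delta> where "\<delta> n k = net_radius (s k) (q k) n" for n k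
  \<comment> \<open>There are finitely many coordinates, so one threshold for n serves them
    all.\<close>
  have ev: "\<forall>\<^sub>F n in sequentially. \<forall>k\<in>UNIV.
      (\<exists>m. real m \<le> K0 k * \<delta> n k powr (- 1 / s k) \<and> net k (\<delta> n k) \<subseteq> trig_polys m) \<and>
      ln (real (card (net k (\<delta> n k)))) \<le> K0' k * \<delta> n k powr (- 1 / s k)"
    unfolding \<delta>_def
    by (intro eventually_ball_finite ballI eventually_compose_filterlim[OF K0 net_radius_tendsto] s q) simp
  have "\<forall>\<^sub>F n in sequentially.
    ennreal (real n powr \<alpha>) * (SUP f\<in>additive_class (\<lambda>k. ellipsoid (w k) (L k)). risk a M W n (T n) f)
      \<le> ennreal (\<Sum>k\<in>UNIV. Ck k)"
    using ev eventually_ge_at_top[of 1]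
  proof eventually_elim
    case (elim n)
    then have n: "n \<ge> 1" by simp
    obtain m where m: "\<And>k. real (m k) \<le> K0 k * \<delta> n k powr (- 1 / s k)" "\<And>k. net k (\<delta> n k) \<subseteq> trig_polys (m k)"
    proof -
      have "\<forall>k. \<exists>m. real m \<le> K0 k * \<delta> n k powr (- 1 / s k) \<and> net k (\<delta> n k) \<subseteq> trig_polys m"
        using elim(1) by blast
      from choice[OF this] show ?thesis using that by blast
    qed
    have lc: "ln (real (card (net k (\<delta> n k)))) \<le> K' k * \<delta> n k powr (- 1 / s k)" for k
    proof -
      have "ln (real (card (net k (\<delta> n k)))) \<le> K0' k * \<delta> n k powr (- 1 / s k)" using elim(1) by simp
      also have "\<dots> \<le> K' k * \<delta> n k powr (- 1 / s k)" by (intro mult_right_mono K) simp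
      finally show ?thesis .
    qed
    have \<delta>0: "\<delta> n k > 0" for k using n by (simp add: \<delta>_def net_radius_def)
    define \<rho> where "\<rho> k = sqrt 2 / C\<^sub>2 * (K k * \<delta> n k powr (- 1 / s k)) powr q k" for k
    \<comment> \<open>\<open>Q\<close> amplifies frequency j by at most
      \<open>sqrt 2 / C\<^sub>2 * real j powr q k\<close>, and j is at most the degree of the
      net.\<close>
    have \<rho>: "inverse (b k j / sqrt 2) \<le> \<rho> k" if j: "1 \<le> j" "j \<le> m k" for k j
    proof -
      have "real j \<le> real (m k)" using j by simp
      also have "\<dots> \<le> K0 k * \<delta> n k powr (- 1 / s k)" by (rule m)
      also have "\<dots> \<le> K k * \<delta> n k powr (- 1 / s k)" by (intro mult_right_mono K) simp
      finally have jk: "real j \<le> K k * \<delta> n k powr (- 1 / s k)" .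
      have "inverse (b k j / sqrt 2) = sqrt 2 / b k j" by simp
      also have "\<dots> \<le> sqrt 2 / (C\<^sub>2 * real j powr (- q k))"
        using b[OF j(1), of k] C j by (intro divide_left_mono mult_pos_pos bpos) auto
      also have "\<dots> = sqrt 2 / C\<^sub>2 * real j powr q k"
        using C by (simp add: powr_minus field_simps)
      also have "\<dots> \<le> \<rho> k"
        unfolding \<rho>_def using C q jk by (intro mult_left_mono powr_mono2) auto
      finally show ?thesis .
    qed
    have bound: "risk a M W n (T n) g \<le> ennreal ((\<Sum>k\<in>UNIV. Ck k) * real n powr (- \<alpha>))"
      if g: "g \<in> additive_class (\<lambda>k. ellipsoid (w k) (L k))" for g
    proof -
      from g obtain f where f: "\<And>k. f k \<in> ellipsoid (w k) (L k)" and gf: "g = (\<lambda>x. \<Sum>k\<in>UNIV. f k (x k))"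
        unfolding additive_class_def by auto
      have dn: "finite (net k (\<delta> n k))" "\<exists>g\<in>net k (\<delta> n k). L2_norm unit_leb (\<lambda>t. f k t - g t) \<le> \<delta> n k" for k
        using net[of k] \<delta>0[of k] f[of k] by (auto simp: delta_nets_def)
      then obtain g0 where g0: "\<And>k. g0 k \<in> net k (\<delta> n k)" "\<And>k. L2_norm unit_leb (\<lambda>t. f k t - g0 k t) \<le> \<delta> n k"
        by metis
      have Tn: "net_estimator Q (additive_class (\<lambda>k. net k (\<delta> n k))) (T n)"
        using T[OF n] by (simp add: \<delta>_def)
      have "risk a M W n (T n) g \<le> ennreal (\<Sum>k\<in>UNIV. 3 * (\<delta> n k)\<^sup>2 +
          32 * (real n powr (- 1 / 2))\<^sup>2 * (\<rho> k)\<^sup>2 * (ln (real (card (net k (\<delta> n k)))) + 2))"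
        unfolding gf
        by (rule net_risk_bound[OF a mar ser bpos Q dn(1) m(2) ellipsoid_centered_cosine[OF f] g0 \<rho> Tn])
      also have "\<dots> \<le> ennreal ((\<Sum>k\<in>UNIV. Ck k) * real n powr (- \<alpha>))"
        unfolding sum_distrib_right
      proof (intro ennreal_leI sum_mono)
        fix k
        have "3 * (\<delta> n k)\<^sup>2 + 32 * (real n powr (- 1 / 2))\<^sup>2 * (\<rho> k)\<^sup>2 * (ln (real (card (net k (\<delta> n k)))) + 2)
          \<le> Ck k * real n powr (- (2 * s k / (2 * s k + 2 * q k + 1)))"
          unfolding Ck_def
          by (rule net_term_bound[OF n s q _ K(1,2) _ _ lc]) (use C in \<open>simp_all add: \<delta>_def \<rho>_def\<close>)
        also have "\<dots> \<le> Ck k * real n powr (- \<alpha>)"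
          using n \<alpha>[of k] Ck by (intro mult_left_mono powr_mono) auto
        finally show "3 * (\<delta> n k)\<^sup>2 + 32 * (real n powr (- 1 / 2))\<^sup>2 * (\<rho> k)\<^sup>2 * (ln (real (card (net k (\<delta> n k)))) + 2)
          \<le> Ck k * real n powr (- \<alpha>)" .
      qed
      finally show ?thesis .
    qed
    have "ennreal (real n powr \<alpha>) * (SUP f\<in>additive_class (\<lambda>k. ellipsoid (w k) (L k)). risk a M W n (T n) f)
       \<le> ennreal (real n powr \<alpha>) * ennreal ((\<Sum>k\<in>UNIV. Ck k) * real n powr (- \<alpha>))"
      by (intro mult_left_mono SUP_least bound) simp_all
    also have "\<dots> = ennreal (real n powr \<alpha> * ((\<Sum>k\<in>UNIV. Ck k) * real n powr (- \<alpha>)))"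
      using Ck by (intro ennreal_mult[symmetric] mult_nonneg_nonneg sum_nonneg) auto
    also have "real n powr \<alpha> * ((\<Sum>k\<in>UNIV. Ck k) * real n powr (- \<alpha>)) = (\<Sum>k\<in>UNIV. Ck k)"
      using n by (simp add: powr_minus)
    finally show ?case .
  qed
  then show ?thesis by blast
qed

theorem corollary3:
  fixes a :: "('d::finite \<Rightarrow> real) \<Rightarrow> real"
    and b w :: "'d \<Rightarrow> nat \<Rightarrow> real"
    and q s L :: "'d \<Rightarrow> real"
    and C\<^sub>2 C\<^sub>3 c\<^sub>1 c\<^sub>2 :: real
    and M :: "'w measure"
    and W :: "(('d \<Rightarrow> real) \<Rightarrow> real) \<Rightarrow> 'w \<Rightarrow> real"
  assumes a_periodic: "\<And>x k. a (x(k := x k + 1)) = a x"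
    and a_integrable: "integrable cube_leb a"
    and marginal_periodic: "\<And>k. periodic1 (marginal k a)"
    and marginal_L2: "\<And>k. marginal k a \<in> L2 unit_leb"
    and marginal_series: "\<And>k. L2_sums unit_leb (\<lambda>j t. b k j * cos_basis j t) (marginal k a)"
    and q_nonneg: "\<And>k. q k \<ge> 0"
    and C_pos: "C\<^sub>2 > 0" "C\<^sub>3 > 0"
    and b_bounds: "\<And>k j. j \<ge> 1 \<Longrightarrow>
      C\<^sub>2 * real j powr (- q k) \<le> b k j \<and> b k j \<le> C\<^sub>3 * real j powr (- q k)"
    and L_pos: "\<And>k. L k > 0"
    and s_pos: "\<And>k. s k > 0"
    and c_pos: "c\<^sub>1 > 0" "c\<^sub>2 > 0"
    and w_bounds: "\<And>k j. j \<ge> 1 \<Longrightarrow>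
      c\<^sub>1 * real j powr s k \<le> w k j \<and> w k j \<le> c\<^sub>2 * real j powr s k"
    and noise: "white_noise M W"
  shows
    "(\<forall>Q net fhat.
        inverse_adjoint b Q \<and>
        (\<forall>k. delta_nets (ellipsoid (w k) (L k)) (s k) (net k)) \<and>
        (\<forall>n\<ge>1. net_estimator Q (additive_class (\<lambda>k. net k (net_radius (s k) (q k) n))) (fhat n))
        \<longrightarrow>
        limsup (\<lambda>n. ennreal (real n powr (MIN k. 2 * s k / (2 * s k + 2 * q k + 1))) *
          (SUP f\<in>additive_class (\<lambda>k. ellipsoid (w k) (L k)). risk a M W n (fhat n) f)) < \<infinity>)
     \<and>
     liminf (\<lambda>n. ennreal (real n powr (MIN k. 2 * s k / (2 * s k + 2 * q k + 1))) *
       (INF g\<in>estimators. SUP f\<in>additive_class (\<lambda>k. ellipsoid (w k) (L k)). risk a M W n g f)) > 0"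
proof -
  interpret noise M W by standard (rule noise)
  define \<alpha> where "\<alpha> = (MIN k. 2 * s k / (2 * s k + 2 * q k + 1))"
  have \<alpha>_le: "\<alpha> \<le> 2 * s k / (2 * s k + 2 * q k + 1)" for k
    unfolding \<alpha>_def by (rule Min_le) auto
  have "\<alpha> \<in> range (\<lambda>k. 2 * s k / (2 * s k + 2 * q k + 1))"
    unfolding \<alpha>_def by (rule Min_in) auto
  \<comment> \<open>The minimum over a finite index type is attained; the lower bound for that one
    coordinate has exactly the exponent \<alpha>.\<close>
  then obtain k where k: "\<alpha> = 2 * s k / (2 * s k + 2 * q k + 1)" by blast
  have upper: "limsup (\<lambda>n. ennreal (real n powr \<alpha>) *
      (SUP f\<in>additive_class (\<lambda>k. ellipsoid (w k) (L k)). risk a M W n (fhat n) f)) < \<infinity>"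
    if "inverse_adjoint b Q" "\<And>k. delta_nets (ellipsoid (w k) (L k)) (s k) (net k)"
      "\<And>n. n \<ge> 1 \<Longrightarrow> net_estimator Q (additive_class (\<lambda>k. net k (net_radius (s k) (q k) n))) (fhat n)"
    for Q net fhat
  proof -
    have bl: "C\<^sub>2 * real j powr (- q k) \<le> b k j" if "j \<ge> 1" for k j using b_bounds that by blast
    note net = that
    obtain C where "\<forall>\<^sub>F n in sequentially. ennreal (real n powr \<alpha>) *
        (SUP f\<in>additive_class (\<lambda>k. ellipsoid (w k) (L k)). risk a M W n (fhat n) f) \<le> ennreal C"
      using net_estimator_rate[OF a_integrable marginal_L2 marginal_series q_nonneg C_pos(1) bl s_pos net \<alpha>_le] by blast
    then have "limsup (\<lambda>n. ennreal (real n powr \<alpha>) *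
        (SUP f\<in>additive_class (\<lambda>k. ellipsoid (w k) (L k)). risk a M W n (fhat n) f)) \<le> ennreal C"
      by (rule Limsup_bounded)
    then show ?thesis by (simp add: order_le_less_trans)
  qed
  obtain c where c: "c > 0" and low: "\<And>n T. n \<ge> 1 \<Longrightarrow> T \<in> estimators \<Longrightarrow> ennreal c \<le> ennreal (real n powr \<alpha>) *
      (SUP f\<in>additive_class (\<lambda>k. ellipsoid (w k) (L k)). risk a M W n T f)"
    using minimax_lower_bound[where k=k and b=b and w=w and q="q k" and s="s k" and L=L,
        OF a_integrable marginal_L2 marginal_series q_nonneg C_pos b_bounds L_pos s_pos c_pos w_bounds]
    unfolding k by blast
  have "\<forall>\<^sub>F n in sequentially. ennreal c \<le> ennreal (real n powr \<alpha>) *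
      (INF g\<in>estimators. SUP f\<in>additive_class (\<lambda>k. ellipsoid (w k) (L k)). risk a M W n g f)"
    using eventually_ge_at_top[of 1]
  proof eventually_elim
    case (elim n)
    have pos: "real n powr \<alpha> > 0" using elim by simp
    \<comment> \<open>The factor is divided out so that the bound can be taken for each estimator
      under the infimum, and is multiplied back afterwards.\<close>
    have "ennreal (c / real n powr \<alpha>) \<le> (INF g\<in>estimators. SUP f\<in>additive_class (\<lambda>k. ellipsoid (w k) (L k)). risk a M W n g f)"
    proof (rule INF_greatest)
      fix T :: "'d data \<Rightarrow> ('d \<Rightarrow> real) \<Rightarrow> real" assume "T \<in> estimators"
      from low[OF elim this] have "ennreal (real n powr \<alpha>) * ennreal (c / real n powr \<alpha>) \<le>
          ennreal (real n powr \<alpha>) * (SUP f\<in>additive_class (\<lambda>k. ellipsoid (w k) (L k)). risk a M W n T f)"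
        using pos c by (simp add: ennreal_mult[symmetric])
      then show "ennreal (c / real n powr \<alpha>) \<le> (SUP f\<in>additive_class (\<lambda>k. ellipsoid (w k) (L k)). risk a M W n T f)"
        using pos by (subst (asm) ennreal_mult_le_mult_iff) auto
    qed
    then have "ennreal (real n powr \<alpha>) * ennreal (c / real n powr \<alpha>) \<le> ennreal (real n powr \<alpha>) *
        (INF g\<in>estimators. SUP f\<in>additive_class (\<lambda>k. ellipsoid (w k) (L k)). risk a M W n g f)"
      by (intro mult_left_mono) auto
    then show ?case using pos c by (simp add: ennreal_mult[symmetric])
  qed
  then have "ennreal c \<le> liminf (\<lambda>n. ennreal (real n powr \<alpha>) *
      (INF g\<in>estimators. SUP f\<in>additive_class (\<lambda>k. ellipsoid (w k) (L k)). risk a M W n g f))"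
    by (rule Liminf_bounded)
  then have "0 < liminf (\<lambda>n. ennreal (real n powr \<alpha>) *
      (INF g\<in>estimators. SUP f\<in>additive_class (\<lambda>k. ellipsoid (w k) (L k)). risk a M W n g f))"
    using c by (meson ennreal_less_zero_iff order_less_le_trans)
  then show ?thesis using upper unfolding \<alpha>_def by blast
qed

end
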